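(* Let $X_{N\times NM}$ be a complex Gaussian random matrix of size $N\times NM$. Let $A_M=[a_{i,j}^{(M)}]\in M_M(\mathbb{C})$ be a sequence of selfadjoint matrices such that $\sup_{i,j,M}|a^{(M)}_{i,j}|<\infty$ and such that $\frac1MA_M$ has limit distribution $\mu$ with respect to the nonnormalized trace. Let $P_N$ be a sequence of selfadjoint $N\times N$ deterministic matrices all of whose moments with respect to the normalized trace converge to $1$, i.e. $\lim_{N\to\infty}\frac1N\operatorname{Tr}(P_N^m)=1$ for all $m\in\mathbb{N}$ (for example $P_N=I_N$, or $P_N=I_N-\frac1NJ_N$ with $J_N$ the all-ones matrix). Then the spectral measures of $$\frac1M X_{N\times NM}\,[A_M\otimes P_N]\,X_{N\times NM}^*$$ converge in distribution, as $M,N\to\infty$, to the law of a random variable $Y$ whose free cumulants are $K_r(Y)=\int t^r\,d\mu(t)$ for all $r\ge1$.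
   Context: An $N\times L$ complex Gaussian random matrix has i.i.d. complex Gaussian entries $x_{ij}$ with mean zero and $\mathbb{E}|x_{ij}|^2=\frac1N$, i.e. the real and imaginary parts of all entries form an i.i.d. family of $N(0,\frac1{2N})$ variables. A sequence of $M\times M$ deterministic matrices $B_M$ has limit distribution $\mu$ with respect to the nonnormalized trace, where $\mu$ is a (not necessarily probability) measure on $\mathbb{R}$ with all moments of order $m\ge1$ finite, if $\lim_{M\to\infty}\operatorname{Tr}(B_M^m)=\int t^m\,d\mu(t)$ for every $m\in\mathbb{N}=\{1,2,\dots\}$. Convergence in distribution of random $N\times N$ matrices $W_{M,N}$ to $Y$ means convergence of moments: $\mathbb{E}\big[\frac1N\operatorname{Tr}(W_{M,N}^m)\big]\to\tau(Y^m)$ for all $m\in\mathbb{N}$, as $M,N\to\infty$. Free cumulants $K_n(Y)$ of a random variable $Y$ in $(\mathcal{A},\tau)$ are defined implicitly by $\tau(Y^n)=\sum_{\pi\in NC(n)}\prod_{B\in\pi}K_{|B|}(Y)$, with $NC(n)$ the noncrossing partitions of $\{1,\dots,n\}$. *)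

theory Defs
  imports
    "HOL-Probability.Probability"
    "Jordan_Normal_Form.Schur_Decomposition"
begin

definition mat_trace :: "complex mat \<Rightarrow> complex" where
  "mat_trace B = (\<Sum>i<dim_row B. B $$ (i, i))"

definition selfadjoint_mat :: "nat \<Rightarrow> complex mat \<Rightarrow> bool" where
  "selfadjoint_mat n B \<longleftrightarrow> B \<in> carrier_mat n n \<and> mat_adjoint B = B"

text \<open>The Kronecker product: the block matrix whose block \<open>(i, j)\<close> is \<open>a\<^sub>i\<^sub>j B\<close>.\<close>

definition kronecker :: "complex mat \<Rightarrow> complex mat \<Rightarrow> complex mat" where
  "kronecker A B =
     mat (dim_row A * dim_row B) (dim_col A * dim_col B)
       (\<lambda>(i, j). A $$ (i div dim_row B, j div dim_col B) * B $$ (i mod dim_row B, j mod dim_col B))"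

text \<open>
  The measure \<open>\<mu>\<close> need not be finite: only its moments of order at least \<open>1\<close> are
  required to exist.
\<close>

definition limit_distribution_Tr :: "(nat \<Rightarrow> complex mat) \<Rightarrow> real measure \<Rightarrow> bool" where
  "limit_distribution_Tr B \<mu> \<longleftrightarrow>
     sets \<mu> = sets borel \<and>
     (\<forall>m\<ge>1. integrable \<mu> (\<lambda>t. t ^ m)) \<and>
     (\<forall>m\<ge>1. (\<lambda>M. mat_trace (B M ^\<^sub>m m)) \<longlonglongrightarrow> complex_of_real (\<integral>t. t ^ m \<partial>\<mu>))"

text \<open>
  An \<open>n \<times> l\<close> complex Gaussian random matrix. The real and imaginary parts of all the entries,
  listed by the index \<open>(i, j, b)\<close> with \<open>b\<close> choosing between the two parts, are independent
  with law \<open>N(0, 1/(2n))\<close>; \<open>normal_density\<close> takes the standard deviation.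
\<close>

definition complex_gaussian_matrix ::
    "'w measure \<Rightarrow> nat \<Rightarrow> nat \<Rightarrow> ('w \<Rightarrow> complex mat) \<Rightarrow> bool" where
  "complex_gaussian_matrix \<Omega> n l X \<longleftrightarrow>
     prob_space \<Omega> \<and>
     (\<forall>\<omega>\<in>space \<Omega>. X \<omega> \<in> carrier_mat n l) \<and>
     prob_space.indep_vars \<Omega> (\<lambda>_. borel :: real measure)
       (\<lambda>(i, j, b) \<omega>. if b then Re (X \<omega> $$ (i, j)) else Im (X \<omega> $$ (i, j)))
       ({..<n} \<times> {..<l} \<times> (UNIV :: bool set)) \<and>
     (\<forall>i<n. \<forall>j<l.
        distributed \<Omega> lborel (\<lambda>\<omega>. Re (X \<omega> $$ (i, j)))
          (\<lambda>x. ennreal (normal_density 0 (sqrt (1 / (2 * real n))) x)) \<and>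
        distributed \<Omega> lborel (\<lambda>\<omega>. Im (X \<omega> $$ (i, j)))
          (\<lambda>x. ennreal (normal_density 0 (sqrt (1 / (2 * real n))) x)))"

text \<open>
  Convergence in distribution of random \<open>N \<times> N\<close> matrices \<open>W M N\<close>, as \<open>M\<close> and \<open>N\<close> tend
  to infinity jointly, to a real random variable with law \<open>\<nu>\<close>.
\<close>

definition converges_in_moments ::
    "(nat \<Rightarrow> nat \<Rightarrow> 'w measure) \<Rightarrow> (nat \<Rightarrow> nat \<Rightarrow> 'w \<Rightarrow> complex mat) \<Rightarrow> real measure \<Rightarrow> bool" where
  "converges_in_moments \<Omega> W \<nu> \<longleftrightarrow>
     (\<forall>m\<ge>1. ((\<lambda>(M, N). \<integral>\<omega>. mat_trace (W M N \<omega> ^\<^sub>m m) / of_nat N \<partial>\<Omega> M N)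
                \<longlongrightarrow> complex_of_real (\<integral>x. x ^ m \<partial>\<nu>)) (sequentially \<times>\<^sub>F sequentially))"

definition noncrossing :: "nat set set \<Rightarrow> bool" where
  "noncrossing \<pi> \<longleftrightarrow>
     \<not> (\<exists>B\<in>\<pi>. \<exists>C\<in>\<pi>. B \<noteq> C \<and>
          (\<exists>a b c d. a < b \<and> b < c \<and> c < d \<and> a \<in> B \<and> c \<in> B \<and> b \<in> C \<and> d \<in> C))"

definition NC :: "nat \<Rightarrow> nat set set set" where
  "NC n = {\<pi>. partition_on {1..n} \<pi> \<and> noncrossing \<pi>}"

text \<open>The laws of real random variables that have moments of all orders.\<close>

definition real_law :: "real measure \<Rightarrow> bool" where
  "real_law \<nu> \<longleftrightarrow> prob_space \<nu> \<and> sets \<nu> = sets borel \<and> (\<forall>m. integrable \<nu> (\<lambda>x. x ^ m))"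

text \<open>
  The moment-cumulant formula, which defines the free cumulants implicitly. It determines
  \<open>K n\<close> for all \<open>n \<ge> 1\<close>, since the one-block partition contributes \<open>K n\<close> and all other
  partitions involve only cumulants of lower order; the value \<open>K 0\<close> is never used.
\<close>

definition has_free_cumulants :: "real measure \<Rightarrow> (nat \<Rightarrow> real) \<Rightarrow> bool" where
  "has_free_cumulants \<nu> K \<longleftrightarrow>
     (\<forall>n\<ge>1. (\<integral>x. x ^ n \<partial>\<nu>) = (\<Sum>\<pi>\<in>NC n. \<Prod>B\<in>\<pi>. K (card B)))"

end

theory Submission
  imports Defs "HOL-Real_Asymp.Real_Asymp"
begin

text \<open>
  Gaussian integration by parts applied to the first letter \<open>X\<close> of a trace of a word in
  \<open>W\<^sub>s = X (A\<^sub>M/M \<otimes> P\<^sub>N)\<^sup>s X\<^sup>*\<close> gives a Schwinger--Dyson equation: the pairing with the adjacent \<open>X\<^sup>*\<close>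
  produces \<open>Tr ((A\<^sub>M/M)\<^sup>s) Tr (P\<^sub>N\<^sup>s) / N\<close>, a pairing with another \<open>X\<^sup>*\<close> of the same trace splits it into two
  traces of shorter words, and a pairing with a different trace merges the two at the cost of a factor
  \<open>1/N\<^sup>2\<close>. Working with expectations of products of traces closes this system, so no separate
  concentration estimate is needed: by induction on the number of letters all these expectations
  converge, and the limits satisfy the recursion of sums over noncrossing partitions that is obtained
  from the maximum of the block of the first point.

  The limiting moments \<open>m\<^sub>k\<close> are positive semidefinite, as limits of expected traces of squares of
  selfadjoint matrices. The entries of \<open>A\<^sub>M\<close> are bounded by some \<open>c\<close>, so the cumulants satisfy
  \<open>|K\<^sub>r| \<le> c\<^sup>r\<close> and the moments grow at most geometrically (like Catalan numbers). The measure with these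
  moments is a weak limit of the discrete measures given by Bernstein polynomials.
\<close>

subsection \<open>Noncrossing partitions\<close>

text \<open>Powers of \<open>W 1\<close> alone do not give a closed system: contracting an X with a
  remote X^* joins two copies of the deterministic matrix, and the power \<open>D (s + t)\<close>
  appears as a new letter. So words over all letters s are followed from the start, and on the
  combinatorial side each point of a noncrossing partition carries a weight, which is handed on when
  the point is absorbed by another point of its block. Letters stay positive throughout. The letter
  0 would bring in the trace of the M-dimensional identity, which diverges; correspondingly only
  moments of \<open>\<mu>\<close> of order at least 1 are available. Selfadjointness of A and P
  serves the positivity of the limiting moments. The law \<open>\<nu>\<close> itself has to be
  constructed, and its bounded support is not given but extracted: positivity on squares, iterated
  Cauchy-Schwarz and geometric growth with rate R yield nonnegativity on q^2 (R^2 - x^2). An affine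
  change of variable then leads to the Hausdorff moment problem on [0, 1].\<close>

definition NC_on :: "nat set \<Rightarrow> nat set set set" where
  "NC_on S = {\<pi>. partition_on S \<pi> \<and> noncrossing \<pi>}"

text \<open>A point i of weight \<open>s i\<close> stands for \<open>s i\<close> points that have
  been merged into one. With weight 1 everywhere this is the right-hand side of the moment-cumulant
  formula.\<close>

definition nc_sum :: "(nat \<Rightarrow> 'a::comm_semiring_1) \<Rightarrow> (nat \<Rightarrow> nat) \<Rightarrow> nat set \<Rightarrow> 'a" where
  "nc_sum K s S = (\<Sum>\<pi>\<in>NC_on S. \<Prod>B\<in>\<pi>. K (sum s B))"

lemma finite_NC_on: "finite S \<Longrightarrow> finite (NC_on S)"
  using finitely_many_partition_on[of S] by (auto simp: NC_on_def intro: finite_subset)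

lemma NC_on_empty: "NC_on {} = {{}}"
  by (auto simp: NC_on_def partition_on_def noncrossing_def)

lemma nc_sum_empty [simp]: "nc_sum K s {} = 1"
  by (simp add: nc_sum_def NC_on_empty)

lemma partition_on_unique:
  "partition_on S \<pi> \<Longrightarrow> B \<in> \<pi> \<Longrightarrow> C \<in> \<pi> \<Longrightarrow> x \<in> B \<Longrightarrow> x \<in> C \<Longrightarrow> B = C"
  by (auto simp: partition_on_def disjoint_def)

lemma noncrossingI:
  "(\<And>B C a b c d. B \<in> \<pi> \<Longrightarrow> C \<in> \<pi> \<Longrightarrow> B \<noteq> C \<Longrightarrow> a < b \<Longrightarrow> b < c \<Longrightarrow> c < d \<Longrightarrow>
      a \<in> B \<Longrightarrow> c \<in> B \<Longrightarrow> b \<in> C \<Longrightarrow> d \<in> C \<Longrightarrow> False) \<Longrightarrow> noncrossing \<pi>"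
  unfolding noncrossing_def by blast

lemma noncrossingD:
  "noncrossing \<pi> \<Longrightarrow> B \<in> \<pi> \<Longrightarrow> C \<in> \<pi> \<Longrightarrow> a < b \<Longrightarrow> b < c \<Longrightarrow> c < d \<Longrightarrow>
      a \<in> B \<Longrightarrow> c \<in> B \<Longrightarrow> b \<in> C \<Longrightarrow> d \<in> C \<Longrightarrow> B = C"
  unfolding noncrossing_def by blast

lemma noncrossing_subset: "noncrossing \<pi> \<Longrightarrow> \<rho> \<subseteq> \<pi> \<Longrightarrow> noncrossing \<rho>"
  unfolding noncrossing_def by blast

text \<open>Since k is to be the maximum of the block of a, the block that a joins is found as the
  block of k, and deleting a loses no information.\<close>

definition glue :: "nat \<Rightarrow> nat \<Rightarrow> nat set set \<times> nat set set \<Rightarrow> nat set set" where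
  "glue a k = (\<lambda>(\<pi>, \<rho>). (\<lambda>B. if k \<in> B then insert a B else B) ` \<pi> \<union> \<rho>)"

definition unglue :: "nat \<Rightarrow> nat \<Rightarrow> nat set set \<Rightarrow> nat set set \<times> nat set set" where
  "unglue a k \<pi> = ((\<lambda>B. B - {a}) ` {B \<in> \<pi>. B \<subseteq> {a..k}}, {B \<in> \<pi>. B \<subseteq> {k<..}})"

text \<open>A noncrossing partition of \<open>{a..<b}\<close> in which the block of \<open>a\<close> has maximum \<open>k > a\<close> has no block
  meeting both \<open>{a<..<k}\<close> and \<open>{k<..<b}\<close>, and removing \<open>a\<close> leaves a pair of noncrossing partitions of
  \<open>{a<..k}\<close> and \<open>{k<..<b}\<close>. The map \<open>unglue\<close> is inverse to \<open>glue\<close> on these partitions.\<close>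

definition NC_first :: "nat \<Rightarrow> nat \<Rightarrow> nat \<Rightarrow> nat set set set" where
  "NC_first a k b = {\<pi> \<in> NC_on {a..<b}. \<exists>B\<in>\<pi>. a \<in> B \<and> k \<in> B \<and> B \<subseteq> {a..k}}"

lemma NC_first_cases:
  assumes "\<pi> \<in> NC_first a k b" "a < k" "k < b"
  obtains B0 L R where "\<pi> = insert B0 (L \<union> R)" "B0 \<notin> L \<union> R" "a \<in> B0" "k \<in> B0" "B0 \<subseteq> {a..k}"
    "\<And>B. B \<in> L \<Longrightarrow> B \<subseteq> {a<..<k}" "\<And>B. B \<in> R \<Longrightarrow> B \<subseteq> {k<..<b}"
proof -
  obtain B0 where B0: "B0 \<in> \<pi>" "a \<in> B0" "k \<in> B0" "B0 \<subseteq> {a..k}"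
    and p: "partition_on {a..<b} \<pi>" and nc: "noncrossing \<pi>"
    using assms by (auto simp: NC_first_def NC_on_def)
  have cases: "B \<subseteq> {a<..<k} \<or> B \<subseteq> {k<..<b}" if B: "B \<in> \<pi>" "B \<noteq> B0" for B
  proof -
    have sub: "B \<subseteq> {a..<b}" using p B by (auto simp: partition_on_def)
    have "a \<notin> B" "k \<notin> B" using partition_on_unique[OF p B(1) B0(1)] B0 B by auto
    then have "B \<subseteq> {a<..<k} \<union> {k<..<b}"
    proof (intro subsetI)
      fix x assume x: "x \<in> B"
      then have "x \<noteq> a" "x \<noteq> k" "a \<le> x" "x < b"
        using \<open>a \<notin> B\<close> \<open>k \<notin> B\<close> sub by auto
      then show "x \<in> {a<..<k} \<union> {k<..<b}" by auto
    qed
    \<comment> \<open>Otherwise a < x < k < y would be a crossing of \<open>B0\<close> and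
      B.\<close>
    moreover have "\<not> (x \<in> B \<and> y \<in> B \<and> x \<in> {a<..<k} \<and> y \<in> {k<..<b})" for x y
      using noncrossingD[OF nc B0(1) B(1), of a x k y] B0 B by auto
    ultimately show ?thesis by blast
  qed
  show thesis
  proof
    let ?L = "{B\<in>\<pi>. B \<noteq> B0 \<and> B \<subseteq> {a<..<k}}" and ?R = "{B\<in>\<pi>. B \<noteq> B0 \<and> B \<subseteq> {k<..<b}}"
    show "\<pi> = insert B0 (?L \<union> ?R)" using cases B0 by auto
  qed (use B0 in auto)
qed

text \<open>Exactly one block contains k, so the conditional in \<open>glue\<close> alters a single
  block. Naming it turns \<open>glue\<close> into an insertion that case distinctions can
  handle.\<close>

lemma glue_eq:
  assumes "partition_on {a<..k} \<pi>" "a < k"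
  obtains B1 where "B1 \<in> \<pi>" "k \<in> B1" "a \<notin> B1"
    "\<And>\<rho>. glue a k (\<pi>, \<rho>) = insert (insert a B1) ((\<pi> - {B1}) \<union> \<rho>)"
    "\<And>B. B \<in> \<pi> - {B1} \<Longrightarrow> B \<subseteq> {a<..<k}"
proof -
  have "k \<in> \<Union>\<pi>" using assms by (auto simp: partition_on_def)
  then obtain B1 where B1: "B1 \<in> \<pi>" "k \<in> B1" by blast
  have sub: "B \<subseteq> {a<..k}" if "B \<in> \<pi>" for B using assms that by (auto simp: partition_on_def)
  have nk: "k \<notin> B" if "B \<in> \<pi> - {B1}" for B
    using partition_on_unique[OF assms(1), of B B1 k] that B1 by auto
  show thesis
  proof
    show "glue a k (\<pi>, \<rho>) = insert (insert a B1) ((\<pi> - {B1}) \<union> \<rho>)" for \<rho>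
    proof -
      have "(\<lambda>B. if k \<in> B then insert a B else B) ` \<pi> = insert (insert a B1) ((\<lambda>B. B) ` (\<pi> - {B1}))"
        using B1 nk by (subst insert_Diff[OF B1(1), symmetric], subst image_insert)
          (auto intro!: image_cong arg_cong2[where f = insert])
      then show ?thesis by (simp add: glue_def)
    qed
    show "B \<subseteq> {a<..<k}" if "B \<in> \<pi> - {B1}" for B
      using sub[of B] nk[OF that] that by (auto simp: less_le)
  qed (use B1 sub[OF B1(1)] in auto)
qed

lemma glue_in:
  assumes "\<pi> \<in> NC_on {a<..k}" "\<rho> \<in> NC_on {k<..<b}" "a < k" "k < b"
  shows "glue a k (\<pi>, \<rho>) \<in> NC_first a k b"
proof -
  have p: "partition_on {a<..k} \<pi>" "partition_on {k<..<b} \<rho>" and nc: "noncrossing \<pi>" "noncrossing \<rho>"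
    using assms by (auto simp: NC_on_def)
  from glue_eq[OF p(1) assms(3)] obtain B1 where B1: "B1 \<in> \<pi>" "k \<in> B1" "a \<notin> B1"
    "glue a k (\<pi>, \<rho>) = insert (insert a B1) ((\<pi> - {B1}) \<union> \<rho>)"
    "\<And>B. B \<in> \<pi> - {B1} \<Longrightarrow> B \<subseteq> {a<..<k}" by metis
  have sub\<rho>: "\<And>B. B \<in> \<rho> \<Longrightarrow> B \<subseteq> {k<..<b}" and sub1: "B1 \<subseteq> {a<..k}"
    using p B1 by (auto simp: partition_on_def)
  have U: "\<Union>\<pi> = {a<..k}" "\<Union>\<rho> = {k<..<b}" and E: "{} \<notin> \<pi>" "{} \<notin> \<rho>"
    and D: "disjoint \<pi>" "disjoint \<rho>"
    using p by (auto simp: partition_on_def)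
  have U1: "\<Union>(\<pi> - {B1}) \<union> B1 = {a<..k}" using U B1 by auto
  have part: "partition_on {a..<b} (glue a k (\<pi>, \<rho>))"
  proof (rule partition_onI)
    have "\<Union>(glue a k (\<pi>, \<rho>)) = insert a (\<Union>(\<pi> - {B1}) \<union> B1 \<union> \<Union>\<rho>)"
      unfolding B1(4) by auto
    also have "\<dots> = {a..<b}" unfolding U1 U using assms by auto
    finally show "\<Union>(glue a k (\<pi>, \<rho>)) = {a..<b}" .
    show "{} \<notin> glue a k (\<pi>, \<rho>)"
      using E unfolding B1(4) by auto
    show "disjnt x y" if "x \<in> glue a k (\<pi>, \<rho>)" "y \<in> glue a k (\<pi>, \<rho>)" "x \<noteq> y" for x y
    proof -
      have d1: "disjnt B1 B" if "B \<in> \<pi> - {B1}" for B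
        using D(1) B1 that by (auto simp: disjoint_def disjnt_def)
      have d2: "disjnt (insert a B1) B" if "B \<in> \<pi> - {B1}" for B
        using d1[OF that] B1(5)[OF that] by (auto simp: disjnt_def)
      have d3: "disjnt B C" if "B \<in> insert (insert a B1) (\<pi> - {B1})" "C \<in> \<rho>" for B C
      proof -
        have "B \<subseteq> {a..k}" using that(1) B1(5)[of B] sub1 assms(3) by fastforce
        then show ?thesis using sub\<rho>[OF that(2)] by (fastforce simp: disjnt_def)
      qed
      have d4: "disjnt B C" if "B \<in> insert (insert a B1) (\<pi> - {B1})"
        "C \<in> insert (insert a B1) (\<pi> - {B1})" "B \<noteq> C" for B C
        using that d2[of B] d2[of C] disjointD[OF D(1), of B C] by (auto simp: disjnt_def)
      have d5: "disjnt B C" if "B \<in> \<rho>" "C \<in> \<rho>" "B \<noteq> C" for B C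
        using that D(2) by (auto simp: disjoint_def disjnt_def)
      let ?P = "insert (insert a B1) (\<pi> - {B1})"
      have "x \<in> ?P \<or> x \<in> \<rho>" "y \<in> ?P \<or> y \<in> \<rho>" using that unfolding B1(4) by auto
      then show ?thesis
        using d3[of x y] d3[of y x] d4[of x y] d5[of x y] that(3) disjnt_sym[of y x] by argo
    qed
  qed
  have nc': "noncrossing (glue a k (\<pi>, \<rho>))"
  proof (rule noncrossingI)
    fix B C p q r t
    assume BC: "B \<in> glue a k (\<pi>, \<rho>)" "C \<in> glue a k (\<pi>, \<rho>)" "B \<noteq> C"
      and o: "p < q" "q < r" "r < t" and m: "p \<in> B" "r \<in> B" "q \<in> C" "t \<in> C"
    have low: "x \<le> k" "x \<ge> a" if "Z \<in> insert (insert a B1) (\<pi> - {B1})" "x \<in> Z" for Z x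
      using that B1(5)[of Z] sub1 assms(3) by fastforce+
    have high: "x > k" if "Z \<in> \<rho>" "x \<in> Z" for Z x using sub\<rho> that by fastforce
    let ?P = "insert (insert a B1) (\<pi> - {B1})"
    have "B \<in> ?P \<or> B \<in> \<rho>" "C \<in> ?P \<or> C \<in> \<rho>" using BC unfolding B1(4) by auto
    moreover have "\<not> (B \<in> ?P \<and> C \<in> \<rho>)"
    proof
      assume *: "B \<in> ?P \<and> C \<in> \<rho>"
      from low(1)[OF conjunct1[OF *] m(2)] high[OF conjunct2[OF *] m(3)] o show False by simp
    qed
    moreover have "\<not> (B \<in> \<rho> \<and> C \<in> ?P)"
    proof
      assume *: "B \<in> \<rho> \<and> C \<in> ?P"
      from low(1)[OF conjunct2[OF *] m(4)] high[OF conjunct1[OF *] m(1)] o show False by simp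
    qed
    ultimately consider "B \<in> \<rho>" "C \<in> \<rho>" | "B \<in> ?P" "C \<in> ?P" by blast
    then show False
    proof cases
      case 1 from noncrossingD[OF nc(2) 1 o m] BC(3) show False by simp
    next
      case 2
      consider "B = insert a B1" "C \<in> \<pi> - {B1}" | "C = insert a B1" "B \<in> \<pi> - {B1}"
        | "B \<in> \<pi> - {B1}" "C \<in> \<pi> - {B1}"
        using 2 BC(3) by blast
      then show False
      proof cases
        case 1
        \<comment> \<open>Here p may be a, which \<open>\<pi>\<close> does not see. The maximum k
          takes its place: q < r < t < k is a crossing of C and \<open>B1\<close> inside
          \<open>\<pi>\<close>.\<close>
        have "r \<in> B1" using m 1 low[OF 2(1) m(1)] o by auto
        moreover have "t < k" using B1(5)[OF 1(2)] m by auto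
        ultimately show False
          using noncrossingD[OF nc(1) _ B1(1), of C q r t k] o m 1 B1 by blast
      next
        case c: 2
        have "q \<in> B1" "t \<in> B1" using m c low[OF 2(1) m(1)] o by auto
        then show False
          using noncrossingD[OF nc(1) _ B1(1), of B p q r t] o m c B1 by blast
      next
        case 3
        then show False using noncrossingD[OF nc(1) _ _ o m] BC by blast
      qed
    qed
  qed
  show ?thesis unfolding NC_first_def NC_on_def using part nc' B1 sub1 assms(3)
    by auto
qed

text \<open>Nonempty blocks keep the two filters of \<open>unglue\<close> apart; an empty block
  would pass both.\<close>

lemma unglue_eq:
  assumes "\<pi> = insert B0 (L \<union> R)" "a \<in> B0" "B0 \<subseteq> {a..k}" "a < k"
    "\<And>B. B \<in> L \<Longrightarrow> B \<subseteq> {a<..<k}" "\<And>B. B \<in> R \<Longrightarrow> B \<subseteq> {k<..<b}" "{} \<notin> \<pi>"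
  shows "unglue a k \<pi> = (insert (B0 - {a}) L, R)"
proof -
  have R: "\<not> B \<subseteq> {a..k}" if "B \<in> R" for B
  proof -
    have "B \<noteq> {}" using that assms(1,7) by auto
    then obtain x where "x \<in> B" by blast
    then show ?thesis using assms(6)[OF that] by fastforce
  qed
  have L: "\<not> B \<subseteq> {k<..}" "B \<subseteq> {a..k}" "B - {a} = B" if "B \<in> L" for B
  proof -
    have "B \<noteq> {}" using that assms(1,7) by auto
    then obtain x where "x \<in> B" by blast
    then show "\<not> B \<subseteq> {k<..}" using assms(5)[OF that] by fastforce
    show "B \<subseteq> {a..k}" "B - {a} = B" using assms(5)[OF that] by auto
  qed
  have "{B \<in> \<pi>. B \<subseteq> {a..k}} = insert B0 L" using assms(1,3) R L by blast
  moreover have "(\<lambda>B. B - {a}) ` L = (\<lambda>B. B) ` L" using L by (intro image_cong) auto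
  moreover have "{B \<in> \<pi>. B \<subseteq> {k<..}} = R"
  proof -
    have "\<not> B0 \<subseteq> {k<..}" using assms(2,4) by auto
    moreover have "B \<subseteq> {k<..}" if "B \<in> R" for B using assms(6)[OF that] by auto
    ultimately show ?thesis using assms(1) L by blast
  qed
  ultimately show ?thesis by (simp add: unglue_def)
qed

lemma glue_unglue:
  assumes "\<pi> \<in> NC_first a k b" "a < k" "k < b"
  shows "unglue a k \<pi> \<in> NC_on {a<..k} \<times> NC_on {k<..<b}" "glue a k (unglue a k \<pi>) = \<pi>"
proof -
  from assms obtain B0 L R where \<pi>: "\<pi> = insert B0 (L \<union> R)" "B0 \<notin> L \<union> R"
    and B0: "a \<in> B0" "k \<in> B0" "B0 \<subseteq> {a..k}"
    and L: "\<And>B. B \<in> L \<Longrightarrow> B \<subseteq> {a<..<k}" and R: "\<And>B. B \<in> R \<Longrightarrow> B \<subseteq> {k<..<b}"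
    by (rule NC_first_cases) blast
  have p: "partition_on {a..<b} \<pi>" and nc: "noncrossing \<pi>"
    using assms by (auto simp: NC_first_def NC_on_def)
  have E: "{} \<notin> \<pi>" and D: "disjoint \<pi>" and U: "\<Union>\<pi> = {a..<b}"
    using p by (auto simp: partition_on_def)
  have eq: "unglue a k \<pi> = (insert (B0 - {a}) L, R)"
    by (rule unglue_eq[OF \<pi>(1) B0(1,3) assms(2) L R E])
  have nk: "k \<notin> B" if "B \<in> L" for B using L[OF that] by auto
  have nk': "k \<notin> B" if "B \<in> R" for B using R[OF that] by auto
  have "(\<lambda>B. if k \<in> B then insert a B else B) ` L = (\<lambda>B. B) ` L"
    using nk by (intro image_cong) auto
  then show "glue a k (unglue a k \<pi>) = \<pi>"
    unfolding eq glue_def using \<pi> B0 assms(2) by (auto simp: insert_absorb)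
  have UL: "\<Union>(insert (B0 - {a}) L) = {a<..k}"
  proof -
    have "\<Union>(insert (B0 - {a}) L) = \<Union>\<pi> \<inter> {a<..k}"
    proof (intro equalityI subsetI)
      fix x assume "x \<in> \<Union>(insert (B0 - {a}) L)"
      then consider "x \<in> B0" "x \<noteq> a" | B where "B \<in> L" "x \<in> B" by blast
      then show "x \<in> \<Union>\<pi> \<inter> {a<..k}"
      proof cases
        case 1 then show ?thesis using B0(3) \<pi>(1) by force
      next
        case 2 then show ?thesis using L[OF 2(1)] \<pi>(1) by force
      qed
    next
      fix x assume "x \<in> \<Union>\<pi> \<inter> {a<..k}"
      then obtain B where B: "B \<in> \<pi>" "x \<in> B" "a < x" "x \<le> k" by auto
      moreover have "B \<notin> R" using R[of B] B by fastforce
      ultimately have "B = B0 \<or> B \<in> L" using \<pi>(1) by auto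
      then show "x \<in> \<Union>(insert (B0 - {a}) L)" using B by auto
    qed
    then show ?thesis unfolding U using assms by auto
  qed
  have UR: "\<Union>R = {k<..<b}"
  proof -
    have "\<Union>R = \<Union>\<pi> \<inter> {k<..}"
    proof (intro equalityI subsetI)
      fix x assume "x \<in> \<Union>R"
      then show "x \<in> \<Union>\<pi> \<inter> {k<..}" using R \<pi>(1) by force
    next
      fix x assume "x \<in> \<Union>\<pi> \<inter> {k<..}"
      then obtain B where B: "B \<in> \<pi>" "x \<in> B" "k < x" by auto
      moreover have "B \<notin> L" using L[of B] B by fastforce
      moreover have "B \<noteq> B0" using B0(3) B by auto
      ultimately show "x \<in> \<Union>R" using \<pi>(1) by auto
    qed
    then show ?thesis unfolding U using assms by auto
  qed
  have part1: "partition_on {a<..k} (insert (B0 - {a}) L)"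
  proof (rule partition_onI[OF UL])
    show "{} \<notin> insert (B0 - {a}) L" using E B0 \<pi>(1) assms(2) by auto
    have d: "disjnt B0 B" "disjnt B C" if "B \<in> L" "C \<in> L" "B \<noteq> C" for B C
      using disjointD[OF D, of B0 B] disjointD[OF D, of B C] \<pi> that by (auto simp: disjnt_def)
    have d0: "disjnt (B0 - {a}) B" if "B \<in> L" for B
      using disjointD[OF D, of B0 B] \<pi> that by (auto simp: disjnt_def)
    show "disjnt x y" if "x \<in> insert (B0 - {a}) L" "y \<in> insert (B0 - {a}) L" "x \<noteq> y" for x y
      using that d(2) d0 disjnt_sym by blast
  qed
  have nc1: "noncrossing (insert (B0 - {a}) L)"
  proof (rule noncrossingI)
    fix B C p q r t
    assume BC: "B \<in> insert (B0 - {a}) L" "C \<in> insert (B0 - {a}) L" "B \<noteq> C"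
      and o: "p < q" "q < r" "r < t" and m: "p \<in> B" "r \<in> B" "q \<in> C" "t \<in> C"
    consider "B = B0 - {a}" "C \<in> L" | "C = B0 - {a}" "B \<in> L" | "B \<in> L" "C \<in> L"
      using BC by blast
    then show False
    proof cases
      case 1
      then show False using noncrossingD[OF nc _ _ o, of B0 C] m \<pi> by auto
    next
      case 2
      then show False using noncrossingD[OF nc _ _ o, of B B0] m \<pi> by auto
    next
      case 3
      then show False using noncrossingD[OF nc _ _ o m] BC(3) \<pi>(1) by auto
    qed
  qed
  have part2: "partition_on {k<..<b} R"
    using UR E D \<pi>(1) by (auto simp: partition_on_def disjoint_def)
  show "unglue a k \<pi> \<in> NC_on {a<..k} \<times> NC_on {k<..<b}"
    unfolding eq using part1 nc1 part2 noncrossing_subset[OF nc, of R] \<pi>(1) by (auto simp: NC_on_def)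
qed

lemma unglue_glue:
  assumes "\<pi> \<in> NC_on {a<..k}" "\<rho> \<in> NC_on {k<..<b}" "a < k" "k < b"
  shows "unglue a k (glue a k (\<pi>, \<rho>)) = (\<pi>, \<rho>)"
proof -
  have p: "partition_on {a<..k} \<pi>" "partition_on {k<..<b} \<rho>" and g: "partition_on {a..<b} (glue a k (\<pi>, \<rho>))"
    using assms glue_in[OF assms] by (auto simp: NC_on_def NC_first_def)
  from glue_eq[OF p(1) assms(3)] obtain B1 where B1: "B1 \<in> \<pi>" "k \<in> B1" "a \<notin> B1"
    and eq: "glue a k (\<pi>, \<rho>) = insert (insert a B1) ((\<pi> - {B1}) \<union> \<rho>)"
    and L: "\<And>B. B \<in> \<pi> - {B1} \<Longrightarrow> B \<subseteq> {a<..<k}" by metis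
  have R: "\<And>B. B \<in> \<rho> \<Longrightarrow> B \<subseteq> {k<..<b}" and s: "B1 \<subseteq> {a<..k}"
    using p B1 by (auto simp: partition_on_def)
  have "unglue a k (glue a k (\<pi>, \<rho>)) = (insert (insert a B1 - {a}) (\<pi> - {B1}), \<rho>)"
  proof (rule unglue_eq[OF eq])
    show "insert a B1 \<subseteq> {a..k}" using s assms(3) by auto
    show "{} \<notin> glue a k (\<pi>, \<rho>)" using g by (auto simp: partition_on_def)
  qed (use L R assms in auto)
  then show ?thesis using B1 by (auto simp: insert_absorb)
qed

text \<open>Moving the weight of a onto k preserves the total weight of the block that contains
  both, and every other block avoids k. Hence deleting a leaves all factors unchanged.\<close>

lemma prod_glue:
  assumes "\<pi> \<in> NC_on {a<..k}" "\<rho> \<in> NC_on {k<..<b}" "a < k" "k < b"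
  shows "(\<Prod>B\<in>glue a k (\<pi>, \<rho>). K (sum s B))
    = (\<Prod>B\<in>\<pi>. K (sum (s(k := s k + s a)) B)) * (\<Prod>B\<in>\<rho>. (K (sum s B) :: 'a :: comm_semiring_1))"
proof -
  have p: "partition_on {a<..k} \<pi>" "partition_on {k<..<b} \<rho>"
    using assms by (auto simp: NC_on_def)
  from glue_eq[OF p(1) assms(3)] obtain B1 where B1: "B1 \<in> \<pi>" "k \<in> B1" "a \<notin> B1"
    and eq: "glue a k (\<pi>, \<rho>) = insert (insert a B1) ((\<pi> - {B1}) \<union> \<rho>)"
    and L: "\<And>B. B \<in> \<pi> - {B1} \<Longrightarrow> B \<subseteq> {a<..<k}" by metis
  have R: "\<And>B. B \<in> \<rho> \<Longrightarrow> B \<subseteq> {k<..<b}" and s: "B1 \<subseteq> {a<..k}"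
    and E: "{} \<notin> \<pi>"
    using p B1 by (auto simp: partition_on_def)
  have fin: "finite \<pi>" "finite \<rho>"
    using p finite_elements[of "{a<..k}" \<pi>] finite_elements[of "{k<..<b}" \<rho>] by auto
  have n1: "insert a B1 \<notin> (\<pi> - {B1}) \<union> \<rho>"
  proof
    assume "insert a B1 \<in> (\<pi> - {B1}) \<union> \<rho>"
    then show False using L[of "insert a B1"] R[of "insert a B1"] assms(3) by auto
  qed
  have n2: "(\<pi> - {B1}) \<inter> \<rho> = {}"
  proof -
    have False if "B \<in> \<pi> - {B1}" "B \<in> \<rho>" for B
    proof -
      from that(1) E have "B \<noteq> {}" by auto
      then obtain x where "x \<in> B" by blast
      then show False using L[OF that(1)] R[OF that(2)] by fastforce
    qed
    then show ?thesis by blast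
  qed
  have fB: "finite B1" using s by (rule finite_subset) simp
  let ?s = "s(k := s k + s a)"
  have "sum ?s B1 = (s k + s a) + sum ?s (B1 - {k})"
    using sum.remove[OF fB B1(2), of ?s] by simp
  also have "sum ?s (B1 - {k}) = sum s (B1 - {k})" by (intro sum.cong) auto
  also have "(s k + s a) + sum s (B1 - {k}) = sum s (insert a B1)"
    using sum.remove[OF fB B1(2), of s] fB B1 by (simp add: ac_simps)
  finally have s1: "sum ?s B1 = sum s (insert a B1)" .
  have s2: "sum ?s B = sum s B" if "B \<in> \<pi> - {B1}" for B
    using L[OF that] by (intro sum.cong) auto
  have "(\<Prod>B\<in>glue a k (\<pi>, \<rho>). K (sum s B))
      = K (sum ?s B1) * (\<Prod>B\<in>\<pi> - {B1}. K (sum ?s B)) * (\<Prod>B\<in>\<rho>. K (sum s B))"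
    unfolding eq s1 using n1 n2 fin prod.cong[OF refl, of "\<pi> - {B1}" "\<lambda>B. K (sum ?s B)" "\<lambda>B. K (sum s B)"] s2
    by (simp add: prod.union_disjoint mult.assoc del: fun_upd_apply)
  then show ?thesis by (simp add: prod.remove[OF fin(1) B1(1)])
qed

lemma sum_NC_first:
  assumes "a < k" "k < b"
  shows "(\<Sum>\<pi>\<in>NC_first a k b. \<Prod>B\<in>\<pi>. K (sum s B))
    = nc_sum K (s(k := s k + s a)) {a<..k} * nc_sum K s {k<..<b}"
proof -
  have "(\<Sum>\<pi>\<in>NC_first a k b. \<Prod>B\<in>\<pi>. K (sum s B))
    = (\<Sum>p\<in>NC_on {a<..k} \<times> NC_on {k<..<b}. \<Prod>B\<in>glue a k p. K (sum s B))"
    using assms by (intro sum.reindex_bij_witness[of _ "glue a k" "unglue a k"])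
      (auto simp: glue_unglue unglue_glue glue_in)
  also have "\<dots> = (\<Sum>p\<in>NC_on {a<..k} \<times> NC_on {k<..<b}.
      (\<Prod>B\<in>fst p. K (sum (s(k := s k + s a)) B)) * (\<Prod>B\<in>snd p. K (sum s B)))"
    using assms by (intro sum.cong) (auto simp: prod_glue)
  also have "\<dots> = nc_sum K (s(k := s k + s a)) {a<..k} * nc_sum K s {k<..<b}"
    unfolding nc_sum_def sum_product sum.cartesian_product by (simp add: case_prod_unfold)
  finally show ?thesis .
qed

text \<open>The remaining case, where the maximum of the block of a is a itself. A singleton takes
  part in no crossing, so it can be added and removed freely.\<close>

lemma sum_NC_singleton:
  assumes "a < b"
  shows "(\<Sum>\<pi> | \<pi> \<in> NC_on {a..<b} \<and> {a} \<in> \<pi>. \<Prod>B\<in>\<pi>. K (sum s B)) = K (s a) * nc_sum K s {a<..<b}"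
proof -
  have fin: "finite \<rho>" and sub: "\<And>B. B \<in> \<rho> \<Longrightarrow> B \<subseteq> {a<..<b}" if "\<rho> \<in> NC_on {a<..<b}" for \<rho>
    using that finite_elements[of "{a<..<b}" \<rho>] by (auto simp: NC_on_def partition_on_def)
  have ins: "insert {a} \<rho> \<in> NC_on {a..<b}" if "\<rho> \<in> NC_on {a<..<b}" for \<rho>
  proof -
    have "partition_on (insert a {a<..<b}) (insert {a} \<rho>)"
    proof (rule partition_onI)
      have "\<Union>\<rho> = {a<..<b}" and E: "{} \<notin> \<rho>" and D: "disjoint \<rho>"
        using that by (auto simp: NC_on_def partition_on_def)
      then show "\<Union>(insert {a} \<rho>) = insert a {a<..<b}" "{} \<notin> insert {a} \<rho>" by auto
      have "disjnt {a} B" "disjnt B {a}" if "B \<in> \<rho>" for B using sub[OF \<open>\<rho> \<in> _\<close> that] by auto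
      then show "disjnt p q" if "p \<in> insert {a} \<rho>" "q \<in> insert {a} \<rho>" "p \<noteq> q" for p q
        using that disjointD[OF D, of p q] by (auto simp: disjnt_def)
    qed
    moreover have "insert a {a<..<b} = {a..<b}" using assms by auto
    moreover have "noncrossing (insert {a} \<rho>)"
    proof (rule noncrossingI)
      fix B C p q r t
      assume BC: "B \<in> insert {a} \<rho>" "C \<in> insert {a} \<rho>" "B \<noteq> C"
        and o: "p < q" "q < r" "r < t" and m: "p \<in> B" "r \<in> B" "q \<in> C" "t \<in> C"
      have "B \<noteq> {a}" "C \<noteq> {a}" using o m by auto
      then have "B \<in> \<rho>" "C \<in> \<rho>" using BC by auto
      moreover have "noncrossing \<rho>" using that by (simp add: NC_on_def)
      ultimately show False using noncrossingD[OF _ _ _ o m] BC(3) by blast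
    qed
    ultimately show ?thesis by (simp add: NC_on_def)
  qed
  have del: "\<pi> - {{a}} \<in> NC_on {a<..<b}" if "\<pi> \<in> NC_on {a..<b}" "{a} \<in> \<pi>" for \<pi>
  proof -
    have p: "partition_on {a..<b} \<pi>" using that by (simp add: NC_on_def)
    have "\<Union>(\<pi> - {{a}}) = \<Union>\<pi> - {a}"
      using partition_on_unique[OF p _ that(2), of _ a] by auto
    also have "\<dots> = {a<..<b}" using p by (auto simp: partition_on_def)
    finally have "partition_on {a<..<b} (\<pi> - {{a}})"
      using p by (auto simp: partition_on_def disjoint_def)
    then show ?thesis using that noncrossing_subset[of \<pi> "\<pi> - {{a}}"] by (auto simp: NC_on_def)
  qed
  have "(\<Sum>\<pi> | \<pi> \<in> NC_on {a..<b} \<and> {a} \<in> \<pi>. \<Prod>B\<in>\<pi>. K (sum s B))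
    = (\<Sum>\<rho>\<in>NC_on {a<..<b}. \<Prod>B\<in>insert {a} \<rho>. K (sum s B))"
  proof (rule sum.reindex_bij_witness[of _ "insert {a}" "\<lambda>\<pi>. \<pi> - {{a}}"])
    fix \<rho> assume \<rho>: "\<rho> \<in> NC_on {a<..<b}"
    show "insert {a} \<rho> - {{a}} = \<rho>" using sub[OF \<rho>, of "{a}"] by auto
  qed (auto simp: ins del insert_absorb)
  also have "\<dots> = (\<Sum>\<rho>\<in>NC_on {a<..<b}. K (s a) * (\<Prod>B\<in>\<rho>. K (sum s B)))"
  proof (rule sum.cong[OF refl])
    fix \<rho> assume \<rho>: "\<rho> \<in> NC_on {a<..<b}"
    have "{a} \<notin> \<rho>" using sub[OF \<rho>, of "{a}"] by auto
    then show "(\<Prod>B\<in>insert {a} \<rho>. K (sum s B)) = K (s a) * (\<Prod>B\<in>\<rho>. K (sum s B))"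
      using fin[OF \<rho>] by simp
  qed
  finally show ?thesis by (simp add: nc_sum_def sum_distrib_left)
qed

theorem nc_sum_rec:
  assumes "a < b"
  shows "nc_sum K s {a..<b} = K (s a) * nc_sum K s {a<..<b}
    + (\<Sum>k\<in>{a<..<b}. nc_sum K (s(k := s k + s a)) {a<..k} * nc_sum K s {k<..<b})"
proof -
  let ?S = "{\<pi>. \<pi> \<in> NC_on {a..<b} \<and> {a} \<in> \<pi>}" and ?f = "\<lambda>\<pi>. \<Prod>B\<in>\<pi>. K (sum s B)"
  let ?U = "\<Union>k\<in>{a<..<b}. NC_first a k b"
  \<comment> \<open>This makes k a function of the partition, so that the classes for different k
    are disjoint.\<close>
  have max: "k = Max B" if "k \<in> B" "B \<subseteq> {a..k}" for k and B :: "nat set"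
    using that finite_subset[OF that(2)] by (intro Max_eqI[symmetric]) auto
  have eq: "NC_on {a..<b} = ?S \<union> ?U"
  proof (intro equalityI subsetI)
    fix \<pi> assume \<pi>: "\<pi> \<in> NC_on {a..<b}"
    then have p: "partition_on {a..<b} \<pi>" by (simp add: NC_on_def)
    then have "a \<in> \<Union>\<pi>" using assms by (auto simp: partition_on_def)
    then obtain B where B: "B \<in> \<pi>" "a \<in> B" by blast
    have sub: "B \<subseteq> {a..<b}" using p B by (auto simp: partition_on_def)
    then have f: "finite B" by (rule finite_subset) simp
    have m: "Max B \<in> B" using f B by (intro Max_in) auto
    have sub': "B \<subseteq> {a..Max B}" using sub f by auto
    show "\<pi> \<in> ?S \<union> ?U"
    proof (cases "Max B = a")
      case True
      then have "B = {a}" using sub' B by auto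
      then show ?thesis using \<pi> B by simp
    next
      case False
      then have "Max B \<in> {a<..<b}" using m sub by (auto simp: le_neq_implies_less)
      moreover have "\<pi> \<in> NC_first a (Max B) b" using \<pi> B m sub' by (auto simp: NC_first_def)
      ultimately show ?thesis by blast
    qed
  qed (auto simp: NC_first_def)
  have fin: "finite (NC_on {a..<b})" by (rule finite_NC_on) simp
  then have "finite (?S \<union> ?U)" by (simp only: eq[symmetric])
  then have finU: "finite ?U" "finite ?S" by auto
  have "?S \<inter> ?U = {}"
  proof -
    have False if "\<pi> \<in> ?S" "\<pi> \<in> NC_first a k b" "a < k" for \<pi> and k :: nat
    proof -
      from that obtain B where B: "B \<in> \<pi>" "a \<in> B" "k \<in> B" and p: "partition_on {a..<b} \<pi>"
        by (auto simp: NC_first_def NC_on_def)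
      then have "B = {a}" using partition_on_unique[OF p B(1), of "{a}" a] that by simp
      then show False using B that by simp
    qed
    then show ?thesis by fastforce
  qed
  then have "nc_sum K s {a..<b} = sum ?f ?S + sum ?f ?U"
    using sum.union_disjoint[OF finU(2,1), of ?f] by (simp only: nc_sum_def eq[symmetric])
  also have "sum ?f ?U = (\<Sum>k\<in>{a<..<b}. sum ?f (NC_first a k b))"
  proof (rule sum.UNION_disjoint)
    show "\<forall>k\<in>{a<..<b}. finite (NC_first a k b)" using fin by (auto simp: NC_first_def)
    show "\<forall>k\<in>{a<..<b}. \<forall>l\<in>{a<..<b}. k \<noteq> l \<longrightarrow> NC_first a k b \<inter> NC_first a l b = {}"
    proof (intro ballI impI)
      fix k l :: nat assume kl: "k \<noteq> l"
      have False if \<pi>: "\<pi> \<in> NC_first a k b" "\<pi> \<in> NC_first a l b" for \<pi>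
      proof -
        obtain B C where B: "B \<in> \<pi>" "a \<in> B" "k \<in> B" "B \<subseteq> {a..k}"
          and C: "C \<in> \<pi>" "a \<in> C" "l \<in> C" "C \<subseteq> {a..l}" and p: "partition_on {a..<b} \<pi>"
          using \<pi> by (auto simp: NC_first_def NC_on_def)
        have "B = C" by (rule partition_on_unique[OF p B(1) C(1) B(2) C(2)])
        then show False using max[OF B(3,4)] max[OF C(3,4)] kl by simp
      qed
      then show "NC_first a k b \<inter> NC_first a l b = {}" by blast
    qed
  qed simp
  finally show ?thesis
    unfolding sum_NC_singleton[OF assms] by (simp add: sum_NC_first)
qed

subsection \<open>Limits of products of traces of words\<close>

text \<open>The words arising when the letter \<open>s\<close>, removed from the word \<open>s # ss\<close>, is paired with a letter of another word.\<close>

fun merges :: "nat \<Rightarrow> nat list \<Rightarrow> nat list list \<Rightarrow> nat list list list" where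
  "merges s ss [] = []"
| "merges s ss (t # ts) = map (\<lambda>k. (ss @ drop (Suc k) t @ take k t @ [t ! k + s]) # ts) [0..<length t]
     @ map ((#) t) (merges s ss ts)"

text \<open>Splitting a word moves the weight s onto letter k and loses none of it. In the growth
  estimate this lets a power of c with the total weight as exponent pass through the
  recursion.\<close>

lemma sum_list_take_snoc_drop: "k < length ss \<Longrightarrow>
    sum_list (take k ss @ [ss ! k + s]) + sum_list (drop (Suc k) ss) = s + sum_list (ss :: nat list)"
  by (subst (4) id_take_nth_drop[of k ss]) simp_all

text \<open>The congruence rule hands the range of the summation index to the termination proofs;
  without k < length ss the recursive arguments need not be shorter.\<close>

context notes sum.cong[fundef_cong]
begin

text \<open>The Schwinger-Dyson equation in the limit: the merging terms have vanished, and the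
  expectation of a product of two traces has become a product of limits.\<close>

function word_limit :: "(nat \<Rightarrow> 'a::comm_semiring_1) \<Rightarrow> nat list \<Rightarrow> 'a" where
  "word_limit K [] = 1"
| "word_limit K (s # ss) = K s * word_limit K ss
    + (\<Sum>k<length ss. word_limit K (take k ss @ [ss ! k + s]) * word_limit K (drop (Suc k) ss))"
  by pat_completeness auto
termination by (relation "Wellfounded.measure (\<lambda>(K, ss). length ss)") auto

fun catalan :: "nat \<Rightarrow> real" where
  "catalan 0 = 1"
| "catalan (Suc n) = (\<Sum>j\<le>n. catalan j * catalan (n - j))"

end

text \<open>Both sides obey the same recursion, letter k of the tail being the point
  \<open>Suc a + k\<close>. The weights must be arbitrary because the recursive call changes one of
  them.\<close>

lemma word_limit_eq_nc_sum: "word_limit K (map s [a..<b]) = nc_sum K s {a..<b}"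
proof (induction "b - a" arbitrary: s a b rule: less_induct)
  case less
  show ?case
  proof (cases "a < b")
    case True
    let ?ss = "map s [Suc a..<b]"
    have len: "length ?ss = b - Suc a" by simp
    have l: "map s [a..<b] = s a # ?ss" using True by (simp add: upt_conv_Cons)
    have t: "take k ?ss @ [?ss ! k + s a] = map (s(Suc a + k := s (Suc a + k) + s a)) [Suc a..<Suc (Suc a + k)]"
      if "k < b - Suc a" for k
      using that by (auto simp: take_map intro!: nth_equalityI simp: nth_append)
    have d: "drop (Suc k) ?ss = map s [Suc (Suc a + k)..<b]" for k
      by (simp add: drop_map)
    have "word_limit K (map s [a..<b]) = K (s a) * nc_sum K s {Suc a..<b}
       + (\<Sum>k<b - Suc a. nc_sum K (s(Suc a + k := s (Suc a + k) + s a)) {Suc a..<Suc (Suc a + k)}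
          * nc_sum K s {Suc (Suc a + k)..<b})"
      unfolding l word_limit.simps len
      using less[of b "Suc a" s] True
      by (intro arg_cong2[where f = "(+)"] arg_cong2[where f = "(*)"] sum.cong refl)
        (simp_all only: t d lessThan_iff, auto intro!: less arg_cong2[where f = "(*)"] simp del: upt_Suc)
    also have "\<dots> = K (s a) * nc_sum K s {a<..<b}
       + (\<Sum>k\<in>{a<..<b}. nc_sum K (s(k := s k + s a)) {a<..k} * nc_sum K s {k<..<b})"
      by (intro arg_cong2[where f = "(+)"] sum.reindex_bij_witness[of _ "\<lambda>k. k - Suc a" "\<lambda>k. Suc a + k"])
        (auto simp: atLeastSucLessThan_greaterThanLessThan atLeastSucAtMost_greaterThanAtMost atLeastLessThanSuc_atLeastAtMost simp del: add_Suc)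
    also have "\<dots> = nc_sum K s {a..<b}" by (rule nc_sum_rec[OF True, symmetric])
    finally show ?thesis .
  qed simp
qed

section \<open>Catalan numbers and the growth of the limits\<close>

lemma catalan_Suc: "catalan (Suc n) = catalan n + (\<Sum>k<n. catalan (Suc k) * catalan (n - Suc k))"
  by (simp only: catalan.simps(2)[of n] sum.atMost_shift) simp

lemma catalan_nonneg: "catalan n \<ge> 0"
  by (induction n rule: less_induct) (case_tac x; auto intro!: sum_nonneg mult_nonneg_nonneg)

declare catalan.simps(2) [simp del]

text \<open>The truncated generating function \<open>f\<^sub>n\<close> satisfies \<open>f\<^sub>n\<^sub>+\<^sub>1(x) \<le> 1 + x f\<^sub>n(x)\<^sup>2\<close>, which
  preserves the bound \<open>2\<close> at \<open>x = 1/4\<close>.\<close>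

lemma catalan_partial_sum: "(\<Sum>j\<le>n. catalan j / 4 ^ j) \<le> 2"
proof (induction n)
  case (Suc n)
  define a where "a j = catalan j / 4 ^ j" for j
  have a_nonneg: "a j \<ge> 0" for j by (simp add: a_def catalan_nonneg)
  have rec: "a (Suc j) = (\<Sum>i\<le>j. a i * a (j - i)) / 4" for j
  proof -
    have "(\<Sum>i\<le>j. a i * a (j - i)) = (\<Sum>i\<le>j. catalan i * catalan (j - i) / 4 ^ j)"
      by (intro sum.cong refl) (simp add: a_def flip: power_add)
    then show ?thesis by (simp add: a_def catalan.simps(2) flip: sum_divide_distrib)
  qed
  have "(\<Sum>j\<le>n. \<Sum>i\<le>j. a i * a (j - i)) = (\<Sum>(i, j)\<in>{(i, j). i + j \<le> n}. a i * a j)"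
    by (rule sum.triangle_reindex_eq[symmetric])
  also have "\<dots> \<le> (\<Sum>(i, j)\<in>{..n} \<times> {..n}. a i * a j)"
    by (rule sum_mono2) (auto simp: a_nonneg)
  also have "\<dots> = (\<Sum>j\<le>n. a j)\<^sup>2"
    by (simp add: power2_eq_square sum_product sum.cartesian_product)
  also have "\<dots> \<le> 2\<^sup>2"
    using Suc by (intro power_mono sum_nonneg a_nonneg) (simp_all add: a_def)
  finally have "(\<Sum>j\<le>n. a (Suc j)) \<le> 1"
    by (simp add: rec flip: sum_divide_distrib)
  moreover have "(\<Sum>j\<le>Suc n. a j) = a 0 + (\<Sum>j\<le>n. a (Suc j))"
    by (rule sum.atMost_Suc_shift)
  ultimately show ?case by (simp add: a_def)
qed simp

lemma catalan_le: "catalan n \<le> 2 * 4 ^ n"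
proof -
  have "catalan n / 4 ^ n \<le> (\<Sum>j\<le>n. catalan j / 4 ^ j)"
    by (rule member_le_sum) (auto simp: catalan_nonneg)
  then have "catalan n / 4 ^ n \<le> 2" using catalan_partial_sum[of n] by linarith
  then show ?thesis by (simp add: field_simps)
qed

text \<open>The total weight is the same in every summand of the recursion, so
  \<open>c ^ sum_list ss\<close> factors out. What remains only sees lengths: the two parts have
  \<open>Suc k\<close> and \<open>length ts - Suc k\<close> letters, which is the recursion
  \<open>catalan_Suc\<close>.\<close>

lemma norm_word_limit_le:
  fixes K :: "nat \<Rightarrow> 'a :: real_normed_field"
  assumes K: "\<And>s. s > 0 \<Longrightarrow> norm (K s) \<le> c ^ s" and c: "c \<ge> 0" and "\<And>s. s \<in> set ss \<Longrightarrow> s > 0"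
  shows "norm (word_limit K ss) \<le> c ^ sum_list ss * catalan (length ss)"
  using assms(3)
proof (induction "length ss" arbitrary: ss rule: less_induct)
  case less
  show ?case
  proof (cases ss)
    case (Cons s ts)
    have "norm (word_limit K ss) \<le> norm (K s * word_limit K ts)
        + (\<Sum>k<length ts. norm (word_limit K (take k ts @ [ts ! k + s]) * word_limit K (drop (Suc k) ts)))"
      unfolding Cons word_limit.simps by (intro norm_triangle_mono order_refl norm_sum)
    also have "norm (K s * word_limit K ts) \<le> c ^ s * (c ^ sum_list ts * catalan (length ts))"
      unfolding norm_mult using less c Cons by (intro mult_mono K less) auto
    also have "(\<Sum>k<length ts. norm (word_limit K (take k ts @ [ts ! k + s]) * word_limit K (drop (Suc k) ts)))
       \<le> (\<Sum>k<length ts. c ^ sum_list ss * (catalan (Suc k) * catalan (length ts - Suc k)))"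
    proof (rule sum_mono)
      fix k assume "k \<in> {..<length ts}"
      then have k: "k < length ts" by simp
      let ?u = "take k ts @ [ts ! k + s]" and ?v = "drop (Suc k) ts"
      have pos: "\<And>x. x \<in> set ts \<Longrightarrow> x > 0" "s > 0" using less.prems Cons by auto
      have "norm (word_limit K ?u) \<le> c ^ sum_list ?u * catalan (length ?u)"
      proof (rule less(1))
        show "length ?u < length ss" using k by (simp add: Cons)
        show "x > 0" if "x \<in> set ?u" for x
          using that pos by (auto dest!: in_set_takeD)
      qed
      moreover have "norm (word_limit K ?v) \<le> c ^ sum_list ?v * catalan (length ?v)"
        using k pos by (intro less) (auto simp: Cons dest: in_set_dropD)
      ultimately have "norm (word_limit K ?u * word_limit K ?v)
          \<le> (c ^ sum_list ?u * catalan (length ?u)) * (c ^ sum_list ?v * catalan (length ?v))"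
        unfolding norm_mult using c by (intro mult_mono mult_nonneg_nonneg catalan_nonneg) auto
      also have "\<dots> = c ^ (sum_list ?u + sum_list ?v) * (catalan (length ?u) * catalan (length ?v))"
        by (simp only: power_add mult_ac)
      also have "\<dots> = c ^ sum_list ss * (catalan (Suc k) * catalan (length ts - Suc k))"
        using k unfolding sum_list_take_snoc_drop[OF k] by (simp add: Cons)
      finally show "norm (word_limit K ?u * word_limit K ?v)
          \<le> c ^ sum_list ss * (catalan (Suc k) * catalan (length ts - Suc k))" .
    qed
    also have "c ^ s * (c ^ sum_list ts * catalan (length ts))
        + (\<Sum>k<length ts. c ^ sum_list ss * (catalan (Suc k) * catalan (length ts - Suc k)))
      = c ^ sum_list ss * catalan (length ss)"
      unfolding Cons length_Cons catalan_Suc[of "length ts"]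
      by (simp add: power_add sum_distrib_left distrib_left mult.assoc)
    finally show ?thesis by simp
  qed simp
qed

lemma merges_positive:
  assumes "us \<in> set (merges s ss ts)" "\<forall>t\<in>set ts. \<forall>u\<in>set t. u > 0" "\<forall>u\<in>set ss. u > 0" "s > 0"
  shows "\<forall>t\<in>set us. \<forall>u\<in>set t. u > 0"
  using assms
  by (induction ts arbitrary: us) (auto dest!: in_set_takeD in_set_dropD)

text \<open>Compared with \<open>(s # ss) # ts\<close>, one letter and one word have
  disappeared.\<close>

lemma merges_size:
  "us \<in> set (merges s ss ts) \<Longrightarrow> length us = length ts \<and>
    sum_list (map length us) = length ss + sum_list (map length ts)"
  by (induction ts arbitrary: us) auto

text \<open>Stated for an abstract family E, since only the recursion matters. Its equations are
  required eventually because they will be available for M, N \<ge> 1 only, and for positive letters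
  because only these have convergent \<open>\<tau>\<close>.\<close>

theorem traces_limit:
  fixes E :: "'p \<Rightarrow> nat list list \<Rightarrow> complex" and \<tau> :: "'p \<Rightarrow> nat \<Rightarrow> complex" and n :: "'p \<Rightarrow> nat"
  assumes nil: "\<forall>\<^sub>F p in F. E p [] = 1"
    and empty: "\<And>ts. \<forall>\<^sub>F p in F. E p ([] # ts) = E p ts"
    and rec: "\<And>s ss ts. s > 0 \<Longrightarrow> \<forall>u\<in>set ss. u > 0 \<Longrightarrow> \<forall>t\<in>set ts. \<forall>u\<in>set t. u > 0 \<Longrightarrow>
      \<forall>\<^sub>F p in F. E p ((s # ss) # ts) = \<tau> p s * E p (ss # ts)
        + (\<Sum>k<length ss. E p ((take k ss @ [ss ! k + s]) # drop (Suc k) ss # ts))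
        + (\<Sum>us\<leftarrow>merges s ss ts. E p us) / (of_nat (n p))\<^sup>2"
    and \<tau>: "\<And>s. s > 0 \<Longrightarrow> ((\<lambda>p. \<tau> p s) \<longlongrightarrow> K s) F"
    and n: "filterlim n at_top F"
    and pos: "\<forall>t\<in>set ts. \<forall>u\<in>set t. u > 0"
  shows "((\<lambda>p. E p ts) \<longlongrightarrow> (\<Prod>t\<leftarrow>ts. word_limit K t)) F"
  using pos
\<comment> \<open>A split removes one letter but creates one more word, so letters have to count
  twice. Counting words as well lets the measure drop when an empty word is discarded.\<close>
proof (induction "2 * sum_list (map length ts) + length ts" arbitrary: ts rule: less_induct)
  case less
  show ?case
  proof (cases ts)
    case Nil
    then show ?thesis using nil by (auto intro: tendsto_eventually)
  next
    case (Cons w vs)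
    show ?thesis
    proof (cases w)
      case Nil
      have "((\<lambda>p. E p vs) \<longlongrightarrow> (\<Prod>t\<leftarrow>vs. word_limit K t)) F"
        using less.prems by (intro less) (auto simp: Cons)
      then show ?thesis
        using tendsto_cong[OF empty[of vs]] by (simp add: Cons Nil)
    next
      case w: (Cons s ss)
      have p: "s > 0" "\<forall>u\<in>set ss. u > 0" "\<forall>t\<in>set vs. \<forall>u\<in>set t. u > 0"
        using less.prems by (auto simp: Cons w)
      have 1: "((\<lambda>p. E p (ss # vs)) \<longlongrightarrow> (\<Prod>t\<leftarrow>ss # vs. word_limit K t)) F"
        using p by (intro less) (auto simp: Cons w)
      have 2: "((\<lambda>p. E p ((take k ss @ [ss ! k + s]) # drop (Suc k) ss # vs)) \<longlongrightarrow>
          (\<Prod>t\<leftarrow>(take k ss @ [ss ! k + s]) # drop (Suc k) ss # vs. word_limit K t)) F"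
        if "k < length ss" for k
        using p that by (intro less) (auto simp: Cons w dest: in_set_takeD in_set_dropD)
      have 3: "((\<lambda>p. E p us) \<longlongrightarrow> (\<Prod>t\<leftarrow>us. word_limit K t)) F" if "us \<in> set (merges s ss vs)" for us
        using merges_positive[OF that p(3,2,1)] merges_size[OF that]
        by (intro less) (auto simp: Cons w)
      have "((\<lambda>p. \<Sum>us\<leftarrow>uss. E p us) \<longlongrightarrow> (\<Sum>us\<leftarrow>uss. \<Prod>t\<leftarrow>us. word_limit K t)) F"
        if "set uss \<subseteq> set (merges s ss vs)" for uss
        using that by (induction uss) (auto intro!: tendsto_add 3)
      then have 4: "((\<lambda>p. \<Sum>us\<leftarrow>merges s ss vs. E p us) \<longlongrightarrow>
          (\<Sum>us\<leftarrow>merges s ss vs. \<Prod>t\<leftarrow>us. word_limit K t)) F"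
        by blast
      have "((\<lambda>p. 1 / real (n p)) \<longlongrightarrow> 0) F"
        using filterlim_compose[OF lim_1_over_n n] .
      then have "((\<lambda>p. complex_of_real (1 / real (n p))) \<longlongrightarrow> complex_of_real 0) F"
        by (rule tendsto_of_real)
      then have "((\<lambda>p. (complex_of_real (1 / real (n p)))\<^sup>2) \<longlongrightarrow> 0) F"
        using tendsto_power[of _ "complex_of_real 0" F 2] by simp
      from tendsto_mult[OF 4 this]
      have 5: "((\<lambda>p. (\<Sum>us\<leftarrow>merges s ss vs. E p us) / (of_nat (n p))\<^sup>2) \<longlongrightarrow> 0) F"
        by (simp add: power_divide)
      have "((\<lambda>p. \<tau> p s * E p (ss # vs)
          + (\<Sum>k<length ss. E p ((take k ss @ [ss ! k + s]) # drop (Suc k) ss # vs))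
          + (\<Sum>us\<leftarrow>merges s ss vs. E p us) / (of_nat (n p))\<^sup>2) \<longlongrightarrow>
          K s * (\<Prod>t\<leftarrow>ss # vs. word_limit K t)
          + (\<Sum>k<length ss. \<Prod>t\<leftarrow>(take k ss @ [ss ! k + s]) # drop (Suc k) ss # vs. word_limit K t) + 0) F"
        using 2 by (intro tendsto_add tendsto_mult \<tau> p(1) 1 5 tendsto_sum) auto
      also have "K s * (\<Prod>t\<leftarrow>ss # vs. word_limit K t)
          + (\<Sum>k<length ss. \<Prod>t\<leftarrow>(take k ss @ [ss ! k + s]) # drop (Suc k) ss # vs. word_limit K t) + 0
        = (\<Prod>t\<leftarrow>ts. word_limit K t)"
        by (simp add: Cons w distrib_right sum_distrib_right mult.assoc)
      finally show ?thesis
        using tendsto_cong[OF rec[OF p]] by (simp add: Cons w)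
    qed
  qed
qed

subsection \<open>Gaussian integration by parts\<close>

locale gaussian_family = prob_space \<Omega>
  for \<Omega> :: "'w measure" +
  fixes I :: "'i set" and \<xi> :: "'i \<Rightarrow> 'w \<Rightarrow> real" and \<sigma> :: real
  assumes finite_I: "finite I"
    and \<sigma>_pos: "\<sigma> > 0"
    and indep: "indep_vars (\<lambda>_. borel) \<xi> I"
    and normal: "\<And>e. e \<in> I \<Longrightarrow> distributed \<Omega> lborel (\<xi> e) (\<lambda>x. ennreal (normal_density 0 \<sigma> x))"
begin

definition mon :: "'i list \<Rightarrow> 'w \<Rightarrow> real" where
  "mon es \<omega> = (\<Prod>e\<leftarrow>es. \<xi> e \<omega>)"

text \<open>Formal partial derivative by the Leibniz rule along the list; each occurrence of e
  contributes, whence the factor \<open>count_list es e\<close> in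
  \<open>dmon_eq_prod\<close>.\<close>

fun dmon :: "'i \<Rightarrow> 'i list \<Rightarrow> 'w \<Rightarrow> real" where
  "dmon e [] \<omega> = 0"
| "dmon e (e' # es) \<omega> = of_bool (e = e') * mon es \<omega> + \<xi> e' \<omega> * dmon e es \<omega>"

lemma mon_simps [simp]: "mon [] \<omega> = 1" "mon (e # es) \<omega> = \<xi> e \<omega> * mon es \<omega>"
  by (simp_all add: mon_def)

lemma mon_Cons: "mon (e # es) = (\<lambda>\<omega>. \<xi> e \<omega> * mon es \<omega>)"
  by (simp add: fun_eq_iff)

lemma mon_append: "mon (es @ fs) \<omega> = mon es \<omega> * mon fs \<omega>"
  by (simp add: mon_def)

lemma dmon_append: "dmon e (es @ fs) \<omega> = dmon e es \<omega> * mon fs \<omega> + mon es \<omega> * dmon e fs \<omega>"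
  by (induction es) (simp_all add: mon_append algebra_simps)

lemma power_moment:
  assumes "e \<in> I"
  shows "integrable \<Omega> (\<lambda>\<omega>. \<xi> e \<omega> ^ k)"
    and "expectation (\<lambda>\<omega>. \<xi> e \<omega> ^ k) = (\<integral>x. normal_density 0 \<sigma> x * x ^ k \<partial>lborel)"
proof -
  have i: "integrable lborel (\<lambda>x. normal_density 0 \<sigma> x * x ^ k)"
    using integrable_normal_moment[OF \<sigma>_pos, of 0 k] by simp
  show "integrable \<Omega> (\<lambda>\<omega>. \<xi> e \<omega> ^ k)"
    using distributed_integrable[OF normal[OF assms], of "\<lambda>x. x ^ k"] i by simp
  show "expectation (\<lambda>\<omega>. \<xi> e \<omega> ^ k) = (\<integral>x. normal_density 0 \<sigma> x * x ^ k \<partial>lborel)"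
    using distributed_integral[OF normal[OF assms], of "\<lambda>x. x ^ k"] by simp
qed

text \<open>Stein's identity for a power of one variable, read off the closed formula for Gaussian
  moments. For even k both sides vanish by symmetry, and at k = 0 the factor k cancels the term in
  which k - 1 is truncated to 0.\<close>

lemma power_moment_Suc:
  assumes "e \<in> I"
  shows "expectation (\<lambda>\<omega>. \<xi> e \<omega> ^ Suc k) = \<sigma>\<^sup>2 * k * expectation (\<lambda>\<omega>. \<xi> e \<omega> ^ (k - 1))"
proof (cases "even k")
  case True
  then obtain j where j: "k = 2 * j" by blast
  have 1: "(\<integral>x. normal_density 0 \<sigma> x * x ^ Suc k \<partial>lborel) = 0"
    using integral_normal_moment_odd[OF \<sigma>_pos, of 0 j] j by simp
  have "real k * (\<integral>x. normal_density 0 \<sigma> x * x ^ (k - 1) \<partial>lborel) = 0"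
  proof (cases j)
    case (Suc i)
    then show ?thesis
      using integral_normal_moment_odd[OF \<sigma>_pos, of 0 i] j by simp
  qed (simp add: j)
  then show ?thesis using 1 unfolding power_moment(2)[OF assms] by simp
next
  case False
  then obtain j where j: "k = 2 * j + 1" by (auto elim: oddE)
  have 1: "(\<integral>x. normal_density 0 \<sigma> x * x ^ Suc k \<partial>lborel) = fact (2 * Suc j) / ((2 / \<sigma>\<^sup>2) ^ Suc j * fact (Suc j))"
    using integral_normal_moment_even[OF \<sigma>_pos, of 0 "Suc j"] j by simp
  have 2: "(\<integral>x. normal_density 0 \<sigma> x * x ^ (k - 1) \<partial>lborel) = fact (2 * j) / ((2 / \<sigma>\<^sup>2) ^ j * fact j)"
    using integral_normal_moment_even[OF \<sigma>_pos, of 0 j] j by simp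
  have 3: "fact (2 * Suc j) / ((2 / \<sigma>\<^sup>2) ^ Suc j * fact (Suc j))
      = \<sigma>\<^sup>2 * real k * (fact (2 * j) / ((2 / \<sigma>\<^sup>2) ^ j * fact j))"
    using \<sigma>_pos j by (simp add: divide_simps)
  show ?thesis using 1 2 3 assms by (simp only: power_moment(2))
qed

lemma expectation_prod_power:
  shows "integrable \<Omega> (\<lambda>\<omega>. \<Prod>e\<in>I. \<xi> e \<omega> ^ c e)"
    and "expectation (\<lambda>\<omega>. \<Prod>e\<in>I. \<xi> e \<omega> ^ c e) = (\<Prod>e\<in>I. expectation (\<lambda>\<omega>. \<xi> e \<omega> ^ c e))"
proof -
  have "indep_vars (\<lambda>_. borel) (\<lambda>e \<omega>. \<xi> e \<omega> ^ c e) I"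
    by (rule indep_vars_compose2[OF indep]) simp
  then show "integrable \<Omega> (\<lambda>\<omega>. \<Prod>e\<in>I. \<xi> e \<omega> ^ c e)"
    and "expectation (\<lambda>\<omega>. \<Prod>e\<in>I. \<xi> e \<omega> ^ c e) = (\<Prod>e\<in>I. expectation (\<lambda>\<omega>. \<xi> e \<omega> ^ c e))"
    using indep_vars_integrable[OF finite_I, of "\<lambda>e \<omega>. \<xi> e \<omega> ^ c e"]
      indep_vars_lebesgue_integral[OF finite_I, of "\<lambda>e \<omega>. \<xi> e \<omega> ^ c e"] power_moment(1) by auto
qed

lemma mon_eq_prod:
  assumes "set es \<subseteq> I"
  shows "mon es \<omega> = (\<Prod>e\<in>I. \<xi> e \<omega> ^ count_list es e)"
  using assms
proof (induction es)
  case (Cons a es)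
  then have a: "a \<in> I" by simp
  have "(\<Prod>e\<in>I. \<xi> e \<omega> ^ count_list (a # es) e)
      = (\<Prod>e\<in>I. (if e = a then \<xi> e \<omega> else 1) * \<xi> e \<omega> ^ count_list es e)"
    by (intro prod.cong) auto
  also have "\<dots> = \<xi> a \<omega> * (\<Prod>e\<in>I. \<xi> e \<omega> ^ count_list es e)"
    using a finite_I by (simp add: prod.distrib)
  finally show ?case using Cons by simp
qed simp

lemma dmon_eq_prod:
  assumes "set es \<subseteq> I" "e \<in> I"
  shows "dmon e es \<omega> = real (count_list es e)
    * (\<xi> e \<omega> ^ (count_list es e - 1) * (\<Prod>e'\<in>I - {e}. \<xi> e' \<omega> ^ count_list es e'))"
  using assms(1)
proof (induction es)
  case (Cons a es)
  then have a: "a \<in> I" and es: "set es \<subseteq> I" by auto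
  let ?P = "\<lambda>es. \<Prod>e'\<in>I - {e}. \<xi> e' \<omega> ^ count_list es e'"
  have m: "mon es \<omega> = \<xi> e \<omega> ^ count_list es e * ?P es"
    unfolding mon_eq_prod[OF es] using finite_I assms(2) by (rule prod.remove)
  show ?case
  proof (cases "a = e")
    case True
    then have "?P (a # es) = ?P es" by (intro prod.cong) auto
    moreover have "\<xi> e \<omega> * (real (count_list es e) * \<xi> e \<omega> ^ (count_list es e - 1))
        = real (count_list es e) * \<xi> e \<omega> ^ count_list es e"
      by (cases "count_list es e") auto
    ultimately show ?thesis using Cons.IH[OF es] m True
      by (auto simp: algebra_simps simp del: One_nat_def)
  next
    case False
    have "?P (a # es) = (\<Prod>e'\<in>I - {e}. (if e' = a then \<xi> e' \<omega> else 1) * \<xi> e' \<omega> ^ count_list es e')"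
      by (intro prod.cong) auto
    also have "\<dots> = \<xi> a \<omega> * ?P es"
      using a finite_I False by (simp add: prod.distrib)
    finally show ?thesis using Cons es False by (simp add: algebra_simps)
  qed
qed simp

lemma integrable_mon: "set es \<subseteq> I \<Longrightarrow> integrable \<Omega> (mon es)"
  using expectation_prod_power(1)[of "count_list es"] by (simp add: mon_eq_prod cong: Bochner_Integration.integrable_cong)

lemma expectation_mon:
  assumes "set es \<subseteq> I"
  shows "expectation (mon es) = (\<Prod>e\<in>I. expectation (\<lambda>\<omega>. \<xi> e \<omega> ^ count_list es e))"
  unfolding expectation_prod_power(2)[symmetric] using mon_eq_prod[OF assms] by metis

lemma prod_fun_upd:
  assumes "e \<in> I"
  shows "(\<Prod>e'\<in>I. g e' ((c(e := k)) e')) = g e k * (\<Prod>e'\<in>I - {e}. g e' (c e'))"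
  unfolding prod.remove[OF finite_I assms]
  by (intro arg_cong2[where f = "(*)"] prod.cong) auto

text \<open>Independence factors both sides over the variables. Only the factor belonging to e
  differs, and there the claim is \<open>power_moment_Suc\<close>.\<close>

lemma wick:
  assumes "set es \<subseteq> I" "e \<in> I"
  shows "expectation (mon (e # es)) = \<sigma>\<^sup>2 * expectation (dmon e es)"
    and "integrable \<Omega> (dmon e es)"
proof -
  define c where "c = count_list es"
  define c' where "c' = c(e := c e - 1)"
  have c: "count_list (e # es) = c(e := Suc (c e))" by (auto simp: c_def)
  have d: "dmon e es \<omega> = real (c e) * (\<Prod>e'\<in>I. \<xi> e' \<omega> ^ c' e')" for \<omega>
    unfolding dmon_eq_prod[OF assms] c'_def
    using prod_fun_upd[OF assms(2), of "\<lambda>e k. \<xi> e \<omega> ^ k" c] by (simp add: c_def)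
  show "integrable \<Omega> (dmon e es)"
    unfolding d[abs_def] by (intro integrable_mult_right expectation_prod_power(1))
  have "expectation (mon (e # es)) = (\<Prod>e'\<in>I. expectation (\<lambda>\<omega>. \<xi> e' \<omega> ^ (c(e := Suc (c e))) e'))"
    using assms by (subst expectation_mon) (auto simp: c)
  also have "\<dots> = expectation (\<lambda>\<omega>. \<xi> e \<omega> ^ Suc (c e)) * (\<Prod>e'\<in>I-{e}. expectation (\<lambda>\<omega>. \<xi> e' \<omega> ^ c e'))"
    by (rule prod_fun_upd[OF assms(2)])
  also have "\<dots> = \<sigma>\<^sup>2 * (c e * (expectation (\<lambda>\<omega>. \<xi> e \<omega> ^ (c e - 1)) * (\<Prod>e'\<in>I-{e}. expectation (\<lambda>\<omega>. \<xi> e' \<omega> ^ c e'))))"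
    unfolding power_moment_Suc[OF assms(2)] by simp
  also have "expectation (\<lambda>\<omega>. \<xi> e \<omega> ^ (c e - 1)) * (\<Prod>e'\<in>I-{e}. expectation (\<lambda>\<omega>. \<xi> e' \<omega> ^ c e'))
     = (\<Prod>e'\<in>I. expectation (\<lambda>\<omega>. \<xi> e' \<omega> ^ c' e'))"
    unfolding c'_def by (rule prod_fun_upd[OF assms(2), symmetric])
  also have "c e * \<dots> = expectation (dmon e es)"
    unfolding d[abs_def] by (simp add: expectation_prod_power(2))
  finally show "expectation (mon (e # es)) = \<sigma>\<^sup>2 * expectation (dmon e es)" .
qed

text \<open>Polynomials in the variables \<open>\<xi>\<close>, as functions on the sample space, together with formal gradients.\<close>

inductive has_deriv :: "('w \<Rightarrow> complex) \<Rightarrow> ('i \<Rightarrow> 'w \<Rightarrow> complex) \<Rightarrow> bool" where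
  mono: "set es \<subseteq> I \<Longrightarrow> has_deriv (\<lambda>\<omega>. c * of_real (mon es \<omega>)) (\<lambda>e \<omega>. c * of_real (dmon e es \<omega>))"
| add: "has_deriv f f' \<Longrightarrow> has_deriv g g' \<Longrightarrow> has_deriv (\<lambda>\<omega>. f \<omega> + g \<omega>) (\<lambda>e \<omega>. f' e \<omega> + g' e \<omega>)"

lemma has_deriv_const: "has_deriv (\<lambda>_. c) (\<lambda>_ _. 0)"
  using mono[of "[]" c] by simp

lemma has_deriv_var: "e \<in> I \<Longrightarrow> has_deriv (\<lambda>\<omega>. of_real (\<xi> e \<omega>)) (\<lambda>e' _. of_bool (e' = e))"
  using mono[of "[e]" 1] by (simp add: of_bool_def if_distrib[of complex_of_real] cong: if_cong)

text \<open>Both factors are sums of monomials, so a nested induction reduces the product rule to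
  concatenation of lists, that is to \<open>mon_append\<close> and
  \<open>dmon_append\<close>.\<close>

lemma has_deriv_mult:
  assumes "has_deriv f f'" "has_deriv g g'"
  shows "has_deriv (\<lambda>\<omega>. f \<omega> * g \<omega>) (\<lambda>e \<omega>. f' e \<omega> * g \<omega> + f \<omega> * g' e \<omega>)"
  using assms
proof (induction arbitrary: g g' rule: has_deriv.induct)
  case (mono es c)
  from mono(2,1) show ?case
  proof (induction rule: has_deriv.induct)
    case (mono fs d)
    have "has_deriv (\<lambda>\<omega>. (c * d) * of_real (mon (es @ fs) \<omega>)) (\<lambda>e \<omega>. (c * d) * of_real (dmon e (es @ fs) \<omega>))"
      using mono by (intro has_deriv.mono) simp
    then show ?case by (simp add: mon_append dmon_append algebra_simps)
  next
    case (add f f' g g')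
    from has_deriv.add[OF add.IH(1,2)] add.prems show ?case by (simp add: algebra_simps)
  qed
next
  case (add f f' h h')
  from has_deriv.add[OF add.IH(1,2)[OF add.prems]] show ?case by (simp add: algebra_simps)
qed

lemma has_deriv_integrable:
  assumes "has_deriv f f'"
  shows "integrable \<Omega> f" "e \<in> I \<Longrightarrow> integrable \<Omega> (f' e)"
    "e \<in> I \<Longrightarrow> integrable \<Omega> (\<lambda>\<omega>. of_real (\<xi> e \<omega>) * f \<omega>)"
  using assms
proof (induction rule: has_deriv.induct)
  case (mono es c)
  { case 1 show ?case using integrable_mon[OF mono] by simp }
  { case 2 show ?case using wick(2)[OF mono 2] by simp }
  { case 3 show ?case using integrable_mon[of "e # es"] mono 3
      by (simp add: mon_Cons mult.left_commute[of _ c] flip: of_real_mult) }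
qed (simp_all add: distrib_left)

lemma integration_by_parts:
  assumes "has_deriv f f'" "e \<in> I"
  shows "expectation (\<lambda>\<omega>. of_real (\<xi> e \<omega>) * f \<omega>) = of_real (\<sigma>\<^sup>2) * expectation (f' e)"
  using assms(1)
proof (induction rule: has_deriv.induct)
  case (mono es c)
  have "expectation (\<lambda>\<omega>. of_real (\<xi> e \<omega>) * (c * of_real (mon es \<omega>))) = c * of_real (expectation (mon (e # es)))"
    by (simp add: mon_Cons mult.left_commute[of _ c] flip: of_real_mult)
  also have "\<dots> = of_real (\<sigma>\<^sup>2) * expectation (\<lambda>\<omega>. c * of_real (dmon e es \<omega>))"
    unfolding wick(1)[OF mono assms(2)] by simp
  finally show ?case .
next
  case (add f f' g g')
  note [simp] = has_deriv_integrable[OF add(1)] has_deriv_integrable[OF add(2)] assms(2)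
  from add.IH show ?case by (simp add: distrib_left)
qed

end

subsection \<open>Words in a Gaussian matrix\<close>

text \<open>\<open>D s\<close> plays the role of the \<open>s\<close>-th power of a deterministic matrix; only the semigroup law matters.
  The letter \<open>s\<close> stands for \<open>W s = X (D s) X\<^sup>*\<close>.\<close>

locale gaussian_matrix =
  gaussian_family \<Omega> "{..<N} \<times> {..<L} \<times> (UNIV :: bool set)"
    "\<lambda>(i, j, b) \<omega>. if b then Re (x i j \<omega>) else Im (x i j \<omega>)" "sqrt (1 / (2 * real N))"
  for \<Omega> :: "'w measure" and N L :: nat and x :: "nat \<Rightarrow> nat \<Rightarrow> 'w \<Rightarrow> complex" +
  fixes D :: "nat \<Rightarrow> nat \<Rightarrow> nat \<Rightarrow> complex"
  assumes D_mult: "\<And>s t i k. s > 0 \<Longrightarrow> t > 0 \<Longrightarrow> i < L \<Longrightarrow> k < L \<Longrightarrow>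
      (\<Sum>j<L. D s i j * D t j k) = D (s + t) i k"
begin

lemma N_pos: "N > 0"
  using \<sigma>_pos by (cases N) auto

text \<open>\<open>h i j\<close> is the derivative of \<open>f\<close> with respect to the conjugate of \<open>x i j\<close>.\<close>

definition wirtinger :: "('w \<Rightarrow> complex) \<Rightarrow> (nat \<Rightarrow> nat \<Rightarrow> 'w \<Rightarrow> complex) \<Rightarrow> bool" where
  "wirtinger f h \<longleftrightarrow> (\<exists>g. has_deriv f g \<and>
     (\<forall>i<N. \<forall>j<L. \<forall>\<omega>. h i j \<omega> = (g (i, j, True) \<omega> + \<i> * g (i, j, False) \<omega>) / 2))"

lemma wirtinger_cong:
  assumes "wirtinger f h" "\<And>i j \<omega>. i < N \<Longrightarrow> j < L \<Longrightarrow> h' i j \<omega> = h i j \<omega>"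
  shows "wirtinger f h'"
proof -
  from assms(1) obtain g where "has_deriv f g"
    "\<forall>i<N. \<forall>j<L. \<forall>\<omega>. h i j \<omega> = (g (i, j, True) \<omega> + \<i> * g (i, j, False) \<omega>) / 2"
    unfolding wirtinger_def by blast
  then show ?thesis unfolding wirtinger_def by (intro exI[of _ g]) (simp add: assms(2))
qed

lemma wirtinger_const: "wirtinger (\<lambda>_. c) (\<lambda>_ _ _. 0)"
  unfolding wirtinger_def using has_deriv_const[of c] by force

lemma wirtinger_add:
  assumes "wirtinger f f'" "wirtinger g g'"
  shows "wirtinger (\<lambda>\<omega>. f \<omega> + g \<omega>) (\<lambda>i j \<omega>. f' i j \<omega> + g' i j \<omega>)"
proof -
  from assms obtain a b where ab: "has_deriv f a" "has_deriv g b"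
    "\<forall>i<N. \<forall>j<L. \<forall>\<omega>. f' i j \<omega> = (a (i, j, True) \<omega> + \<i> * a (i, j, False) \<omega>) / 2"
    "\<forall>i<N. \<forall>j<L. \<forall>\<omega>. g' i j \<omega> = (b (i, j, True) \<omega> + \<i> * b (i, j, False) \<omega>) / 2"
    unfolding wirtinger_def by blast
  show ?thesis unfolding wirtinger_def
    by (intro exI[of _ "\<lambda>e \<omega>. a e \<omega> + b e \<omega>"]) (use ab in \<open>simp add: has_deriv.add field_simps\<close>)
qed

lemma wirtinger_mult:
  assumes "wirtinger f f'" "wirtinger g g'"
  shows "wirtinger (\<lambda>\<omega>. f \<omega> * g \<omega>) (\<lambda>i j \<omega>. f' i j \<omega> * g \<omega> + f \<omega> * g' i j \<omega>)"
proof -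
  from assms obtain a b where ab: "has_deriv f a" "has_deriv g b"
    "\<forall>i<N. \<forall>j<L. \<forall>\<omega>. f' i j \<omega> = (a (i, j, True) \<omega> + \<i> * a (i, j, False) \<omega>) / 2"
    "\<forall>i<N. \<forall>j<L. \<forall>\<omega>. g' i j \<omega> = (b (i, j, True) \<omega> + \<i> * b (i, j, False) \<omega>) / 2"
    unfolding wirtinger_def by blast
  show ?thesis unfolding wirtinger_def
    by (intro exI[of _ "\<lambda>e \<omega>. a e \<omega> * g \<omega> + f \<omega> * b e \<omega>"] conjI has_deriv_mult ab(1,2))
      (simp add: ab(3,4) field_simps)
qed

lemma wirtinger_cmult: "wirtinger f f' \<Longrightarrow> wirtinger (\<lambda>\<omega>. c * f \<omega>) (\<lambda>i j \<omega>. c * f' i j \<omega>)"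
  using wirtinger_mult[OF wirtinger_const[of c], of f f'] by simp

lemma wirtinger_sum:
  assumes "finite S" "\<And>k. k \<in> S \<Longrightarrow> wirtinger (f k) (f' k)"
  shows "wirtinger (\<lambda>\<omega>. \<Sum>k\<in>S. f k \<omega>) (\<lambda>i j \<omega>. \<Sum>k\<in>S. f' k i j \<omega>)"
  using assms
proof (induction S)
  case empty
  show ?case using wirtinger_const[of 0] by simp
next
  case (insert k S)
  then show ?case using wirtinger_add[of "f k" "f' k"] by simp
qed

lemma has_deriv_parts:
  assumes "k < N" "l < L"
  shows "has_deriv (\<lambda>\<omega>. of_real (Re (x k l \<omega>))) (\<lambda>e _. of_bool (e = (k, l, True)))"
    "has_deriv (\<lambda>\<omega>. of_real (Im (x k l \<omega>))) (\<lambda>e _. of_bool (e = (k, l, False)))"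
  using has_deriv_var[of "(k, l, True)"] has_deriv_var[of "(k, l, False)"] assms by simp_all

text \<open>The parts contribute (1 + \<i> * \<i>) / 2 = 0 for an entry and (1 - \<i> * \<i>) / 2 =
  1 for its conjugate. This is why an X pairs with an X^* and never with another X.\<close>

lemma wirtinger_entry:
  assumes "k < N" "l < L"
  shows "wirtinger (x k l) (\<lambda>i j _. 0)"
    and "wirtinger (\<lambda>\<omega>. cnj (x k l \<omega>)) (\<lambda>i j _. of_bool (i = k \<and> j = l))"
proof -
  have re: "wirtinger (\<lambda>\<omega>. of_real (Re (x k l \<omega>))) (\<lambda>i j _. of_bool (i = k \<and> j = l) / 2)"
    unfolding wirtinger_def
    by (rule exI[of _ "\<lambda>e _. of_bool (e = (k, l, True))"]) (simp add: has_deriv_parts[OF assms])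
  have im: "wirtinger (\<lambda>\<omega>. of_real (Im (x k l \<omega>))) (\<lambda>i j _. \<i> * of_bool (i = k \<and> j = l) / 2)"
    unfolding wirtinger_def
    by (rule exI[of _ "\<lambda>e _. of_bool (e = (k, l, False))"]) (simp add: has_deriv_parts[OF assms])
  have "x k l = (\<lambda>\<omega>. of_real (Re (x k l \<omega>)) + \<i> * of_real (Im (x k l \<omega>)))"
    by (auto simp: complex_eq_iff)
  then show "wirtinger (x k l) (\<lambda>i j _. 0)"
    using wirtinger_add[OF re wirtinger_cmult[OF im, of \<i>]] by (simp add: algebra_simps)
  have "(\<lambda>\<omega>. cnj (x k l \<omega>)) = (\<lambda>\<omega>. of_real (Re (x k l \<omega>)) + (-\<i>) * of_real (Im (x k l \<omega>)))"
    by (auto simp: complex_eq_iff)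
  then show "wirtinger (\<lambda>\<omega>. cnj (x k l \<omega>)) (\<lambda>i j _. of_bool (i = k \<and> j = l))"
    using wirtinger_add[OF re wirtinger_cmult[OF im, of "-\<i>"]] by (simp add: algebra_simps)
qed

lemma wirtinger_integrable:
  assumes "wirtinger f h"
  shows "integrable \<Omega> f" "i < N \<Longrightarrow> j < L \<Longrightarrow> integrable \<Omega> (h i j)"
proof -
  from assms obtain g where g: "has_deriv f g"
    "\<forall>i<N. \<forall>j<L. \<forall>\<omega>. h i j \<omega> = (g (i, j, True) \<omega> + \<i> * g (i, j, False) \<omega>) / 2"
    unfolding wirtinger_def by blast
  show "integrable \<Omega> f" by (rule has_deriv_integrable(1)[OF g(1)])
  assume ij: "i < N" "j < L"
  then have "h i j = (\<lambda>\<omega>. (g (i, j, True) \<omega> + \<i> * g (i, j, False) \<omega>) / 2)" using g(2) by auto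
  then show "integrable \<Omega> (h i j)"
    using has_deriv_integrable(2)[OF g(1)] ij by simp
qed

text \<open>Each of the two real parts brings its variance 1 / (2N); the denominator 2 in the
  Wirtinger derivative turns this into 1 / N.\<close>

lemma wirtinger_by_parts:
  assumes "wirtinger f h" "i < N" "j < L"
  shows "expectation (\<lambda>\<omega>. x i j \<omega> * f \<omega>) = expectation (h i j) / of_nat N"
proof -
  from assms obtain g where g: "has_deriv f g"
    "\<forall>i<N. \<forall>j<L. \<forall>\<omega>. h i j \<omega> = (g (i, j, True) \<omega> + \<i> * g (i, j, False) \<omega>) / 2"
    unfolding wirtinger_def by blast
  have h: "h i j = (\<lambda>\<omega>. (g (i, j, True) \<omega> + \<i> * g (i, j, False) \<omega>) / 2)" using g(2) assms by auto
  have e: "(i, j, True) \<in> {..<N} \<times> {..<L} \<times> UNIV" "(i, j, False) \<in> {..<N} \<times> {..<L} \<times> UNIV"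
    using assms by auto
  have int: "integrable \<Omega> (\<lambda>\<omega>. of_real (Re (x i j \<omega>)) * f \<omega>)" "integrable \<Omega> (\<lambda>\<omega>. of_real (Im (x i j \<omega>)) * f \<omega>)"
    using has_deriv_integrable(3)[OF g(1) e(1)] has_deriv_integrable(3)[OF g(1) e(2)] by simp_all
  note int' = has_deriv_integrable(2)[OF g(1) e(1)] has_deriv_integrable(2)[OF g(1) e(2)]
  have s: "(sqrt (1 / (2 * real N)))\<^sup>2 = 1 / (2 * real N)" by simp
  have "(\<lambda>\<omega>. x i j \<omega> * f \<omega>) = (\<lambda>\<omega>. of_real (Re (x i j \<omega>)) * f \<omega> + \<i> * (of_real (Im (x i j \<omega>)) * f \<omega>))"
    by (rule ext, subst (1) complex_eq[of "x i j _"]) (simp add: algebra_simps)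
  then have "expectation (\<lambda>\<omega>. x i j \<omega> * f \<omega>)
      = expectation (\<lambda>\<omega>. of_real (Re (x i j \<omega>)) * f \<omega>) + \<i> * expectation (\<lambda>\<omega>. of_real (Im (x i j \<omega>)) * f \<omega>)"
    using int by simp
  also have "\<dots> = expectation (h i j) / of_nat N"
    using integration_by_parts[OF g(1) e(1)] integration_by_parts[OF g(1) e(2)] int' N_pos
    unfolding s h by (simp add: field_simps)
  finally show ?thesis .
qed

text \<open>\<open>XD\<close> and \<open>DX\<close> are the two stumps of a letter: differentiating
  its X^* leaves \<open>XD\<close>, splitting off its X leaves \<open>DX\<close>.\<close>

definition XD :: "nat \<Rightarrow> nat \<Rightarrow> nat \<Rightarrow> 'w \<Rightarrow> complex" where
  "XD s a j \<omega> = (\<Sum>j'<L. x a j' \<omega> * D s j' j)"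

definition DX :: "nat \<Rightarrow> nat \<Rightarrow> nat \<Rightarrow> 'w \<Rightarrow> complex" where
  "DX s j c \<omega> = (\<Sum>l<L. D s j l * cnj (x c l \<omega>))"

definition W :: "nat \<Rightarrow> nat \<Rightarrow> nat \<Rightarrow> 'w \<Rightarrow> complex" where
  "W s a b \<omega> = (\<Sum>l<L. XD s a l \<omega> * cnj (x b l \<omega>))"

fun word :: "nat list \<Rightarrow> nat \<Rightarrow> nat \<Rightarrow> 'w \<Rightarrow> complex" where
  "word [] a b \<omega> = of_bool (a = b)"
| "word (s # ss) a b \<omega> = (\<Sum>c<N. W s a c \<omega> * word ss c b \<omega>)"

text \<open>Differentiation by the conjugate of \<open>x i j\<close> cuts a word open at one X^*:
  the left piece ends in column j of a stump, the right piece starts in row i.\<close>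

fun dword :: "nat list \<Rightarrow> nat \<Rightarrow> nat \<Rightarrow> nat \<Rightarrow> nat \<Rightarrow> 'w \<Rightarrow> complex" where
  "dword [] a b i j \<omega> = 0"
| "dword (s # ss) a b i j \<omega> = XD s a j \<omega> * word ss i b \<omega> + (\<Sum>c<N. W s a c \<omega> * dword ss c b i j \<omega>)"

lemma sum_of_bool_mult [simp]:
  fixes f :: "nat \<Rightarrow> complex"
  shows "a < n \<Longrightarrow> (\<Sum>c<n. of_bool (a = c) * f c) = f a" "a < n \<Longrightarrow> (\<Sum>c<n. f c * of_bool (a = c)) = f a"
    "a < n \<Longrightarrow> (\<Sum>c<n. of_bool (c = a) * f c) = f a" "a < n \<Longrightarrow> (\<Sum>c<n. f c * of_bool (c = a)) = f a"
  by (simp_all add: of_bool_def if_distrib if_distribR cong: if_cong)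

lemma W_eq: "W s a b \<omega> = (\<Sum>j<L. x a j \<omega> * DX s j b \<omega>)"
  unfolding W_def XD_def DX_def
  by (simp add: sum_distrib_left sum_distrib_right mult.assoc) (rule sum.swap)

text \<open>By the semigroup law of D, two stumps that meet form a single letter, and their indices
  add up.\<close>

lemma XD_DX:
  assumes "s > 0" "t > 0"
  shows "(\<Sum>j<L. XD t d j \<omega> * DX s j c \<omega>) = W (t + s) d c \<omega>"
proof -
  have "(\<Sum>j<L. XD t d j \<omega> * DX s j c \<omega>)
      = (\<Sum>j<L. \<Sum>j'<L. \<Sum>l<L. x d j' \<omega> * (D t j' j * D s j l) * cnj (x c l \<omega>))"
    unfolding XD_def DX_def by (simp add: sum_product mult.assoc)
  also have "\<dots> = (\<Sum>j'<L. \<Sum>l<L. \<Sum>j<L. x d j' \<omega> * (D t j' j * D s j l) * cnj (x c l \<omega>))"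
    by (rule trans[OF sum.swap]) (intro sum.cong refl sum.swap)
  also have "\<dots> = (\<Sum>j'<L. \<Sum>l<L. x d j' \<omega> * D (t + s) j' l * cnj (x c l \<omega>))"
    using D_mult[OF assms(2,1)]
    by (intro sum.cong refl) (simp flip: sum_distrib_left sum_distrib_right)
  also have "\<dots> = W (t + s) d c \<omega>"
    unfolding W_eq DX_def by (simp add: sum_distrib_left mult.assoc)
  finally show ?thesis .
qed

lemma wirtinger_XD: "a < N \<Longrightarrow> wirtinger (XD s a j) (\<lambda>_ _ _. 0)"
proof -
  assume "a < N"
  then have "wirtinger (\<lambda>\<omega>. \<Sum>j'<L. x a j' \<omega> * D s j' j) (\<lambda>_ _ \<omega>. \<Sum>j'<L. 0 * D s j' j + x a j' \<omega> * 0)"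
    by (intro wirtinger_sum wirtinger_mult wirtinger_entry wirtinger_const) auto
  then show ?thesis by (simp add: XD_def[abs_def])
qed

lemma wirtinger_DX: "c < N \<Longrightarrow> wirtinger (DX s j c) (\<lambda>i l _. D s j l * of_bool (i = c))"
proof -
  assume c: "c < N"
  then have "wirtinger (\<lambda>\<omega>. \<Sum>l<L. D s j l * cnj (x c l \<omega>)) (\<lambda>i k \<omega>. \<Sum>l<L. D s j l * of_bool (i = c \<and> k = l))"
    by (intro wirtinger_sum wirtinger_cmult wirtinger_entry) auto
  then show ?thesis
    unfolding DX_def[abs_def]
    by (rule wirtinger_cong) (simp add: of_bool_conj flip: sum_distrib_right mult.assoc)
qed

lemma wirtinger_W:
  assumes "a < N" "b < N"
  shows "wirtinger (W s a b) (\<lambda>i j \<omega>. XD s a j \<omega> * of_bool (i = b))"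
proof -
  have "wirtinger (\<lambda>\<omega>. \<Sum>l<L. XD s a l \<omega> * cnj (x b l \<omega>))
      (\<lambda>i j \<omega>. \<Sum>l<L. 0 * cnj (x b l \<omega>) + XD s a l \<omega> * of_bool (i = b \<and> j = l))"
    using assms by (intro wirtinger_sum wirtinger_mult wirtinger_entry wirtinger_XD) auto
  then show ?thesis
    unfolding W_def[abs_def]
    by (rule wirtinger_cong) (simp add: of_bool_conj flip: sum_distrib_right mult.assoc)
qed

lemma wirtinger_word: "a < N \<Longrightarrow> b < N \<Longrightarrow> wirtinger (word ss a b) (dword ss a b)"
proof (induction ss arbitrary: a)
  case Nil
  have *: "word [] a b = (\<lambda>_. of_bool (a = b))" by (rule ext) simp
  show ?case unfolding * by (rule wirtinger_cong[OF wirtinger_const]) simp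
next
  case (Cons s ss)
  have "wirtinger (\<lambda>\<omega>. \<Sum>c<N. W s a c \<omega> * word ss c b \<omega>)
     (\<lambda>i j \<omega>. \<Sum>c<N. (XD s a j \<omega> * of_bool (i = c)) * word ss c b \<omega> + W s a c \<omega> * dword ss c b i j \<omega>)"
    using Cons by (intro wirtinger_sum wirtinger_mult wirtinger_W) auto
  moreover have "word (s # ss) a b = (\<lambda>\<omega>. \<Sum>c<N. W s a c \<omega> * word ss c b \<omega>)" by (rule ext) simp
  ultimately have "wirtinger (word (s # ss) a b)
     (\<lambda>i j \<omega>. \<Sum>c<N. (XD s a j \<omega> * of_bool (i = c)) * word ss c b \<omega> + W s a c \<omega> * dword ss c b i j \<omega>)"
    by simp
  then show ?case
  proof (rule wirtinger_cong)
    fix i j \<omega> assume i: "i < N"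
    have "(\<Sum>c<N. (XD s a j \<omega> * of_bool (i = c)) * word ss c b \<omega>)
        = XD s a j \<omega> * (\<Sum>c<N. of_bool (i = c) * word ss c b \<omega>)"
      unfolding sum_distrib_left by (simp only: mult.assoc)
    then show "dword (s # ss) a b i j \<omega>
        = (\<Sum>c<N. (XD s a j \<omega> * of_bool (i = c)) * word ss c b \<omega> + W s a c \<omega> * dword ss c b i j \<omega>)"
      using i by (simp add: sum.distrib del: of_bool_eq_iff)
  qed
qed

lemma word_append:
  "a < N \<Longrightarrow> word (ss @ ts) a b \<omega> = (\<Sum>c<N. word ss a c \<omega> * word ts c b \<omega>)"
proof (induction ss arbitrary: a)
  case (Cons s ss)
  have "word ((s # ss) @ ts) a b \<omega> = (\<Sum>d<N. \<Sum>c<N. W s a d \<omega> * word ss d c \<omega> * word ts c b \<omega>)"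
    using Cons by (simp add: sum_distrib_left mult.assoc)
  also have "\<dots> = (\<Sum>c<N. word (s # ss) a c \<omega> * word ts c b \<omega>)"
    by (subst sum.swap) (simp add: sum_distrib_right)
  finally show ?case .
qed simp

text \<open>The Leibniz rule unrolled: summand k belongs to the cut at the X^* of letter k.\<close>

lemma dword_eq:
  assumes "a < N"
  shows "dword ss a b i j \<omega> = (\<Sum>k<length ss. (\<Sum>c<N. word (take k ss) a c \<omega> * XD (ss ! k) c j \<omega>)
      * word (drop (Suc k) ss) i b \<omega>)"
  using assms
proof (induction ss arbitrary: a)
  case (Cons s ss)
  let ?f = "\<lambda>k a. \<Sum>d<N. word (take k ss) a d \<omega> * XD (ss ! k) d j \<omega>"
  have "(\<Sum>c<N. W s a c \<omega> * dword ss c b i j \<omega>)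
      = (\<Sum>c<N. \<Sum>k<length ss. W s a c \<omega> * ?f k c * word (drop (Suc k) ss) i b \<omega>)"
  proof (intro sum.cong refl)
    fix c assume "c \<in> {..<N}"
    then have "c < N" by simp
    from Cons.IH[OF this] show "W s a c \<omega> * dword ss c b i j \<omega>
        = (\<Sum>k<length ss. W s a c \<omega> * ?f k c * word (drop (Suc k) ss) i b \<omega>)"
      by (simp only: mult.assoc flip: sum_distrib_left)
  qed
  also have "\<dots> = (\<Sum>k<length ss. (\<Sum>c<N. W s a c \<omega> * ?f k c) * word (drop (Suc k) ss) i b \<omega>)"
    by (subst sum.swap) (simp add: sum_distrib_right)
  also have "\<dots> = (\<Sum>k<length ss. (\<Sum>d<N. word (take (Suc k) (s # ss)) a d \<omega> * XD ((s # ss) ! Suc k) d j \<omega>)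
      * word (drop (Suc (Suc k)) (s # ss)) i b \<omega>)"
  proof (rule sum.cong[OF refl])
    fix k
    have "(\<Sum>c<N. W s a c \<omega> * ?f k c) = (\<Sum>d<N. \<Sum>c<N. W s a c \<omega> * word (take k ss) c d \<omega> * XD (ss ! k) d j \<omega>)"
      by (subst sum.swap) (simp add: sum_distrib_left mult.assoc)
    then have "(\<Sum>c<N. W s a c \<omega> * ?f k c)
        = (\<Sum>d<N. word (take (Suc k) (s # ss)) a d \<omega> * XD ((s # ss) ! Suc k) d j \<omega>)"
      by (simp add: sum_distrib_right)
    then show "(\<Sum>c<N. W s a c \<omega> * ?f k c) * word (drop (Suc k) ss) i b \<omega>
        = (\<Sum>d<N. word (take (Suc k) (s # ss)) a d \<omega> * XD ((s # ss) ! Suc k) d j \<omega>)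
          * word (drop (Suc (Suc k)) (s # ss)) i b \<omega>"
      by simp
  qed
  finally show ?case
    using Cons.prems by (simp only: dword.simps length_Cons sum.lessThan_Suc_shift) simp
qed simp

definition tr :: "nat list \<Rightarrow> 'w \<Rightarrow> complex" where
  "tr ss \<omega> = (\<Sum>a<N. word ss a a \<omega>) / of_nat N"

definition dtr :: "nat list \<Rightarrow> nat \<Rightarrow> nat \<Rightarrow> 'w \<Rightarrow> complex" where
  "dtr ss i j \<omega> = (\<Sum>a<N. dword ss a a i j \<omega>) / of_nat N"

lemma wirtinger_tr: "wirtinger (tr ss) (dtr ss)"
proof -
  have "wirtinger (\<lambda>\<omega>. 1 / of_nat N * (\<Sum>a<N. word ss a a \<omega>)) (\<lambda>i j \<omega>. 1 / of_nat N * (\<Sum>a<N. dword ss a a i j \<omega>))"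
    by (intro wirtinger_cmult wirtinger_sum wirtinger_word) auto
  then show ?thesis by (simp add: tr_def[abs_def] dtr_def[abs_def])
qed

fun traces :: "nat list list \<Rightarrow> 'w \<Rightarrow> complex" where
  "traces [] \<omega> = 1"
| "traces (t # ts) \<omega> = tr t \<omega> * traces ts \<omega>"

fun dtraces :: "nat list list \<Rightarrow> nat \<Rightarrow> nat \<Rightarrow> 'w \<Rightarrow> complex" where
  "dtraces [] i j \<omega> = 0"
| "dtraces (t # ts) i j \<omega> = dtr t i j \<omega> * traces ts \<omega> + tr t \<omega> * dtraces ts i j \<omega>"

lemma wirtinger_traces: "wirtinger (traces ts) (dtraces ts)"
proof (induction ts)
  case Nil
  show ?case using wirtinger_const[of 1] by (simp add: wirtinger_def)
next
  case (Cons t ts)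
  then show ?case using wirtinger_mult[OF wirtinger_tr[of t] Cons] by (simp add: wirtinger_def)
qed

lemma integrable_traces: "integrable \<Omega> (traces ts)"
  by (rule wirtinger_integrable(1)[OF wirtinger_traces])

end

section \<open>Contractions and the Schwinger-Dyson equation\<close>

lemma sum_mult_swap:
  fixes g :: "'a \<Rightarrow> 'b \<Rightarrow> 'c :: comm_semiring_0"
  shows "(\<Sum>j\<in>A. \<Sum>c\<in>B. g j c * (\<Sum>k\<in>K. F k j c * w k)) = (\<Sum>k\<in>K. (\<Sum>j\<in>A. \<Sum>c\<in>B. g j c * F k j c) * w k)"
proof -
  have "(\<Sum>j\<in>A. \<Sum>c\<in>B. g j c * (\<Sum>k\<in>K. F k j c * w k)) = (\<Sum>j\<in>A. \<Sum>c\<in>B. \<Sum>k\<in>K. g j c * F k j c * w k)"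
    by (simp add: sum_distrib_left mult.assoc)
  also have "\<dots> = (\<Sum>j\<in>A. \<Sum>k\<in>K. \<Sum>c\<in>B. g j c * F k j c * w k)"
    by (intro sum.cong refl sum.swap)
  also have "\<dots> = (\<Sum>k\<in>K. \<Sum>j\<in>A. \<Sum>c\<in>B. g j c * F k j c * w k)"
    by (rule sum.swap)
  finally show ?thesis by (simp add: sum_distrib_right)
qed

context gaussian_matrix
begin

text \<open>Here u is the word lying between the stump left by the first letter and the stump left
  by the cut.\<close>

lemma sum_DX_XD:
  assumes "s > 0" "t > 0"
  shows "(\<Sum>j<L. \<Sum>c<N. DX s j c \<omega> * (\<Sum>d<N. u c d * XD t d j \<omega>)) = (\<Sum>c<N. \<Sum>d<N. u c d * W (t + s) d c \<omega>)"
proof -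
  have "(\<Sum>j<L. \<Sum>c<N. DX s j c \<omega> * (\<Sum>d<N. u c d * XD t d j \<omega>))
      = (\<Sum>j<L. \<Sum>c<N. \<Sum>d<N. u c d * (XD t d j \<omega> * DX s j c \<omega>))"
    by (simp add: sum_distrib_left mult_ac)
  also have "\<dots> = (\<Sum>c<N. \<Sum>d<N. \<Sum>j<L. u c d * (XD t d j \<omega> * DX s j c \<omega>))"
    by (rule trans[OF sum.swap]) (intro sum.cong refl sum.swap)
  also have "\<dots> = (\<Sum>c<N. \<Sum>d<N. u c d * W (t + s) d c \<omega>)"
    by (simp add: XD_DX[OF assms] flip: sum_distrib_left)
  finally show ?thesis .
qed

lemma sum_word_snoc: "(\<Sum>c<N. \<Sum>d<N. word u c d \<omega> * W t d c \<omega>) = of_nat N * tr (u @ [t]) \<omega>"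
proof -
  have "(\<Sum>c<N. word (u @ [t]) c c \<omega>) = (\<Sum>c<N. \<Sum>d<N. word u c d \<omega> * W t d c \<omega>)"
    by (intro sum.cong refl) (simp add: word_append)
  then show ?thesis using N_pos by (simp add: tr_def)
qed

text \<open>The stump of s meets the cut at letter k and closes the part before it into a trace,
  while the sum over a closes the part behind it into another. Each normalized trace accounts for
  one factor N.\<close>

lemma split_term:
  assumes "s > 0" "\<And>t. t \<in> set ss \<Longrightarrow> t > 0"
  shows "(\<Sum>a<N. \<Sum>j<L. \<Sum>c<N. DX s j c \<omega> * dword ss c a a j \<omega>)
    = (of_nat N)\<^sup>2 * (\<Sum>k<length ss. tr (take k ss @ [ss ! k + s]) \<omega> * tr (drop (Suc k) ss) \<omega>)"
proof -
  have "(\<Sum>j<L. \<Sum>c<N. DX s j c \<omega> * dword ss c a a j \<omega>)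
      = (\<Sum>k<length ss. of_nat N * tr (take k ss @ [ss ! k + s]) \<omega> * word (drop (Suc k) ss) a a \<omega>)" for a
  proof -
    have "(\<Sum>j<L. \<Sum>c<N. DX s j c \<omega> * dword ss c a a j \<omega>)
        = (\<Sum>j<L. \<Sum>c<N. DX s j c \<omega> * (\<Sum>k<length ss.
            (\<Sum>d<N. word (take k ss) c d \<omega> * XD (ss ! k) d j \<omega>) * word (drop (Suc k) ss) a a \<omega>))"
      by (intro sum.cong refl) (simp add: dword_eq)
    also have "\<dots> = (\<Sum>k<length ss. of_nat N * tr (take k ss @ [ss ! k + s]) \<omega> * word (drop (Suc k) ss) a a \<omega>)"
      unfolding sum_mult_swap
      by (intro sum.cong refl) (simp add: sum_DX_XD[OF assms(1)] assms(2) sum_word_snoc)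
    finally show ?thesis .
  qed
  then have "(\<Sum>a<N. \<Sum>j<L. \<Sum>c<N. DX s j c \<omega> * dword ss c a a j \<omega>)
      = (\<Sum>k<length ss. \<Sum>a<N. of_nat N * tr (take k ss @ [ss ! k + s]) \<omega> * word (drop (Suc k) ss) a a \<omega>)"
    by simp (rule sum.swap)
  also have "\<dots> = (\<Sum>k<length ss. (of_nat N)\<^sup>2 * (tr (take k ss @ [ss ! k + s]) \<omega> * tr (drop (Suc k) ss) \<omega>))"
    using N_pos by (intro sum.cong refl) (simp add: power2_eq_square tr_def[of "drop _ _"] flip: sum_distrib_left)
  finally show ?thesis by (simp add: sum_distrib_left)
qed

text \<open>Cyclicity of the trace: cut at letter k, it opens into one word that starts behind the
  cut and runs around, hence \<open>drop\<close> before \<open>take\<close>.\<close>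

lemma dtr_eq:
  assumes "a < N"
  shows "dtr t a j \<omega> = (\<Sum>k<length t. \<Sum>d<N. word (drop (Suc k) t @ take k t) a d \<omega> * XD (t ! k) d j \<omega>) / of_nat N"
proof -
  have "(\<Sum>b<N. dword t b b a j \<omega>) = (\<Sum>k<length t. \<Sum>b<N. \<Sum>d<N.
      word (drop (Suc k) t) a b \<omega> * word (take k t) b d \<omega> * XD (t ! k) d j \<omega>)"
    by (subst sum.swap) (simp add: dword_eq sum_distrib_left sum_distrib_right mult_ac)
  also have "\<dots> = (\<Sum>k<length t. \<Sum>d<N. word (drop (Suc k) t @ take k t) a d \<omega> * XD (t ! k) d j \<omega>)"
  proof (rule sum.cong[OF refl])
    fix k
    show "(\<Sum>b<N. \<Sum>d<N. word (drop (Suc k) t) a b \<omega> * word (take k t) b d \<omega> * XD (t ! k) d j \<omega>)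
        = (\<Sum>d<N. word (drop (Suc k) t @ take k t) a d \<omega> * XD (t ! k) d j \<omega>)"
      by (subst sum.swap) (simp add: word_append[OF assms] sum_distrib_right)
  qed
  finally show ?thesis by (simp add: dtr_def)
qed

lemma word_dtr:
  assumes "c < N"
  shows "(\<Sum>a<N. word ss c a \<omega> * dtr t a j \<omega>) = (\<Sum>k<length t.
    (\<Sum>d<N. word (ss @ drop (Suc k) t @ take k t) c d \<omega> * XD (t ! k) d j \<omega>) * (1 / of_nat N))"
proof -
  have "(\<Sum>a<N. word ss c a \<omega> * dtr t a j \<omega>)
      = (\<Sum>a<N. \<Sum>k<length t. \<Sum>d<N. word ss c a \<omega> * word (drop (Suc k) t @ take k t) a d \<omega> * (XD (t ! k) d j \<omega> / of_nat N))"
    by (simp add: dtr_eq sum_distrib_left sum_divide_distrib mult_ac)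
  also have "\<dots> = (\<Sum>k<length t. \<Sum>d<N. \<Sum>a<N. word ss c a \<omega> * word (drop (Suc k) t @ take k t) a d \<omega> * (XD (t ! k) d j \<omega> / of_nat N))"
    by (rule trans[OF sum.swap]) (intro sum.cong refl sum.swap)
  also have "\<dots> = (\<Sum>k<length t. \<Sum>d<N. word (ss @ drop (Suc k) t @ take k t) c d \<omega> * (XD (t ! k) d j \<omega> / of_nat N))"
    by (simp only: word_append[OF assms, of ss] sum_distrib_right)
  finally show ?thesis by (simp add: sum_divide_distrib)
qed

text \<open>The opened trace is inserted behind \<open>ss\<close> and everything closes to one
  trace. The factor N of this closure cancels the 1 / N in \<open>dtr\<close>, so against the N^2 of
  \<open>split_term\<close> merging is smaller by two orders.\<close>

lemma merge_term_single:
  assumes "s > 0" "\<And>u. u \<in> set t \<Longrightarrow> u > 0"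
  shows "(\<Sum>a<N. \<Sum>j<L. \<Sum>c<N. DX s j c \<omega> * word ss c a \<omega> * dtr t a j \<omega>)
    = (\<Sum>k<length t. tr (ss @ drop (Suc k) t @ take k t @ [t ! k + s]) \<omega>)"
proof -
  have "(\<Sum>a<N. \<Sum>j<L. \<Sum>c<N. DX s j c \<omega> * word ss c a \<omega> * dtr t a j \<omega>)
      = (\<Sum>j<L. \<Sum>c<N. \<Sum>a<N. DX s j c \<omega> * word ss c a \<omega> * dtr t a j \<omega>)"
    by (rule trans[OF sum.swap]) (intro sum.cong refl sum.swap)
  also have "\<dots> = (\<Sum>j<L. \<Sum>c<N. DX s j c \<omega> * (\<Sum>k<length t.
      (\<Sum>d<N. word (ss @ drop (Suc k) t @ take k t) c d \<omega> * XD (t ! k) d j \<omega>) * (1 / of_nat N)))"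
    by (intro sum.cong refl) (simp only: mult.assoc lessThan_iff word_dtr flip: sum_distrib_left)
  also have "\<dots> = (\<Sum>k<length t. tr (ss @ drop (Suc k) t @ take k t @ [t ! k + s]) \<omega>)"
    unfolding sum_mult_swap
    using N_pos by (intro sum.cong refl) (simp add: sum_DX_XD[OF assms(1)] assms(2) sum_word_snoc)
  finally show ?thesis .
qed

lemma merge_term:
  assumes "s > 0" "\<And>t u. t \<in> set ts \<Longrightarrow> u \<in> set t \<Longrightarrow> u > 0"
  shows "(\<Sum>a<N. \<Sum>j<L. \<Sum>c<N. DX s j c \<omega> * word ss c a \<omega> * dtraces ts a j \<omega>)
    = (\<Sum>us\<leftarrow>merges s ss ts. traces us \<omega>)"
  using assms(2)
proof (induction ts)
  case (Cons t ts)
  have "(\<Sum>a<N. \<Sum>j<L. \<Sum>c<N. DX s j c \<omega> * word ss c a \<omega> * dtraces (t # ts) a j \<omega>)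
      = (\<Sum>a<N. \<Sum>j<L. \<Sum>c<N. DX s j c \<omega> * word ss c a \<omega> * dtr t a j \<omega>) * traces ts \<omega>
      + tr t \<omega> * (\<Sum>a<N. \<Sum>j<L. \<Sum>c<N. DX s j c \<omega> * word ss c a \<omega> * dtraces ts a j \<omega>)"
    by (simp add: distrib_left sum.distrib sum_distrib_left sum_distrib_right mult_ac)
  also have "(\<Sum>a<N. \<Sum>j<L. \<Sum>c<N. DX s j c \<omega> * word ss c a \<omega> * dtraces ts a j \<omega>) = (\<Sum>us\<leftarrow>merges s ss ts. traces us \<omega>)"
    using Cons by auto
  also have "(\<Sum>a<N. \<Sum>j<L. \<Sum>c<N. DX s j c \<omega> * word ss c a \<omega> * dtr t a j \<omega>)
      = (\<Sum>k<length t. tr (ss @ drop (Suc k) t @ take k t @ [t ! k + s]) \<omega>)"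
    using Cons.prems by (intro merge_term_single assms(1)) auto
  finally show ?case
    by (simp add: comp_def sum_distrib_right interv_sum_list_conv_sum_set_nat atLeast0LessThan
        flip: sum_list_const_mult)
qed simp

text \<open>The leading X is split off by \<open>W_eq\<close>, so that integration by parts applies
  to \<open>x a j\<close> times the remaining factor G. Division by N happens twice, through the
  normalized trace and through \<open>wirtinger_by_parts\<close>.\<close>

theorem schwinger_dyson:
  assumes "s > 0" "\<And>t. t \<in> set ss \<Longrightarrow> t > 0" "\<And>t u. t \<in> set ts \<Longrightarrow> u \<in> set t \<Longrightarrow> u > 0"
  shows "expectation (traces ((s # ss) # ts)) =
      (\<Sum>j<L. D s j j) / of_nat N * expectation (traces (ss # ts))
    + (\<Sum>k<length ss. expectation (traces ((take k ss @ [ss ! k + s]) # drop (Suc k) ss # ts)))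
    + (\<Sum>us\<leftarrow>merges s ss ts. expectation (traces us)) / (of_nat N)\<^sup>2"
proof -
  let ?Q = "traces ts" and ?Q' = "dtraces ts"
  define G where "G a j \<omega> = (\<Sum>c<N. DX s j c \<omega> * word ss c a \<omega> * ?Q \<omega>)" for a j \<omega>
  \<comment> \<open>The summands come from the X^* of the first letter itself, from the rest of its
    word, and from the other traces.\<close>
  define G' where "G' a j \<omega> = D s j j * word ss a a \<omega> * ?Q \<omega>
      + (\<Sum>c<N. DX s j c \<omega> * dword ss c a a j \<omega>) * ?Q \<omega>
      + (\<Sum>c<N. DX s j c \<omega> * word ss c a \<omega> * ?Q' a j \<omega>)" for a j \<omega>
  have wG: "wirtinger (G a j) (\<lambda>i l \<omega>. \<Sum>c<N.
      ((D s j l * of_bool (i = c)) * word ss c a \<omega> + DX s j c \<omega> * dword ss c a i l \<omega>) * ?Q \<omega>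
      + DX s j c \<omega> * word ss c a \<omega> * ?Q' i l \<omega>)" if "a < N" for a j
    unfolding G_def[abs_def] using that
    by (intro wirtinger_sum wirtinger_mult wirtinger_DX wirtinger_word wirtinger_traces) auto
  have G': "(\<Sum>c<N. ((D s j j * of_bool (a = c)) * word ss c a \<omega> + DX s j c \<omega> * dword ss c a a j \<omega>) * ?Q \<omega>
      + DX s j c \<omega> * word ss c a \<omega> * ?Q' a j \<omega>) = G' a j \<omega>" if "a < N" for a j \<omega>
  proof -
    have "(\<Sum>c<N. D s j j * of_bool (a = c) * word ss c a \<omega> * ?Q \<omega>)
        = (\<Sum>c<N. of_bool (a = c) * (D s j j * word ss c a \<omega> * ?Q \<omega>))"
      by (simp add: mult_ac)
    also have "\<dots> = D s j j * word ss a a \<omega> * ?Q \<omega>" using that by simp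
    finally show ?thesis unfolding G'_def by (simp add: sum.distrib distrib_right sum_distrib_right)
  qed
  have intG: "integrable \<Omega> (\<lambda>\<omega>. x a j \<omega> * G a j \<omega>)" if "a < N" "j < L" for a j
    by (rule wirtinger_integrable(1)[OF wirtinger_mult[OF wirtinger_entry(1)[OF that] wG[OF that(1)]]])
  have intG': "integrable \<Omega> (G' a j)" if "a < N" "j < L" for a j
    using wirtinger_integrable(2)[OF wG[OF that(1), of j] that] by (simp only: G'[OF that(1)])
  have ibp: "expectation (\<lambda>\<omega>. x a j \<omega> * G a j \<omega>) = expectation (G' a j) / of_nat N" if "a < N" "j < L" for a j
    using wirtinger_by_parts[OF wG[OF that(1), of j] that] by (simp only: G'[OF that(1)])
  have tr_word: "traces ((s # ss) # ts) \<omega> = (\<Sum>a<N. \<Sum>j<L. x a j \<omega> * G a j \<omega>) / of_nat N" for \<omega>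
  proof -
    have "(\<Sum>a<N. word (s # ss) a a \<omega>) * ?Q \<omega> = (\<Sum>a<N. \<Sum>c<N. \<Sum>j<L. x a j \<omega> * (DX s j c \<omega> * word ss c a \<omega> * ?Q \<omega>))"
      by (simp add: W_eq sum_distrib_right sum_distrib_left mult_ac)
    also have "\<dots> = (\<Sum>a<N. \<Sum>j<L. \<Sum>c<N. x a j \<omega> * (DX s j c \<omega> * word ss c a \<omega> * ?Q \<omega>))"
      by (intro sum.cong refl sum.swap)
    finally show ?thesis by (simp add: tr_def G_def sum_distrib_left)
  qed
  have pointwise: "(\<Sum>a<N. \<Sum>j<L. G' a j \<omega>) = of_nat N * (\<Sum>j<L. D s j j) * traces (ss # ts) \<omega>
      + (of_nat N)\<^sup>2 * (\<Sum>k<length ss. traces ((take k ss @ [ss ! k + s]) # drop (Suc k) ss # ts) \<omega>)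
      + (\<Sum>us\<leftarrow>merges s ss ts. traces us \<omega>)" for \<omega>
  proof -
    have "(\<Sum>a<N. \<Sum>j<L. D s j j * word ss a a \<omega> * ?Q \<omega>) = (\<Sum>a<N. word ss a a \<omega>) * (\<Sum>j<L. D s j j) * ?Q \<omega>"
      by (simp add: mult_ac flip: sum_distrib_left sum_distrib_right)
    also have "\<dots> = of_nat N * (\<Sum>j<L. D s j j) * traces (ss # ts) \<omega>"
      using N_pos by (simp add: tr_def)
    finally have 1: "(\<Sum>a<N. \<Sum>j<L. D s j j * word ss a a \<omega> * ?Q \<omega>) = of_nat N * (\<Sum>j<L. D s j j) * traces (ss # ts) \<omega>" .
    have 2: "(\<Sum>a<N. \<Sum>j<L. (\<Sum>c<N. DX s j c \<omega> * dword ss c a a j \<omega>) * ?Q \<omega>)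
        = (of_nat N)\<^sup>2 * (\<Sum>k<length ss. traces ((take k ss @ [ss ! k + s]) # drop (Suc k) ss # ts) \<omega>)"
    proof -
      have "(\<Sum>a<N. \<Sum>j<L. (\<Sum>c<N. DX s j c \<omega> * dword ss c a a j \<omega>) * ?Q \<omega>)
          = (\<Sum>a<N. \<Sum>j<L. \<Sum>c<N. DX s j c \<omega> * dword ss c a a j \<omega>) * ?Q \<omega>"
        by (simp only: sum_distrib_right)
      also have "\<dots> = (of_nat N)\<^sup>2 * (\<Sum>k<length ss. tr (take k ss @ [ss ! k + s]) \<omega> * tr (drop (Suc k) ss) \<omega>) * ?Q \<omega>"
        by (simp only: split_term[OF assms(1,2)])
      finally show ?thesis by (simp add: sum_distrib_right mult.assoc)
    qed
    have 3: "(\<Sum>a<N. \<Sum>j<L. \<Sum>c<N. DX s j c \<omega> * word ss c a \<omega> * ?Q' a j \<omega>) = (\<Sum>us\<leftarrow>merges s ss ts. traces us \<omega>)"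
      by (rule merge_term) (use assms in auto)
    show ?thesis unfolding G'_def sum.distrib 1 2 3 ..
  qed
  note int = integrable_traces
  have int3: "integrable \<Omega> (\<lambda>\<omega>. \<Sum>us\<leftarrow>uss. traces us \<omega>)"
    and exp3: "expectation (\<lambda>\<omega>. \<Sum>us\<leftarrow>uss. traces us \<omega>) = (\<Sum>us\<leftarrow>uss. expectation (traces us))" for uss
    by (induction uss) (simp_all add: int)
  have exp_sum: "expectation (\<lambda>\<omega>. \<Sum>a<N. \<Sum>j<L. h a j \<omega>) = (\<Sum>a<N. \<Sum>j<L. expectation (h a j))"
    if "\<And>a j. a < N \<Longrightarrow> j < L \<Longrightarrow> integrable \<Omega> (h a j)" for h :: "nat \<Rightarrow> nat \<Rightarrow> 'w \<Rightarrow> complex"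
  proof -
    have "expectation (\<lambda>\<omega>. \<Sum>a<N. \<Sum>j<L. h a j \<omega>) = (\<Sum>a<N. expectation (\<lambda>\<omega>. \<Sum>j<L. h a j \<omega>))"
      by (rule Bochner_Integration.integral_sum) (auto intro!: Bochner_Integration.integrable_sum that)
    also have "\<dots> = (\<Sum>a<N. \<Sum>j<L. expectation (h a j))"
      by (intro sum.cong refl Bochner_Integration.integral_sum) (auto intro!: that)
    finally show ?thesis .
  qed
  have "expectation (traces ((s # ss) # ts)) = expectation (\<lambda>\<omega>. \<Sum>a<N. \<Sum>j<L. x a j \<omega> * G a j \<omega>) / of_nat N"
    unfolding tr_word[abs_def] by simp
  also have "expectation (\<lambda>\<omega>. \<Sum>a<N. \<Sum>j<L. x a j \<omega> * G a j \<omega>) = (\<Sum>a<N. \<Sum>j<L. expectation (\<lambda>\<omega>. x a j \<omega> * G a j \<omega>))"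
    by (rule exp_sum[OF intG])
  also have "\<dots> = (\<Sum>a<N. \<Sum>j<L. expectation (G' a j) / of_nat N)"
    by (intro sum.cong refl) (simp add: ibp)
  also have "\<dots> / of_nat N = (\<Sum>a<N. \<Sum>j<L. expectation (G' a j)) / (of_nat N)\<^sup>2"
    by (simp add: power2_eq_square flip: sum_divide_distrib)
  also have "(\<Sum>a<N. \<Sum>j<L. expectation (G' a j)) = expectation (\<lambda>\<omega>. \<Sum>a<N. \<Sum>j<L. G' a j \<omega>)"
    by (rule exp_sum[OF intG', symmetric])
  also have "expectation (\<lambda>\<omega>. \<Sum>a<N. \<Sum>j<L. G' a j \<omega>) = of_nat N * (\<Sum>j<L. D s j j) * expectation (traces (ss # ts))
      + (of_nat N)\<^sup>2 * (\<Sum>k<length ss. expectation (traces ((take k ss @ [ss ! k + s]) # drop (Suc k) ss # ts)))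
      + (\<Sum>us\<leftarrow>merges s ss ts. expectation (traces us))"
    unfolding pointwise using int int3 by (simp add: exp3 Bochner_Integration.integral_sum del: traces.simps)
  finally show ?thesis
    using N_pos by (simp add: power2_eq_square add_divide_distrib del: traces.simps)
qed

end

subsection \<open>The moment problem on an interval\<close>

text \<open>Hausdorff's setting on [0, 1]: nonnegativity on x^k (1 - x)^l makes the values on the
  Bernstein basis polynomials usable as point masses.\<close>

locale positive_functional =
  fixes \<Lambda> :: "real poly \<Rightarrow> real"
  assumes add: "\<Lambda> (p + q) = \<Lambda> p + \<Lambda> q"
    and scale: "\<Lambda> (Polynomial.smult c p) = c * \<Lambda> p"
    and one: "\<Lambda> 1 = 1"
    and pos: "\<Lambda> ([:0, 1:] ^ k * [:1, -1:] ^ l) \<ge> 0"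
begin

lemma sum: "\<Lambda> (\<Sum>i\<in>S. f i) = (\<Sum>i\<in>S. \<Lambda> (f i))"
proof -
  have "\<Lambda> 0 = 0" using scale[of 0 0] by simp
  then show ?thesis by (induction S rule: infinite_finite_induct) (simp_all add: add)
qed

definition weight :: "nat \<Rightarrow> nat \<Rightarrow> real" where
  "weight n k = real (n choose k) * \<Lambda> ([:0, 1:] ^ k * [:1, -1:] ^ (n - k))"

lemma weight_nonneg: "weight n k \<ge> 0"
  by (simp add: weight_def pos)

text \<open>Binomial moments are exact for each n \<ge> r: (n choose k) (k choose r) = (n choose r)
  (n - r choose k - r), and the sum over k collapses by the binomial theorem for x + (1 - x) = 1.
  Ordinary powers are reached in the limit only.\<close>

lemma sum_weight_choose:
  assumes "r \<le> n"
  shows "(\<Sum>k\<le>n. weight n k * real (k choose r)) = real (n choose r) * \<Lambda> ([:0, 1:] ^ r)"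
proof -
  let ?X = "[:0, 1:] :: real poly" and ?Y = "[:1, -1:] :: real poly"
  have "(\<Sum>k\<le>n. weight n k * real (k choose r)) = (\<Sum>k\<in>{r..n}. weight n k * real (k choose r))"
    by (rule sum.mono_neutral_right) auto
  also have "\<dots> = (\<Sum>k\<in>{r..n}. real (n choose r) * \<Lambda> (Polynomial.smult (real ((n - r) choose (k - r))) (?X ^ k * ?Y ^ (n - k))))"
  proof (intro sum.cong refl)
    fix k assume "k \<in> {r..n}"
    then have "real ((n choose k) * (k choose r)) = real ((n choose r) * ((n - r) choose (k - r)))"
      using choose_mult[of r k n] by simp
    then show "weight n k * real (k choose r)
        = real (n choose r) * \<Lambda> (Polynomial.smult (real ((n - r) choose (k - r))) (?X ^ k * ?Y ^ (n - k)))"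
      by (simp add: weight_def scale algebra_simps)
  qed
  also have "\<dots> = real (n choose r) * \<Lambda> (\<Sum>k\<in>{r..n}. Polynomial.smult (real ((n - r) choose (k - r))) (?X ^ k * ?Y ^ (n - k)))"
    by (simp add: sum sum_distrib_left)
  also have "(\<Sum>k\<in>{r..n}. Polynomial.smult (real ((n - r) choose (k - r))) (?X ^ k * ?Y ^ (n - k)))
      = (\<Sum>k\<le>n - r. ?X ^ r * (of_nat ((n - r) choose k) * ?X ^ k * ?Y ^ (n - r - k)))"
    by (rule sum.reindex_bij_witness[of _ "\<lambda>k. k + r" "\<lambda>k. k - r"])
      (use assms in \<open>auto simp: of_nat_poly power_add[symmetric] mult.assoc[symmetric] simp flip: power_add\<close>)
  also have "\<dots> = ?X ^ r * (?X + ?Y) ^ (n - r)"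
    unfolding binomial_ring by (simp add: sum_distrib_left)
  also have "?X + ?Y = 1" by (simp add: one_pCons)
  finally show ?thesis by simp
qed

lemma sum_weight: "(\<Sum>k\<le>n. weight n k) = 1"
  using sum_weight_choose[of 0 n] by (simp add: one)

text \<open>The quotient is a product of r factors (k - i) / (n - i), each within r / (n - r) of k /
  n. Products of factors of modulus at most 1 differ by at most the sum of the factorwise
  differences. The condition 2 r < n secures the modulus when k < i.\<close>

lemma choose_ratio_diff:
  assumes "k \<le> n" "2 * r < n"
  shows "\<bar>real (k choose r) / real (n choose r) - (real k / real n) ^ r\<bar> \<le> real r ^ 2 / (real n - real r)"
proof -
  define z where "z i = (real k - real i) / (real n - real i)" for i
  have "real (k choose r) / real (n choose r) = (\<Prod>i<r. z i)"
    by (simp add: binomial_gbinomial gbinomial_prod_rev prod_dividef z_def atLeast0LessThan)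
  moreover have "(real k / real n) ^ r = (\<Prod>i<r. real k / real n)" by simp
  ultimately have "\<bar>real (k choose r) / real (n choose r) - (real k / real n) ^ r\<bar>
      = norm ((\<Prod>i<r. z i) - (\<Prod>i<r. real k / real n))" by simp
  also have "\<dots> \<le> (\<Sum>i<r. norm (z i - real k / real n))"
  proof (rule norm_prod_diff)
    fix i assume "i \<in> {..<r}"
    then have "i < r" by simp
    then have "\<bar>real k - real i\<bar> \<le> real n - real i" using assms by auto
    then show "norm (z i) \<le> 1" by (simp add: z_def abs_le_iff divide_le_eq le_divide_eq abs_divide)
    show "norm (real k / real n) \<le> 1" using assms by simp
  qed
  also have "\<dots> \<le> (\<Sum>i<r. real r / (real n - real r))"
  proof (rule sum_mono)
    fix i assume "i \<in> {..<r}"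
    then have i: "real i < real r" "2 * real r < real n" using assms by auto
    have "z i - real k / real n = - (real i / (real n - real i)) * (1 - real k / real n)"
      using i by (simp add: z_def field_simps)
    then have "norm (z i - real k / real n) = (real i / (real n - real i)) * (1 - real k / real n)"
      using i assms by (simp add: abs_mult)
    also have "\<dots> \<le> (real i / (real n - real i)) * 1"
      using i assms by (intro mult_left_mono) auto
    also have "\<dots> \<le> real r / (real n - real r)"
      using i by (simp add: frac_le)
    finally show "norm (z i - real k / real n) \<le> real r / (real n - real r)" .
  qed
  also have "\<dots> = real r ^ 2 / (real n - real r)" by (simp add: power2_eq_square)
  finally show ?thesis .
qed

lemma weight_moment_limit: "(\<lambda>n. \<Sum>k\<le>n. weight n k * (real k / real n) ^ r) \<longlonglongrightarrow> \<Lambda> ([:0, 1:] ^ r)"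
proof -
  have "\<forall>\<^sub>F n in sequentially. norm ((\<Sum>k\<le>n. weight n k * (real k / real n) ^ r) - \<Lambda> ([:0, 1:] ^ r))
      \<le> real r ^ 2 / (real n - real r)"
    using eventually_gt_at_top[of "2 * r"]
  proof eventually_elim
    case (elim n)
    have "\<Lambda> ([:0, 1:] ^ r) = (\<Sum>k\<le>n. weight n k * (real (k choose r) / real (n choose r)))"
      using sum_weight_choose[of r n] elim by (simp add: field_simps flip: sum_divide_distrib)
    then have "norm ((\<Sum>k\<le>n. weight n k * (real k / real n) ^ r) - \<Lambda> ([:0, 1:] ^ r))
      = \<bar>\<Sum>k\<le>n. weight n k * ((real k / real n) ^ r - real (k choose r) / real (n choose r))\<bar>"
      by (simp add: right_diff_distrib sum_subtractf)
    also have "\<dots> \<le> (\<Sum>k\<le>n. weight n k * (real r ^ 2 / (real n - real r)))"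
    proof (rule order_trans[OF sum_abs], rule sum_mono)
      fix k assume "k \<in> {..n}"
      then have "\<bar>(real k / real n) ^ r - real (k choose r) / real (n choose r)\<bar> \<le> real r ^ 2 / (real n - real r)"
        using choose_ratio_diff[of k n r] elim by (simp add: abs_minus_commute)
      then show "\<bar>weight n k * ((real k / real n) ^ r - real (k choose r) / real (n choose r))\<bar>
          \<le> weight n k * (real r ^ 2 / (real n - real r))"
        unfolding abs_mult abs_of_nonneg[OF weight_nonneg] by (rule mult_left_mono[OF _ weight_nonneg])
    qed
    also have "\<dots> = real r ^ 2 / (real n - real r)"
      by (simp only: sum_distrib_right[symmetric] sum_weight mult_1_left)
    finally show ?case .
  qed
  moreover have "(\<lambda>n. real r ^ 2 / (real n - real r)) \<longlonglongrightarrow> 0" by real_asymp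
  ultimately have "(\<lambda>n. (\<Sum>k\<le>n. weight n k * (real k / real n) ^ r) - \<Lambda> ([:0, 1:] ^ r)) \<longlonglongrightarrow> 0"
    by (rule Lim_null_comparison)
  then show ?thesis by (simp add: LIM_zero_iff)
qed

text \<open>Integrating \<open>f\<close> against this measure applies \<open>\<Lambda>\<close> to the \<open>n\<close>-th Bernstein polynomial of \<open>f\<close>.
  The point \<open>0 / 0 = 0\<close> for \<open>n = 0\<close> is harmless.\<close>

definition bernstein_measure :: "nat \<Rightarrow> real measure" where
  "bernstein_measure n = distr (point_measure {..n} (\<lambda>k. ennreal (weight n k))) borel (\<lambda>k. real k / real n)"

lemma real_distribution_bernstein: "real_distribution (bernstein_measure n)"
proof -
  have "(\<Sum>k\<le>n. ennreal (weight n k)) = 1"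
    by (subst sum_ennreal) (simp_all add: weight_nonneg sum_weight)
  then have "prob_space (point_measure {..n} (\<lambda>k. ennreal (weight n k)))"
    by (intro prob_spaceI) (simp add: space_point_measure emeasure_point_measure_finite)
  then have "prob_space (bernstein_measure n)"
    unfolding bernstein_measure_def by (rule prob_space.prob_space_distr) (simp add: point_measure_def)
  then show ?thesis
    by (simp add: real_distribution_def real_distribution_axioms_def bernstein_measure_def)
qed

lemma integral_bernstein:
  fixes g :: "real \<Rightarrow> real"
  assumes "g \<in> borel_measurable borel"
  shows "integral\<^sup>L (bernstein_measure n) g = (\<Sum>k\<le>n. weight n k * g (real k / real n))"
  unfolding bernstein_measure_def using assms
  by (subst integral_distr) (simp_all add: point_measure_def lebesgue_integral_point_measure_finite[unfolded point_measure_def] weight_nonneg)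

text \<open>All Bernstein measures live on [0, 1], so they are tight and some subsequence converges
  weakly; its moments converge by \<open>weight_moment_limit\<close>.\<close>

theorem moment_measure:
  obtains \<nu> where "prob_space \<nu>" "sets \<nu> = sets borel" "AE x in \<nu>. x \<in> {0..1}"
    "\<And>p. integral\<^sup>L \<nu> (poly p) = \<Lambda> p"
proof -
  have frac: "real k / real n \<in> {0..1}" if "k \<le> n" for k n
    using that by (cases "n = 0") auto
  have "tight bernstein_measure"
    unfolding tight_def
  proof (intro conjI allI impI real_distribution_bernstein)
    fix \<epsilon> :: real assume "\<epsilon> > 0"
    \<comment> \<open>Tightness uses intervals open on the left; the end -1 keeps a possible atom at
      0 inside.\<close>
    have "measure (bernstein_measure n) {-1<..1} > 1 - \<epsilon>" for n
    proof -
      interpret real_distribution "bernstein_measure n" by (rule real_distribution_bernstein)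
      have "measure (bernstein_measure n) {-1<..1} = (\<Sum>k\<le>n. weight n k * indicator {-1<..1} (real k / real n))"
        using integral_bernstein[of "indicator {-1<..1}" n] by simp
      also have "\<dots> = (\<Sum>k\<le>n. weight n k)"
      proof (intro sum.cong refl)
        fix k assume "k \<in> {..n}"
        then have "real k / real n \<le> 1" using frac[of k n] by simp
        moreover have "-1 < real k / real n" by (rule less_le_trans[of _ 0]) simp_all
        ultimately have "real k / real n \<in> {-1<..1}" by simp
        then show "weight n k * indicator {-1<..1} (real k / real n) = weight n k" by simp
      qed
      finally show ?thesis using \<open>\<epsilon> > 0\<close> by (simp add: sum_weight)
    qed
    then show "\<exists>a b. a < b \<and> (\<forall>n. 1 - \<epsilon> < measure (bernstein_measure n) {a<..b})"
      by (intro exI[of _ "-1"] exI[of _ 1]) auto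
  qed
  from tight_imp_convergent_subsubsequence[OF this strict_mono_id]
  obtain r \<nu> where r: "strict_mono r" and \<nu>: "real_distribution \<nu>"
    and conv: "weak_conv_m (bernstein_measure \<circ> r) \<nu>" by auto
  interpret real_distribution \<nu> by fact
  have lim: "(\<lambda>n. \<Sum>k\<le>r n. weight (r n) k * g (real k / real (r n))) \<longlonglongrightarrow> integral\<^sup>L \<nu> g"
    if "\<And>x. isCont g x" "\<And>x. norm (g x) \<le> 1" for g :: "real \<Rightarrow> real"
  proof -
    have "(\<lambda>n. integral\<^sup>L ((bernstein_measure \<circ> r) n) g) \<longlonglongrightarrow> integral\<^sup>L \<nu> g"
      by (rule weak_conv_imp_integral_bdd_continuous_conv[OF _ \<nu> conv, where B = 1])
        (use that in \<open>simp_all add: real_distribution_bernstein\<close>)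
    moreover have "g \<in> borel_measurable borel"
      using that by (intro borel_measurable_continuous_onI) (simp add: continuous_at_imp_continuous_on)
    ultimately show ?thesis by (simp add: integral_bernstein)
  qed
  \<comment> \<open>Powers are unbounded on the line, so they are tested after clamping to [0, 1],
    which changes nothing at the points k / n.\<close>
  define cl :: "real \<Rightarrow> real" where "cl x = min 1 (max 0 x)" for x
  have cl: "cl x \<in> {0..1}" for x by (auto simp: cl_def)
  have cl_id: "cl x = x" if "x \<in> {0..1}" for x using that by (auto simp: cl_def)
  have cl_cont: "isCont cl x" for x unfolding cl_def by (intro continuous_intros)
  have mom: "integral\<^sup>L \<nu> (\<lambda>x. cl x ^ m) = \<Lambda> ([:0, 1:] ^ m)" for m
  proof -
    have "(\<lambda>n. \<Sum>k\<le>r n. weight (r n) k * cl (real k / real (r n)) ^ m) \<longlonglongrightarrow> integral\<^sup>L \<nu> (\<lambda>x. cl x ^ m)"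
      using cl by (intro lim continuous_intros cl_cont) (auto simp: power_le_one norm_power)
    moreover have "(\<lambda>n. \<Sum>k\<le>r n. weight (r n) k * cl (real k / real (r n)) ^ m)
        = (\<lambda>n. \<Sum>k\<le>r n. weight (r n) k * (real k / real (r n)) ^ m)"
      using frac by (intro ext sum.cong refl) (simp add: cl_id)
    ultimately show ?thesis
      using LIMSEQ_subseq_LIMSEQ[OF weight_moment_limit[of m] r] LIMSEQ_unique by (fastforce simp: comp_def)
  qed
  \<comment> \<open>A bounded continuous function that vanishes exactly on [0, 1]: its integral is 0
    along the sequence, which confines \<open>\<nu>\<close> to the interval and removes the
    clamp.\<close>
  let ?g = "\<lambda>x. min 1 \<bar>x - cl x\<bar>"
  have "(\<lambda>n. \<Sum>k\<le>r n. weight (r n) k * ?g (real k / real (r n))) \<longlonglongrightarrow> integral\<^sup>L \<nu> ?g"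
    by (intro lim continuous_intros cl_cont) auto
  moreover have "(\<lambda>n. \<Sum>k\<le>r n. weight (r n) k * ?g (real k / real (r n))) = (\<lambda>n. 0)"
    using frac by (intro ext sum.neutral) (simp add: cl_id)
  ultimately have "integral\<^sup>L \<nu> ?g = 0" by (simp add: LIMSEQ_const_iff)
  moreover have [measurable]: "cl \<in> borel_measurable borel" unfolding cl_def by measurable
  moreover have "integrable \<nu> ?g"
    by (rule integrable_const_bound[of _ 1]) auto
  ultimately have "AE x in \<nu>. ?g x = 0"
    by (subst (asm) integral_nonneg_eq_0_iff_AE) auto
  then have ae: "AE x in \<nu>. x = cl x" by eventually_elim (auto simp: min_def split: if_splits)
  have int: "integral\<^sup>L \<nu> (poly p) = \<Lambda> p" for p
  proof -
    have "integral\<^sup>L \<nu> (poly p) = integral\<^sup>L \<nu> (\<lambda>x. \<Sum>i\<le>Polynomial.degree p. Polynomial.coeff p i * cl x ^ i)"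
    proof (rule integral_cong_AE)
      show "AE x in \<nu>. poly p x = (\<Sum>i\<le>Polynomial.degree p. Polynomial.coeff p i * cl x ^ i)"
        using ae by eventually_elim (simp add: poly_altdef)
      show "poly p \<in> borel_measurable \<nu>"
        using borel_measurable_continuous_onI[of "poly p"] by (simp add: continuous_on_poly)
    qed simp
    also have "\<dots> = (\<Sum>i\<le>Polynomial.degree p. Polynomial.coeff p i * integral\<^sup>L \<nu> (\<lambda>x. cl x ^ i))"
    proof -
      have "integrable \<nu> (\<lambda>x. cl x ^ i)" for i
        using cl by (intro integrable_const_bound[of _ 1]) (auto simp: power_le_one norm_power)
      then show ?thesis by (simp add: Bochner_Integration.integral_sum)
    qed
    also have "\<dots> = \<Lambda> (\<Sum>i\<le>Polynomial.degree p. Polynomial.smult (Polynomial.coeff p i) ([:0, 1:] ^ i))"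
      by (simp add: mom sum scale)
    also have "(\<Sum>i\<le>Polynomial.degree p. Polynomial.smult (Polynomial.coeff p i) ([:0, 1:] ^ i)) = p"
      by (simp add: poly_as_sum_of_monoms flip: monom_altdef)
    finally show ?thesis .
  qed
  show thesis
  proof
    show "AE x in \<nu>. x \<in> {0..1}" using ae by eventually_elim (metis cl)
  qed (use int prob_space_axioms in auto)
qed

end

section \<open>From geometric growth of the moments to the unit interval\<close>

lemma pcompose_pow: "(p ^ k) \<circ>\<^sub>p q = (p \<circ>\<^sub>p q) ^ k" for p q :: "'a :: comm_semiring_1 poly"
  by (induction k) (simp_all add: pcompose_mult pcompose_1)

text \<open>The Riesz functional of the sequence c, which sends x^i to \<open>c i\<close>.\<close>

definition moment_functional :: "(nat \<Rightarrow> real) \<Rightarrow> real poly \<Rightarrow> real" where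
  "moment_functional c p = (\<Sum>i\<le>Polynomial.degree p. Polynomial.coeff p i * c i)"

lemma moment_functional_eq: "Polynomial.degree p \<le> n \<Longrightarrow> moment_functional c p = (\<Sum>i\<le>n. Polynomial.coeff p i * c i)"
  unfolding moment_functional_def by (rule sum.mono_neutral_left) (auto simp: coeff_eq_0)

lemma moment_functional_add: "moment_functional c (p + q) = moment_functional c p + moment_functional c q"
proof -
  let ?n = "max (Polynomial.degree p) (Polynomial.degree q)"
  have "moment_functional c (p + q) = (\<Sum>i\<le>?n. Polynomial.coeff (p + q) i * c i)"
    by (intro moment_functional_eq degree_add_le) auto
  then show ?thesis
    by (simp add: moment_functional_eq[of p ?n] moment_functional_eq[of q ?n] sum.distrib distrib_right)
qed

lemma moment_functional_smult: "moment_functional c (Polynomial.smult a p) = a * moment_functional c p"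
  by (simp add: moment_functional_eq[OF degree_smult_le] moment_functional_def sum_distrib_left mult.assoc)

lemma moment_functional_sum: "moment_functional c (\<Sum>i\<in>S. f i) = (\<Sum>i\<in>S. moment_functional c (f i))"
proof -
  have "moment_functional c 0 = 0" by (simp add: moment_functional_def)
  then show ?thesis by (induction S rule: infinite_finite_induct) (simp_all add: moment_functional_add)
qed

lemma moment_functional_monom: "moment_functional c (Polynomial.monom a k) = a * c k"
proof -
  have "moment_functional c (Polynomial.monom a k) = (\<Sum>i\<le>k. Polynomial.coeff (Polynomial.monom a k) i * c i)"
    by (rule moment_functional_eq) (rule degree_monom_le)
  also have "\<dots> = (\<Sum>i\<le>k. if i = k then a * c k else 0)" by (intro sum.cong refl) auto
  finally show ?thesis by simp
qed

lemma moment_functional_square: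
  "moment_functional c (p * p) = (\<Sum>i\<le>Polynomial.degree p. \<Sum>j\<le>Polynomial.degree p. Polynomial.coeff p i * Polynomial.coeff p j * c (i + j))"
proof -
  have "p * p = (\<Sum>i\<le>Polynomial.degree p. Polynomial.monom (Polynomial.coeff p i) i) * (\<Sum>j\<le>Polynomial.degree p. Polynomial.monom (Polynomial.coeff p j) j)"
    by (simp add: poly_as_sum_of_monoms)
  also have "\<dots> = (\<Sum>i\<le>Polynomial.degree p. \<Sum>j\<le>Polynomial.degree p. Polynomial.monom (Polynomial.coeff p i * Polynomial.coeff p j) (i + j))"
    by (simp add: sum_product mult_monom)
  finally show ?thesis by (simp add: moment_functional_sum moment_functional_monom)
qed

context
  fixes c :: "nat \<Rightarrow> real" and C R :: real
  assumes psd: "\<And>p. moment_functional c (p * p) \<ge> 0"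
    and growth: "\<And>k. \<bar>c k\<bar> \<le> C * R ^ k" and R: "R > 0" and c0: "c 0 = 1"
begin

text \<open>For g k, the value at q^2 x^(2k), Cauchy-Schwarz gives (g k)^2 \<le> g 0 * g (2k). A
  ratio g 1 / g 0 above R^2 would be squared again and again along powers of two and outgrow any
  constant multiple of R^(2k).\<close>

lemma moment_functional_bounded_square: "moment_functional c (q * q * [:R\<^sup>2, 0, -1:]) \<ge> 0"
proof -
  let ?L = "moment_functional c"
  define g where "g k = ?L ((q * Polynomial.monom 1 k) * (q * Polynomial.monom 1 k))" for k
  have g_nonneg: "g k \<ge> 0" for k unfolding g_def by (rule psd)
  have cs: "(g k)\<^sup>2 \<le> g 0 * g (2 * k)" for k
  proof -
    \<comment> \<open>Positivity on the square of q (t + s x^(2k)) gives a quadratic form in t and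
      s; its discriminant is the Cauchy-Schwarz inequality.\<close>
    have q: "t\<^sup>2 * g 0 + 2 * t * s * g k + s\<^sup>2 * g (2 * k) \<ge> 0" for t s
    proof -
      let ?p = "q * (Polynomial.smult t 1 + Polynomial.smult s (Polynomial.monom 1 (2 * k)))"
      have "?p * ?p = Polynomial.smult (t\<^sup>2) ((q * Polynomial.monom 1 0) * (q * Polynomial.monom 1 0))
          + Polynomial.smult (2 * t * s) ((q * Polynomial.monom 1 k) * (q * Polynomial.monom 1 k))
          + Polynomial.smult (s\<^sup>2) ((q * Polynomial.monom 1 (2 * k)) * (q * Polynomial.monom 1 (2 * k)))"
      proof -
        have "Polynomial.monom 1 (2 * k) = Polynomial.monom 1 k * (Polynomial.monom 1 k :: real poly)"
          by (simp add: mult_monom mult_2)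
        moreover have "Polynomial.smult (2 * t * s) w = Polynomial.smult (t * s) w + Polynomial.smult (t * s) w" for w :: "real poly"
          by (simp add: mult_ac flip: Polynomial.smult_add_left)
        ultimately show ?thesis
          by (simp only: power2_eq_square) (simp add: algebra_simps Polynomial.smult_add_right)
      qed
      then have "?L (?p * ?p) = t\<^sup>2 * g 0 + 2 * t * s * g k + s\<^sup>2 * g (2 * k)"
        by (simp only: moment_functional_add moment_functional_smult g_def)
      then show ?thesis using psd[of ?p] by simp
    qed
    show ?thesis
    proof (cases "g 0 = 0")
      case True
      have "g k = 0"
      proof (rule ccontr)
        assume "g k \<noteq> 0"
        \<comment> \<open>With g 0 = 0 the form at s = 1 is affine in t, and this t gives it the
          value -1.\<close>
        then show False
          using q[of "- (g (2 * k) + 1) / (2 * g k)" 1] True by (simp add: field_simps)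
      qed
      then show ?thesis using True by simp
    next
      case False
      then have "g 0 > 0" using g_nonneg[of 0] by simp
      \<comment> \<open>At this point the form equals g 0 * (g 0 * g (2k) - (g k)^2).\<close>
      then show ?thesis
        using q[of "- g k" "g 0"] by (simp add: power2_eq_square algebra_simps)
    qed
  qed
  define Cq where "Cq = (\<Sum>i\<le>Polynomial.degree q. \<Sum>j\<le>Polynomial.degree q. \<bar>Polynomial.coeff q i * Polynomial.coeff q j\<bar> * (C * R ^ (i + j)))"
  have g_growth: "g k \<le> Cq * (R\<^sup>2) ^ k" for k
  proof -
    have "(q * Polynomial.monom 1 k) * (q * Polynomial.monom 1 k)
        = (\<Sum>i\<le>Polynomial.degree q. \<Sum>j\<le>Polynomial.degree q. Polynomial.monom (Polynomial.coeff q i * Polynomial.coeff q j) (i + j + 2 * k))"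
    proof -
      have "(q * Polynomial.monom 1 k) * (q * Polynomial.monom 1 k)
          = ((\<Sum>i\<le>Polynomial.degree q. Polynomial.monom (Polynomial.coeff q i) i) * Polynomial.monom 1 k) * ((\<Sum>j\<le>Polynomial.degree q. Polynomial.monom (Polynomial.coeff q j) j) * Polynomial.monom 1 k)"
        by (simp add: poly_as_sum_of_monoms)
      also have "\<dots> = (\<Sum>i\<le>Polynomial.degree q. \<Sum>j\<le>Polynomial.degree q. Polynomial.monom (Polynomial.coeff q i * Polynomial.coeff q j) (i + j + 2 * k))"
        by (simp only: sum_distrib_right[of _ _ "Polynomial.monom 1 k"] sum_product mult_monom) (simp add: mult_2 add.assoc add.commute add.left_commute)
      finally show ?thesis .
    qed
    then have "g k = (\<Sum>i\<le>Polynomial.degree q. \<Sum>j\<le>Polynomial.degree q. Polynomial.coeff q i * Polynomial.coeff q j * c (i + j + 2 * k))"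
      by (simp add: g_def moment_functional_sum moment_functional_monom)
    also have "\<dots> \<le> (\<Sum>i\<le>Polynomial.degree q. \<Sum>j\<le>Polynomial.degree q. \<bar>Polynomial.coeff q i * Polynomial.coeff q j\<bar> * (C * R ^ (i + j + 2 * k)))"
    proof (intro sum_mono)
      fix i j
      have "Polynomial.coeff q i * Polynomial.coeff q j * c (i + j + 2 * k) \<le> \<bar>Polynomial.coeff q i * Polynomial.coeff q j\<bar> * \<bar>c (i + j + 2 * k)\<bar>"
        by (metis abs_ge_self abs_mult)
      also have "\<dots> \<le> \<bar>Polynomial.coeff q i * Polynomial.coeff q j\<bar> * (C * R ^ (i + j + 2 * k))"
        by (intro mult_left_mono growth) auto
      finally show "Polynomial.coeff q i * Polynomial.coeff q j * c (i + j + 2 * k) \<le> \<bar>Polynomial.coeff q i * Polynomial.coeff q j\<bar> * (C * R ^ (i + j + 2 * k))" .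
    qed
    also have "\<dots> = Cq * (R\<^sup>2) ^ k"
      by (simp add: Cq_def sum_distrib_right power_add mult.assoc flip: power_mult)
    finally show ?thesis .
  qed
  have "g 1 \<le> R\<^sup>2 * g 0"
  proof (cases "g 0 = 0")
    case True
    then show ?thesis using cs[of 1] by simp
  next
    case False
    then have g0: "g 0 > 0" using g_nonneg[of 0] by simp
    \<comment> \<open>Normalized so that Cauchy-Schwarz becomes (a k)^2 \<le> a (2k), the growth
      bound becomes a constant, and the goal becomes a 1 \<le> 1.\<close>
    define a where "a k = g k / (g 0 * (R\<^sup>2) ^ k)" for k
    have a_sq: "(a k)\<^sup>2 \<le> a (2 * k)" for k
    proof -
      have "(a k)\<^sup>2 = (g k)\<^sup>2 / ((g 0)\<^sup>2 * (R\<^sup>2) ^ (2 * k))"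
        by (simp add: a_def power_divide power_mult_distrib power_mult[symmetric] mult.commute)
      also have "\<dots> \<le> (g 0 * g (2 * k)) / ((g 0)\<^sup>2 * (R\<^sup>2) ^ (2 * k))"
        using cs[of k] by (intro divide_right_mono) auto
      also have "\<dots> = a (2 * k)" using g0 by (simp add: a_def power2_eq_square)
      finally show ?thesis .
    qed
    have a_nonneg: "a k \<ge> 0" for k using g_nonneg[of k] g0 by (simp add: a_def)
    have a_bound: "a k \<le> Cq / g 0" for k
      using g_growth[of k] g0 R by (simp add: a_def field_simps)
    have pow: "a 1 ^ (2 ^ n) \<le> a (2 ^ n)" for n
    proof (induction n)
      case (Suc n)
      have "a 1 ^ (2 ^ Suc n) = (a 1 ^ (2 ^ n))\<^sup>2" by (simp add: mult.commute flip: power_mult)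
      also have "\<dots> \<le> (a (2 ^ n))\<^sup>2" using Suc a_nonneg by (intro power_mono) auto
      also have "\<dots> \<le> a (2 ^ Suc n)" using a_sq[of "2 ^ n"] by simp
      finally show ?case .
    qed simp
    have "a 1 \<le> 1"
    proof (rule ccontr)
      assume "\<not> a 1 \<le> 1"
      then have a1: "a 1 > 1" by simp
      obtain m where m: "Cq / g 0 < a 1 ^ m" using real_arch_pow[OF a1] by blast
      have "a 1 ^ m \<le> a 1 ^ (2 ^ m)" using a1 by (intro power_increasing) (auto simp: less_imp_le)
      also have "\<dots> \<le> Cq / g 0" using pow[of m] a_bound[of "2 ^ m"] by linarith
      finally show False using m by simp
    qed
    then show ?thesis using g0 R by (simp add: a_def field_simps)
  qed
  moreover have "q * q * [:R\<^sup>2, 0, -1:] = Polynomial.smult (R\<^sup>2) ((q * Polynomial.monom 1 0) * (q * Polynomial.monom 1 0))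
      + Polynomial.smult (-1) ((q * Polynomial.monom 1 1) * (q * Polynomial.monom 1 1))"
  proof -
    have "[:R\<^sup>2, 0, -1:] = Polynomial.smult (R\<^sup>2) 1 + Polynomial.smult (-1) (Polynomial.monom 1 1 * Polynomial.monom 1 1)"
      by (simp add: mult_monom monom_altdef one_pCons)
    then show ?thesis
      by (simp only: distrib_left mult_smult_right mult_smult_left mult_1_left mult_1_right monom_0 pCons_one mult_ac)
  qed
  ultimately show ?thesis
    by (simp only: moment_functional_add moment_functional_smult flip: g_def)
qed

text \<open>The affine map u takes [-R, R] to [0, 1], and v = 1 - u. The measure comes from the
  Hausdorff problem for the functional composed with u and is then transported back to
  [-R, R].\<close>

theorem bounded_moment_problem:
  obtains \<nu> where "prob_space \<nu>" "sets \<nu> = sets borel" "\<And>k. integrable \<nu> (\<lambda>x. x ^ k)"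
    "\<And>k. integral\<^sup>L \<nu> (\<lambda>x. x ^ k) = c k"
proof -
  let ?L = "moment_functional c"
  define u where "u = [:1 / 2, 1 / (2 * R):]"
  define v where "v = [:1 / 2, - 1 / (2 * R):]"
  have uv: "u * v = Polynomial.smult (1 / (4 * R\<^sup>2)) [:R\<^sup>2, 0, -1:]" "u + v = 1"
    using R by (auto simp: u_def v_def power2_eq_square one_pCons field_simps)
  have sq: "?L (p * p * (u * v)) \<ge> 0" for p
  proof -
    have "?L (p * p * (u * v)) = 1 / (4 * R\<^sup>2) * ?L (p * p * [:R\<^sup>2, 0, -1:])"
      by (simp only: uv(1) mult_smult_right moment_functional_smult)
    then show ?thesis using moment_functional_bounded_square[of p] by simp
  qed
  \<comment> \<open>Extracting squares leaves exponents 0 or 1. The product u v is a positive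
    multiple of R^2 - x^2, and u + v = 1 gives u = u^2 + u v and v = v^2 + u v.\<close>
  have pos: "?L (u ^ k * v ^ l) \<ge> 0" for k l
  proof -
    define q where "q = u ^ (k div 2) * v ^ (l div 2)"
    have dm: "w ^ n = w ^ (n mod 2) * (w ^ (n div 2) * w ^ (n div 2))" for w :: "real poly" and n
      by (simp flip: power_add) (simp add: mult_2[symmetric])
    have "u ^ k * v ^ l = q * q * (u ^ (k mod 2) * v ^ (l mod 2))"
      by (subst dm[of u k], subst dm[of v l]) (simp add: q_def mult_ac)
    moreover have "k mod 2 = 0 \<or> k mod 2 = 1" "l mod 2 = 0 \<or> l mod 2 = 1" by auto
    moreover have "q * q * u = (q * u) * (q * u) + q * q * (u * v)"
      by (metis (no_types, opaque_lifting) uv(2) distrib_left mult.commute mult.left_commute mult_1_right)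
    moreover have "q * q * v = (q * v) * (q * v) + q * q * (u * v)"
      by (metis (no_types, opaque_lifting) uv(2) add.commute distrib_left mult.commute mult.left_commute mult_1_right)
    ultimately show ?thesis
      using psd[of q] psd[of "q * u"] psd[of "q * v"] sq[of q]
      by (auto simp: moment_functional_add)
  qed
  interpret positive_functional "\<lambda>p. ?L (p \<circ>\<^sub>p u)"
  proof
    show "?L (1 \<circ>\<^sub>p u) = 1" using c0 by (simp add: moment_functional_def pcompose_1)
    show "0 \<le> ?L (([:0, 1:] ^ k * [:1, - 1:] ^ l) \<circ>\<^sub>p u)" for k l
    proof -
      have "[:1, - 1:] \<circ>\<^sub>p u = v" by (simp add: pcompose_pCons u_def v_def one_pCons)
      moreover have "[:0, 1:] \<circ>\<^sub>p u = u" by (simp add: pcompose_pCons)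
      ultimately show ?thesis using pos[of k l] by (simp add: pcompose_mult pcompose_pow del: pcompose_pCons)
    qed
  qed (simp_all add: pcompose_add pcompose_smult moment_functional_add moment_functional_smult)
  from moment_measure obtain \<nu> where \<nu>: "prob_space \<nu>" "sets \<nu> = sets borel"
    "AE x in \<nu>. x \<in> {0..1}" "\<And>p. integral\<^sup>L \<nu> (poly p) = ?L (p \<circ>\<^sub>p u)" by blast
  interpret prob_space \<nu> by fact
  \<comment> \<open>The inverse of u.\<close>
  define h where "h x = 2 * R * x - R" for x :: real
  have h[measurable]: "h \<in> borel_measurable \<nu>"
    unfolding measurable_cong_sets[OF \<nu>(2) refl] h_def[abs_def] by measurable
  show thesis
  proof
    show "prob_space (distr \<nu> borel h)" by (rule prob_space_distr) (rule h)
    show "sets (distr \<nu> borel h) = sets borel" by simp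
    fix k
    have "integrable \<nu> (\<lambda>x. h x ^ k)"
    proof (rule integrable_const_bound)
      show "AE x in \<nu>. norm (h x ^ k) \<le> R ^ k"
        using \<nu>(3)
      proof eventually_elim
        case (elim x)
        then have "R * x \<le> R" "0 \<le> R * x" using R by (auto simp: mult_le_cancel_left2)
        then have "\<bar>h x\<bar> \<le> R" by (simp add: h_def abs_le_iff)
        then show ?case by (simp add: norm_power power_mono power_abs)
      qed
    qed measurable
    then show "integrable (distr \<nu> borel h) (\<lambda>x. x ^ k)" by (simp add: integrable_distr_eq)
    have "integral\<^sup>L (distr \<nu> borel h) (\<lambda>x. x ^ k) = integral\<^sup>L \<nu> (poly ([:-R, 2 * R:] ^ k))"
      by (subst integral_distr[OF h]) (simp_all add: h_def[abs_def] poly_power[abs_def] algebra_simps)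
    also have "\<dots> = ?L (([:-R, 2 * R:] \<circ>\<^sub>p u) ^ k)" by (simp add: \<nu>(4) pcompose_pow)
    also have "[:-R, 2 * R:] \<circ>\<^sub>p u = [:0, 1:]" using R by (simp add: pcompose_pCons u_def)
    also have "?L ([:0, 1:] ^ k) = c k"
      using moment_functional_monom[of c 1 k] by (simp add: monom_altdef)
    finally show "integral\<^sup>L (distr \<nu> borel h) (\<lambda>x. x ^ k) = c k" .
  qed
qed

end

subsection \<open>The limit law\<close>

lemma word_limit_of_real: "word_limit (\<lambda>s. complex_of_real (K s)) ss = of_real (word_limit K ss)"
proof (induction "length ss" arbitrary: ss rule: less_induct)
  case less
  show ?case
  proof (cases ss)
    case (Cons s ts)
    have "(\<Sum>k<length ts. word_limit (\<lambda>s. complex_of_real (K s)) (take k ts @ [ts ! k + s])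
          * word_limit (\<lambda>s. complex_of_real (K s)) (drop (Suc k) ts))
        = (\<Sum>k<length ts. of_real (word_limit K (take k ts @ [ts ! k + s])) * of_real (word_limit K (drop (Suc k) ts)))"
      by (intro sum.cong refl arg_cong2[where f = "(*)"] less) (simp_all add: Cons)
    then show ?thesis using less[of ts] by (simp add: Cons)
  qed simp
qed

lemma sum_swap_pairs:
  "(\<Sum>i\<in>I. \<Sum>j\<in>J. \<Sum>a\<in>A. \<Sum>b\<in>B. h i j a b) = (\<Sum>a\<in>A. \<Sum>b\<in>B. \<Sum>i\<in>I. \<Sum>j\<in>J. h i j a b)"
proof -
  have "(\<Sum>i\<in>I. \<Sum>j\<in>J. \<Sum>a\<in>A. \<Sum>b\<in>B. h i j a b) = (\<Sum>i\<in>I. \<Sum>a\<in>A. \<Sum>b\<in>B. \<Sum>j\<in>J. h i j a b)"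
    by (rule sum.cong[OF refl], rule trans[OF sum.swap], rule sum.cong[OF refl], rule sum.swap)
  also have "\<dots> = (\<Sum>a\<in>A. \<Sum>b\<in>B. \<Sum>i\<in>I. \<Sum>j\<in>J. h i j a b)"
    by (rule trans[OF sum.swap], rule sum.cong[OF refl], rule sum.swap)
  finally show ?thesis .
qed

section \<open>Positivity of the expected moments\<close>

context gaussian_matrix
begin

lemma cnj_word:
  assumes D: "\<And>j l. j < L \<Longrightarrow> l < L \<Longrightarrow> cnj (D 1 j l) = D 1 l j" and "a < N" "b < N"
  shows "cnj (word (replicate m 1) a b \<omega>) = word (replicate m 1) b a \<omega>"
  using assms(2)
proof (induction m arbitrary: a)
  case (Suc m)
  have W: "cnj (W 1 a c \<omega>) = W 1 c a \<omega>" for c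
  proof -
    have "cnj (W 1 a c \<omega>) = (\<Sum>l<L. \<Sum>j<L. cnj (x a j \<omega>) * (D 1 l j * x c l \<omega>))"
      unfolding W_def XD_def using D by (simp add: sum_distrib_right mult.assoc)
    also have "\<dots> = W 1 c a \<omega>"
      unfolding W_def XD_def by (subst sum.swap) (simp add: sum_distrib_left mult_ac)
    finally show ?thesis .
  qed
  have "cnj (word (replicate (Suc m) 1) a b \<omega>) = (\<Sum>c<N. word (replicate m 1) b c \<omega> * W 1 c a \<omega>)"
    using Suc.IH by (simp add: W[unfolded One_nat_def] mult.commute)
  also have "\<dots> = word (replicate m 1 @ [1]) b a \<omega>"
    using Suc.prems assms(3) by (simp add: word_append)
  finally show ?case by (simp only: replicate_append_same replicate_Suc)
qed (auto simp: of_bool_def)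

text \<open>As \<open>W 1\<close> is selfadjoint, the double sum is the expected normalized squared
  Hilbert-Schmidt norm of the real polynomial in \<open>W 1\<close> with coefficients
  \<open>\<alpha>\<close>.\<close>

lemma moments_positive_semidefinite:
  assumes D: "\<And>j l. j < L \<Longrightarrow> l < L \<Longrightarrow> cnj (D 1 j l) = D 1 l j"
  shows "Re (\<Sum>i\<le>n. \<Sum>j\<le>n. of_real (\<alpha> i * \<alpha> j) * expectation (traces [replicate (i + j) 1])) \<ge> 0"
proof -
  define p where "p a b \<omega> = (\<Sum>i\<le>n. of_real (\<alpha> i) * word (replicate i 1) a b \<omega>)" for a b \<omega>
  have "(\<Sum>i\<le>n. \<Sum>j\<le>n. of_real (\<alpha> i * \<alpha> j) * traces [replicate (i + j) 1] \<omega>)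
      = of_real ((\<Sum>a<N. \<Sum>b<N. (cmod (p a b \<omega>))\<^sup>2) / real N)" for \<omega>
  proof -
    have "traces [replicate (i + j) 1] \<omega>
        = (\<Sum>a<N. \<Sum>b<N. word (replicate i 1) a b \<omega> * cnj (word (replicate j 1) a b \<omega>)) / of_nat N" for i j
      by (simp add: tr_def replicate_add word_append cnj_word[OF D, unfolded One_nat_def])
    then have "(\<Sum>i\<le>n. \<Sum>j\<le>n. of_real (\<alpha> i * \<alpha> j) * traces [replicate (i + j) 1] \<omega>)
        = (\<Sum>i\<le>n. \<Sum>j\<le>n. \<Sum>a<N. \<Sum>b<N. (of_real (\<alpha> i) * word (replicate i 1) a b \<omega>)
            * cnj (of_real (\<alpha> j) * word (replicate j 1) a b \<omega>)) / of_nat N"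
      by (simp add: sum_divide_distrib sum_distrib_left mult_ac del: traces.simps)
    also have "(\<Sum>i\<le>n. \<Sum>j\<le>n. \<Sum>a<N. \<Sum>b<N. (of_real (\<alpha> i) * word (replicate i 1) a b \<omega>)
            * cnj (of_real (\<alpha> j) * word (replicate j 1) a b \<omega>))
        = (\<Sum>a<N. \<Sum>b<N. \<Sum>i\<le>n. \<Sum>j\<le>n. (of_real (\<alpha> i) * word (replicate i 1) a b \<omega>)
            * cnj (of_real (\<alpha> j) * word (replicate j 1) a b \<omega>))"
      by (rule sum_swap_pairs)
    also have "\<dots> = (\<Sum>a<N. \<Sum>b<N. p a b \<omega> * cnj (p a b \<omega>))"
      unfolding p_def cnj_sum sum_product ..
    also have "\<dots> = of_real (\<Sum>a<N. \<Sum>b<N. (cmod (p a b \<omega>))\<^sup>2)"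
      unfolding of_real_sum by (intro sum.cong refl) (rule complex_norm_square[symmetric])
    finally show ?thesis by simp
  qed
  note eq = this
  have "(\<Sum>i\<le>n. \<Sum>j\<le>n. of_real (\<alpha> i * \<alpha> j) * expectation (traces [replicate (i + j) 1]))
      = expectation (\<lambda>\<omega>. \<Sum>i\<le>n. \<Sum>j\<le>n. of_real (\<alpha> i * \<alpha> j) * traces [replicate (i + j) 1] \<omega>)"
    using integrable_traces by (simp add: Bochner_Integration.integral_sum del: traces.simps of_real_mult)
  also have "\<dots> = of_real (expectation (\<lambda>\<omega>. (\<Sum>a<N. \<Sum>b<N. (cmod (p a b \<omega>))\<^sup>2) / real N))"
    unfolding eq by (rule integral_complex_of_real)
  also have "Re \<dots> \<ge> 0"
    unfolding Re_complex_of_real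
    by (intro integral_nonneg_AE AE_I2 divide_nonneg_nonneg sum_nonneg) simp_all
  finally show ?thesis .
qed

end

section \<open>Matrix powers, trace bounds and Kronecker products\<close>

lemma div_mod_lt: "i < N * M \<Longrightarrow> i div N < M \<and> i mod N < (N :: nat)"
  by (metis less_mult_imp_div_less mod_less_divisor mult.commute mult_0 gr0I not_less_zero)

lemma sum_div_mod:
  "(\<Sum>j<N * M. f (j div N) (j mod N)) = (\<Sum>p<M. \<Sum>q<(N :: nat). f p q)" for f :: "nat \<Rightarrow> nat \<Rightarrow> 'a :: comm_monoid_add"
proof -
  have lt: "q + N * p < N * M" if "p < M" "q < N" for p q
  proof -
    have "q + N * p < N * Suc p" using that by simp
    also have "\<dots> \<le> N * M" using that by (intro mult_le_mono2) simp
    finally show ?thesis .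
  qed
  have "(\<Sum>j<N * M. f (j div N) (j mod N)) = (\<Sum>(p, q)\<in>{..<M} \<times> {..<N}. f p q)"
    by (rule sum.reindex_bij_witness[of _ "\<lambda>(p, q). q + N * p" "\<lambda>j. (j div N, j mod N)"])
      (auto simp: lt div_mod_lt)
  then show ?thesis by (simp add: sum.cartesian_product)
qed

lemma pow_mat_add:
  assumes "B \<in> carrier_mat n n"
  shows "B ^\<^sub>m (s + t) = B ^\<^sub>m s * (B ^\<^sub>m t :: complex mat)"
proof (induction t)
  case 0
  then show ?case using assms by simp
next
  case (Suc t)
  then show ?case
    using assms assoc_mult_mat[of "B ^\<^sub>m s" n n "B ^\<^sub>m t" n B n] by simp
qed

lemma index_mat_adjoint: "i < dim_col B \<Longrightarrow> j < dim_row B \<Longrightarrow> mat_adjoint B $$ (i, j) = cnj (B $$ (j, i))"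
  by (simp add: mat_adjoint_def mat_of_rows_index)

lemma index_mult_mat_sum:
  assumes "A \<in> carrier_mat n k" "B \<in> carrier_mat k m" "i < n" "j < m"
  shows "(A * B) $$ (i, j) = (\<Sum>l<k. A $$ (i, l) * B $$ (l, j) :: complex)"
  using assms by (simp add: scalar_prod_def atLeast0LessThan)

text \<open>A matrix product sums n terms while each entry carries 1 / n, so a bound of the form c^k
  / n reproduces itself. It starts at exponent 1, the identity having entries 1.\<close>

lemma cmod_pow_mat_le:
  assumes B: "B \<in> carrier_mat n n" and bound: "\<And>i j. i < n \<Longrightarrow> j < n \<Longrightarrow> cmod (B $$ (i, j)) \<le> c / n"
    and ij: "i < n" "j < n" and c: "c \<ge> 0"
  shows "cmod ((B ^\<^sub>m Suc k) $$ (i, j)) \<le> c ^ Suc k / n"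
  using ij
proof (induction k arbitrary: j)
  case 0
  then show ?case using bound B by simp
next
  case (Suc k)
  have n: "n > 0" using ij by simp
  have car: "B ^\<^sub>m Suc k \<in> carrier_mat n n" using B by (rule pow_carrier_mat)
  have "cmod ((B ^\<^sub>m Suc (Suc k)) $$ (i, j)) = cmod (\<Sum>l<n. (B ^\<^sub>m Suc k) $$ (i, l) * B $$ (l, j))"
    using index_mult_mat_sum[OF car B Suc.prems] by simp
  also have "\<dots> \<le> (\<Sum>l<n. c ^ Suc k / n * (c / n))"
  proof (rule order_trans[OF norm_sum], rule sum_mono)
    fix l assume "l \<in> {..<n}"
    then have l: "l < n" by simp
    show "cmod ((B ^\<^sub>m Suc k) $$ (i, l) * B $$ (l, j)) \<le> c ^ Suc k / n * (c / n)"
      unfolding norm_mult using c by (intro mult_mono Suc.IH[OF ij(1) l] bound[OF l Suc.prems(2)]) simp_all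
  qed
  also have "\<dots> = c ^ Suc (Suc k) / n" using n by simp
  finally show ?case .
qed

lemma cmod_trace_pow_le:
  assumes "B \<in> carrier_mat n n" "\<And>i j. i < n \<Longrightarrow> j < n \<Longrightarrow> cmod (B $$ (i, j)) \<le> c / n" "c \<ge> 0" "n > 0" "r > 0"
  shows "cmod (mat_trace (B ^\<^sub>m r)) \<le> c ^ r"
proof -
  obtain k where r: "r = Suc k" using assms(5) gr0_implies_Suc by blast
  have dim: "dim_row (B ^\<^sub>m r) = n" using pow_carrier_mat[OF assms(1), of r] by auto
  have "cmod (mat_trace (B ^\<^sub>m r)) \<le> (\<Sum>i<n. c ^ r / n)"
    unfolding mat_trace_def dim
    by (rule order_trans[OF norm_sum], rule sum_mono) (use cmod_pow_mat_le[OF assms(1,2) _ _ assms(3)] r in auto)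
  then show ?thesis using assms(4) by simp
qed

text \<open>Entries of the s-th power of the Kronecker product of B and P, computed as the Kronecker
  product of the s-th powers; this is the D of \<open>gaussian_matrix\<close>.\<close>

definition tensor_entry :: "complex mat \<Rightarrow> complex mat \<Rightarrow> nat \<Rightarrow> nat \<Rightarrow> nat \<Rightarrow> nat \<Rightarrow> complex" where
  "tensor_entry B P N s i j = (B ^\<^sub>m s) $$ (i div N, j div N) * (P ^\<^sub>m s) $$ (i mod N, j mod N)"

lemma tensor_entry_mult:
  assumes B: "B \<in> carrier_mat M M" and P: "P \<in> carrier_mat N N" and ik: "i < N * M" "k < N * M"
  shows "(\<Sum>j<N * M. tensor_entry B P N s i j * tensor_entry B P N t j k) = tensor_entry B P N (s + t) i k"
proof -
  note lt = div_mod_lt[OF ik(1)] div_mod_lt[OF ik(2)]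
  note cB = pow_carrier_mat[OF B] and cP = pow_carrier_mat[OF P]
  have "(\<Sum>j<N * M. tensor_entry B P N s i j * tensor_entry B P N t j k)
      = (\<Sum>p<M. \<Sum>q<N. ((B ^\<^sub>m s) $$ (i div N, p) * (P ^\<^sub>m s) $$ (i mod N, q))
          * ((B ^\<^sub>m t) $$ (p, k div N) * (P ^\<^sub>m t) $$ (q, k mod N)))"
    unfolding tensor_entry_def by (rule sum_div_mod)
  also have "\<dots> = (\<Sum>p<M. (B ^\<^sub>m s) $$ (i div N, p) * (B ^\<^sub>m t) $$ (p, k div N))
      * (\<Sum>q<N. (P ^\<^sub>m s) $$ (i mod N, q) * (P ^\<^sub>m t) $$ (q, k mod N))"
    unfolding sum_product by (intro sum.cong refl) (simp only: mult_ac)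
  also have "\<dots> = tensor_entry B P N (s + t) i k"
    unfolding tensor_entry_def pow_mat_add[OF B] pow_mat_add[OF P]
    using index_mult_mat_sum[OF cB cB, of "i div N" "k div N"] index_mult_mat_sum[OF cP cP, of "i mod N" "k mod N"] lt
    by simp
  finally show ?thesis .
qed

lemma tensor_entry_trace:
  assumes B: "B \<in> carrier_mat M M" and P: "P \<in> carrier_mat N N"
  shows "(\<Sum>j<N * M. tensor_entry B P N s j j) = mat_trace (B ^\<^sub>m s) * mat_trace (P ^\<^sub>m s)"
proof -
  have "dim_row (B ^\<^sub>m s) = M" "dim_row (P ^\<^sub>m s) = N"
    using pow_carrier_mat[OF B, of s] pow_carrier_mat[OF P, of s] by auto
  then show ?thesis
    unfolding tensor_entry_def mat_trace_def sum_product
    by (simp only: sum_div_mod[of "\<lambda>p q. (B ^\<^sub>m s) $$ (p, p) * (P ^\<^sub>m s) $$ (q, q)"])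
qed

lemma gaussian_matrix_tensor:
  assumes X: "complex_gaussian_matrix \<Omega> N (N * M) X" and N: "N > 0"
    and B: "B \<in> carrier_mat M M" and P: "P \<in> carrier_mat N N"
  shows "gaussian_matrix \<Omega> N (N * M) (\<lambda>i j \<omega>. X \<omega> $$ (i, j)) (tensor_entry B P N)"
proof -
  let ?\<xi> = "\<lambda>(i, j, b) \<omega>. if b then Re (X \<omega> $$ (i, j)) else Im (X \<omega> $$ (i, j))"
  have "distributed \<Omega> lborel (?\<xi> e) (\<lambda>x. ennreal (normal_density 0 (sqrt (1 / (2 * real N))) x))"
    if "e \<in> {..<N} \<times> {..<N * M} \<times> UNIV" for e
  proof -
    obtain i j b where "e = (i, j, b)" by (cases e)
    then show ?thesis using X that by (cases b) (auto simp: complex_gaussian_matrix_def)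
  qed
  then show ?thesis
    unfolding gaussian_matrix_def gaussian_matrix_axioms_def gaussian_family_def gaussian_family_axioms_def
    using X N tensor_entry_mult[OF B P] by (auto simp: complex_gaussian_matrix_def)
qed

text \<open>The scalar 1 / M is absorbed into A, so that the matrix of the theorem is exactly the
  letter \<open>W 1\<close>.\<close>

lemma pow_eq_word:
  assumes g: "gaussian_matrix \<Omega> N (N * M) (\<lambda>i j \<omega>. X \<omega> $$ (i, j)) (tensor_entry ((1 / of_nat M) \<cdot>\<^sub>m A) P N)"
    and X: "X \<omega> \<in> carrier_mat N (N * M)" and A: "A \<in> carrier_mat M M" and P: "P \<in> carrier_mat N N"
    and ab: "a < N" "b < N"
  shows "(((1 / of_nat M) \<cdot>\<^sub>m (X \<omega> * kronecker A P * mat_adjoint (X \<omega>))) ^\<^sub>m m) $$ (a, b)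
    = gaussian_matrix.word N (N * M) (\<lambda>i j \<omega>. X \<omega> $$ (i, j)) (tensor_entry ((1 / of_nat M) \<cdot>\<^sub>m A) P N)
        (replicate m 1) a b \<omega>"
proof -
  interpret gaussian_matrix \<Omega> N "N * M" "\<lambda>i j \<omega>. X \<omega> $$ (i, j)" "tensor_entry ((1 / of_nat M) \<cdot>\<^sub>m A) P N"
    by (rule g)
  let ?T = "kronecker A P" and ?Y = "(1 / of_nat M) \<cdot>\<^sub>m (X \<omega> * kronecker A P * mat_adjoint (X \<omega>))"
  have T: "?T \<in> carrier_mat (N * M) (N * M)"
    using A P by (auto simp: kronecker_def mult.commute)
  have adj: "mat_adjoint (X \<omega>) \<in> carrier_mat (N * M) N"
    using X by (auto simp: mat_adjoint_def)
  have XT: "X \<omega> * ?T \<in> carrier_mat N (N * M)" using X T by simp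
  have Y: "?Y \<in> carrier_mat N N" using XT adj by simp
  have entry: "tensor_entry ((1 / of_nat M) \<cdot>\<^sub>m A) P N 1 j l = 1 / of_nat M * ?T $$ (j, l)"
    if "j < N * M" "l < N * M" for j l
    using A P that div_mod_lt[OF that(1)] div_mod_lt[OF that(2)]
    by (simp add: tensor_entry_def kronecker_def mult.commute)
  have W: "?Y $$ (a, b) = W 1 a b \<omega>" if "a < N" "b < N" for a b
  proof -
    have "?Y $$ (a, b) = 1 / of_nat M * (\<Sum>l<N * M. (\<Sum>j<N * M. X \<omega> $$ (a, j) * ?T $$ (j, l)) * cnj (X \<omega> $$ (b, l)))"
      using that X XT T adj index_mult_mat_sum[OF XT adj that] index_mult_mat_sum[OF X T that(1)]
      by (simp add: index_mat_adjoint)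
    also have "\<dots> = W 1 a b \<omega>"
      unfolding W_def XD_def using entry by (simp add: sum_distrib_left sum_distrib_right mult_ac)
    finally show ?thesis .
  qed
  show ?thesis using ab
  proof (induction m arbitrary: b)
    case 0
    then show ?case using Y X by (simp add: of_bool_def carrier_matD[OF X])
  next
    case (Suc m)
    have "(?Y ^\<^sub>m Suc m) $$ (a, b) = (\<Sum>c<N. (?Y ^\<^sub>m m) $$ (a, c) * ?Y $$ (c, b))"
      using index_mult_mat_sum[OF pow_carrier_mat[OF Y] Y Suc.prems] by simp
    also have "\<dots> = (\<Sum>c<N. word (replicate m 1) a c \<omega> * word [1] c b \<omega>)"
      using Suc W by (intro sum.cong refl) simp
    also have "\<dots> = word (replicate (Suc m) 1) a b \<omega>"
      using word_append[OF ab(1), of "replicate m 1" "[1]" b \<omega>]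
      by (simp only: replicate_append_same replicate_Suc)
    finally show ?case .
  qed
qed

theorem corollary3p5:
  fixes \<Omega> :: "nat \<Rightarrow> nat \<Rightarrow> 'w measure"
    and X :: "nat \<Rightarrow> nat \<Rightarrow> 'w \<Rightarrow> complex mat"
    and A P :: "nat \<Rightarrow> complex mat"
    and \<mu> :: "real measure"
  assumes X_gaussian:
      "\<And>M N. M \<ge> 1 \<Longrightarrow> N \<ge> 1 \<Longrightarrow> complex_gaussian_matrix (\<Omega> M N) N (N * M) (X M N)"
    and A_selfadjoint: "\<And>M. M \<ge> 1 \<Longrightarrow> selfadjoint_mat M (A M)"
    and A_bounded: "bdd_above {cmod (A M $$ (i, j)) | M i j. i < M \<and> j < M}"
    and A_limit: "limit_distribution_Tr (\<lambda>M. (1 / of_nat M) \<cdot>\<^sub>m A M) \<mu>"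
    and P_selfadjoint: "\<And>N. N \<ge> 1 \<Longrightarrow> selfadjoint_mat N (P N)"
    and P_limit: "\<And>m. m \<ge> 1 \<Longrightarrow> (\<lambda>N. mat_trace (P N ^\<^sub>m m) / of_nat N) \<longlonglongrightarrow> 1"
  shows "\<exists>\<nu>. real_law \<nu> \<and>
           has_free_cumulants \<nu> (\<lambda>r. \<integral>t. t ^ r \<partial>\<mu>) \<and>
           converges_in_moments \<Omega>
             (\<lambda>M N \<omega>. (1 / of_nat M) \<cdot>\<^sub>m
                (X M N \<omega> * kronecker (A M) (P N) * mat_adjoint (X M N \<omega>))) \<nu>"
proof -
  define B where "B M = (1 / of_nat M) \<cdot>\<^sub>m A M" for M
  define K where "K r = (\<integral>t. t ^ r \<partial>\<mu>)" for r
  define F where "F = (sequentially \<times>\<^sub>F sequentially :: (nat \<times> nat) filter)"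
  have A: "A M \<in> carrier_mat M M" "mat_adjoint (A M) = A M" if "M \<ge> 1" for M
    using A_selfadjoint[OF that] by (auto simp: selfadjoint_mat_def)
  have P: "P N \<in> carrier_mat N N" "mat_adjoint (P N) = P N" if "N \<ge> 1" for N
    using P_selfadjoint[OF that] by (auto simp: selfadjoint_mat_def)
  have B: "B M \<in> carrier_mat M M" if "M \<ge> 1" for M using A[OF that] by (simp add: B_def)
  have B_lim: "(\<lambda>M. mat_trace (B M ^\<^sub>m r)) \<longlonglongrightarrow> of_real (K r)" if "r \<ge> 1" for r
    using A_limit that unfolding limit_distribution_Tr_def B_def K_def by blast

  obtain c where c: "\<And>M i j. i < M \<Longrightarrow> j < M \<Longrightarrow> cmod (A M $$ (i, j)) \<le> c" "c \<ge> 1"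
  proof -
    from A_bounded obtain c where "\<forall>x\<in>{cmod (A M $$ (i, j)) | M i j. i < M \<and> j < M}. x \<le> c"
      unfolding bdd_above_def by blast
    \<comment> \<open>Raising the bound to at least 1 keeps the radius 4 * c of the moment problem
      positive even when all entries vanish.\<close>
    then have "cmod (A M $$ (i, j)) \<le> max c 1" if "i < M" "j < M" for M i j
      using that by (intro max.coboundedI1) blast
    then show thesis using that[of "max c 1"] by simp
  qed
  \<comment> \<open>The measure \<open>\<mu>\<close> is known through its moments only, so the
    estimate is made for the traces of (A/M)^r and passed to the limit.\<close>
  have K_bound: "norm (K r) \<le> c ^ r" if "r > 0" for r
  proof -
    have "\<forall>\<^sub>F M in sequentially. cmod (mat_trace (B M ^\<^sub>m r)) \<le> c ^ r"
      using eventually_ge_at_top[of 1]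
    proof eventually_elim
      case (elim M)
      have "cmod (B M $$ (i, j)) \<le> c / M" if "i < M" "j < M" for i j
        using c(1)[OF that] A[OF elim] that by (simp add: B_def norm_divide divide_right_mono)
      then show ?case using B[OF elim] c(2) elim that by (intro cmod_trace_pow_le[where n = M]) auto
    qed
    moreover have "(\<lambda>M. cmod (mat_trace (B M ^\<^sub>m r))) \<longlonglongrightarrow> cmod (of_real (K r))"
      using B_lim that by (intro tendsto_norm) simp
    ultimately have "cmod (of_real (K r)) \<le> c ^ r"
      by (intro tendsto_upperbound) auto
    then show ?thesis by simp
  qed

  define D where "D M N = tensor_entry (B M) (P N) N" for M N
  have gm: "gaussian_matrix (\<Omega> M N) N (N * M) (\<lambda>i j \<omega>. X M N \<omega> $$ (i, j)) (D M N)" if "M \<ge> 1" "N \<ge> 1" for M N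
    unfolding D_def using X_gaussian[OF that] B[OF that(1)] P[OF that(2)] that by (intro gaussian_matrix_tensor) auto
  have D_hermitian: "cnj (D M N 1 j l) = D M N 1 l j" if "M \<ge> 1" "N \<ge> 1" "j < N * M" "l < N * M" for M N j l
  proof -
    note d = div_mod_lt[OF that(3)] div_mod_lt[OF that(4)]
    have "cnj (A M $$ (i, k)) = A M $$ (k, i)" if "i < M" "k < M" for i k
      using index_mat_adjoint[of k "A M" i] A[OF \<open>M \<ge> 1\<close>] that by auto
    moreover have "cnj (P N $$ (i, k)) = P N $$ (k, i)" if "i < N" "k < N" for i k
      using index_mat_adjoint[of k "P N" i] P[OF \<open>N \<ge> 1\<close>] that by auto
    ultimately show ?thesis
      using d A[OF that(1)] P[OF that(2)] B[OF that(1)] by (simp add: D_def tensor_entry_def B_def)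
  qed

  \<comment> \<open>E is total in (M, N), but its equations come from the locale and hold where M, N
    \<ge> 1, which is eventually the case along F.\<close>
  define E where "E p ts = (case p of (M, N) \<Rightarrow>
    \<integral>\<omega>. gaussian_matrix.traces N (N * M) (\<lambda>i j \<omega>. X M N \<omega> $$ (i, j)) (D M N) ts \<omega> \<partial>\<Omega> M N)" for p ts
  have ev: "\<forall>\<^sub>F p in F. fst p \<ge> 1 \<and> snd p \<ge> 1"
    unfolding F_def
    by (intro eventually_conj eventually_compose_filterlim[OF eventually_ge_at_top filterlim_fst]
        eventually_compose_filterlim[OF eventually_ge_at_top filterlim_snd])
  have evI: "\<forall>\<^sub>F p in F. Q p" if "\<And>M N. M \<ge> 1 \<Longrightarrow> N \<ge> 1 \<Longrightarrow> Q (M, N)" for Q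
    using ev by eventually_elim (use that in auto)
  have E_lim: "((\<lambda>p. E p ts) \<longlongrightarrow> (\<Prod>t\<leftarrow>ts. word_limit (\<lambda>s. of_real (K s)) t)) F"
    if pos: "\<forall>t\<in>set ts. \<forall>u\<in>set t. u > 0" for ts
  proof (rule traces_limit[where n = snd and \<tau> = "\<lambda>p s. mat_trace (B (fst p) ^\<^sub>m s) * (mat_trace (P (snd p) ^\<^sub>m s) / of_nat (snd p))"])
    show "\<forall>\<^sub>F p in F. E p [] = 1"
    proof (rule evI)
      fix M N :: nat assume "M \<ge> 1" "N \<ge> 1"
      then interpret gaussian_matrix "\<Omega> M N" N "N * M" "\<lambda>i j \<omega>. X M N \<omega> $$ (i, j)" "D M N" by (rule gm)
      have "traces [] = (\<lambda>_. 1)" by (rule ext) simp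
      then show "E (M, N) [] = 1" by (simp add: E_def prob_space)
    qed
    show "\<forall>\<^sub>F p in F. E p ([] # ts) = E p ts" for ts
    proof (rule evI)
      fix M N :: nat assume "M \<ge> 1" "N \<ge> 1"
      then interpret gaussian_matrix "\<Omega> M N" N "N * M" "\<lambda>i j \<omega>. X M N \<omega> $$ (i, j)" "D M N" by (rule gm)
      have "traces ([] # ts) = traces ts" using N_pos by (intro ext) (simp add: tr_def)
      then show "E (M, N) ([] # ts) = E (M, N) ts" by (simp add: E_def)
    qed
    fix s :: nat and ss :: "nat list" and ts :: "nat list list"
    assume s: "s > 0" "\<forall>u\<in>set ss. u > 0" "\<forall>t\<in>set ts. \<forall>u\<in>set t. u > 0"
    show "\<forall>\<^sub>F p in F. E p ((s # ss) # ts)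
        = mat_trace (B (fst p) ^\<^sub>m s) * (mat_trace (P (snd p) ^\<^sub>m s) / of_nat (snd p)) * E p (ss # ts)
        + (\<Sum>k<length ss. E p ((take k ss @ [ss ! k + s]) # drop (Suc k) ss # ts))
        + (\<Sum>us\<leftarrow>merges s ss ts. E p us) / (of_nat (snd p))\<^sup>2"
    proof (rule evI)
      fix M N :: nat assume MN: "M \<ge> 1" "N \<ge> 1"
      then interpret gaussian_matrix "\<Omega> M N" N "N * M" "\<lambda>i j \<omega>. X M N \<omega> $$ (i, j)" "D M N" by (rule gm)
      have E: "E (M, N) us = expectation (traces us)" for us by (simp add: E_def)
      have "(\<Sum>j<N * M. D M N s j j) = mat_trace (B M ^\<^sub>m s) * mat_trace (P N ^\<^sub>m s)"
        unfolding D_def by (rule tensor_entry_trace[OF B[OF MN(1)] P(1)[OF MN(2)]])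
      then show "E (M, N) ((s # ss) # ts)
        = mat_trace (B (fst (M, N)) ^\<^sub>m s) * (mat_trace (P (snd (M, N)) ^\<^sub>m s) / of_nat (snd (M, N))) * E (M, N) (ss # ts)
        + (\<Sum>k<length ss. E (M, N) ((take k ss @ [ss ! k + s]) # drop (Suc k) ss # ts))
        + (\<Sum>us\<leftarrow>merges s ss ts. E (M, N) us) / (of_nat (snd (M, N)))\<^sup>2"
        unfolding E using schwinger_dyson[of s ss ts] s by simp
    qed
  next
    fix s :: nat assume s: "s > 0"
    \<comment> \<open>The factor 1 / N of the Schwinger-Dyson equation normalizes the trace of P^s,
      which then tends to 1; the trace of (A/M)^s stays nonnormalized and tends to K s.\<close>
    have "((\<lambda>p. mat_trace (B (fst p) ^\<^sub>m s)) \<longlongrightarrow> of_real (K s)) F"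
      unfolding F_def using filterlim_compose[OF B_lim[of s] filterlim_fst] s by simp
    moreover have "((\<lambda>p. mat_trace (P (snd p) ^\<^sub>m s) / of_nat (snd p)) \<longlongrightarrow> 1) F"
      unfolding F_def using filterlim_compose[OF P_limit[of s] filterlim_snd] s by simp
    ultimately show "((\<lambda>p. mat_trace (B (fst p) ^\<^sub>m s) * (mat_trace (P (snd p) ^\<^sub>m s) / of_nat (snd p))) \<longlongrightarrow> of_real (K s)) F"
      using tendsto_mult by fastforce
  next
    show "filterlim snd at_top F" unfolding F_def by (rule filterlim_snd)
  qed (use pos in blast)

  define m where "m k = word_limit K (replicate k 1)" for k
  have E_m: "((\<lambda>p. E p [replicate k 1]) \<longlongrightarrow> of_real (m k)) F" for k
    using E_lim[of "[replicate k 1]"] by (simp add: word_limit_of_real m_def)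
  have m_nc: "m k = (\<Sum>\<pi>\<in>NC k. \<Prod>B\<in>\<pi>. K (card B))" for k
  proof -
    \<comment> \<open>All weights are 1, so the weight of a block is its cardinality.\<close>
    have "replicate k (1 :: nat) = map (\<lambda>_. 1) [1..<Suc k]" by (simp add: map_replicate_const)
    then show ?thesis
      unfolding m_def by (simp only: word_limit_eq_nc_sum)
        (simp add: nc_sum_def NC_on_def NC_def atLeastLessThanSuc_atLeastAtMost)
  qed
  \<comment> \<open>The rate combines c from the cumulants with the Catalan rate 4.\<close>
  have growth: "\<bar>m k\<bar> \<le> 2 * (4 * c) ^ k" for k
  proof -
    have "norm (m k) \<le> c ^ sum_list (replicate k 1) * catalan (length (replicate k 1 :: nat list))"
      unfolding m_def using c(2) by (intro norm_word_limit_le K_bound) auto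
    also have "\<dots> \<le> c ^ k * (2 * 4 ^ k)"
      using c(2) catalan_le[of k] by (simp add: sum_list_replicate)
    finally show ?thesis by (simp add: power_mult_distrib mult_ac)
  qed
  have nontriv: "F \<noteq> bot" unfolding F_def by (simp add: prod_filter_eq_bot)
  have psd: "moment_functional m (p * p) \<ge> 0" for p
  proof -
    let ?a = "Polynomial.coeff p" and ?n = "Polynomial.degree p"
    let ?S = "\<lambda>q. Re (\<Sum>i\<le>?n. \<Sum>j\<le>?n. of_real (?a i * ?a j) * E q [replicate (i + j) 1])"
    have "(?S \<longlongrightarrow> Re (\<Sum>i\<le>?n. \<Sum>j\<le>?n. of_real (?a i * ?a j) * of_real (m (i + j)))) F"
      by (intro tendsto_Re tendsto_sum tendsto_mult tendsto_const E_m)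
    moreover have "\<forall>\<^sub>F q in F. ?S q \<ge> 0"
    proof (rule evI)
      fix M N :: nat assume MN: "M \<ge> 1" "N \<ge> 1"
      then interpret gaussian_matrix "\<Omega> M N" N "N * M" "\<lambda>i j \<omega>. X M N \<omega> $$ (i, j)" "D M N" by (rule gm)
      have E: "E (M, N) us = expectation (traces us)" for us by (simp add: E_def)
      show "?S (M, N) \<ge> 0"
        unfolding E using D_hermitian[OF MN] by (rule moments_positive_semidefinite)
    qed
    ultimately have "Re (\<Sum>i\<le>?n. \<Sum>j\<le>?n. of_real (?a i * ?a j) * of_real (m (i + j))) \<ge> 0"
      using nontriv by (rule tendsto_lowerbound)
    then show ?thesis by (simp add: moment_functional_square)
  qed
  obtain \<nu> where \<nu>: "prob_space \<nu>" "sets \<nu> = sets borel" "\<And>k. integrable \<nu> (\<lambda>x. x ^ k)"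
    "\<And>k. integral\<^sup>L \<nu> (\<lambda>x. x ^ k) = m k"
  proof (rule bounded_moment_problem[of m 2 "4 * c"])
    show "m 0 = 1" by (simp add: m_def)
  qed (use psd growth c(2) in auto)

  have "real_law \<nu>" using \<nu> by (simp add: real_law_def)
  moreover have "has_free_cumulants \<nu> K"
    unfolding has_free_cumulants_def by (simp add: \<nu>(4) m_nc)
  moreover have "converges_in_moments \<Omega>
      (\<lambda>M N \<omega>. (1 / of_nat M) \<cdot>\<^sub>m (X M N \<omega> * kronecker (A M) (P N) * mat_adjoint (X M N \<omega>))) \<nu>"
    unfolding converges_in_moments_def F_def[symmetric] \<nu>(4)
  proof (intro allI impI)
    fix k :: nat
    let ?Y = "\<lambda>M N \<omega>. (1 / of_nat M) \<cdot>\<^sub>m (X M N \<omega> * kronecker (A M) (P N) * mat_adjoint (X M N \<omega>))"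
    have "\<forall>\<^sub>F p in F. (case p of (M, N) \<Rightarrow> \<integral>\<omega>. mat_trace (?Y M N \<omega> ^\<^sub>m k) / of_nat N \<partial>\<Omega> M N) = E p [replicate k 1]"
    proof (rule evI)
      fix M N :: nat assume MN: "M \<ge> 1" "N \<ge> 1"
      then interpret gaussian_matrix "\<Omega> M N" N "N * M" "\<lambda>i j \<omega>. X M N \<omega> $$ (i, j)" "D M N" by (rule gm)
      have "mat_trace (?Y M N \<omega> ^\<^sub>m k) / of_nat N = traces [replicate k 1] \<omega>" if "\<omega> \<in> space (\<Omega> M N)" for \<omega>
      proof -
        have Xc: "X M N \<omega> \<in> carrier_mat N (N * M)"
          using X_gaussian[OF MN] that by (auto simp: complex_gaussian_matrix_def)
        have Y: "?Y M N \<omega> \<in> carrier_mat N N" using Xc by (auto simp: mat_adjoint_def)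
        have "mat_trace (?Y M N \<omega> ^\<^sub>m k) = (\<Sum>a<N. word (replicate k 1) a a \<omega>)"
          unfolding mat_trace_def carrier_matD(1)[OF pow_carrier_mat[OF Y]]
          using pow_eq_word[OF gm[OF MN, unfolded D_def B_def] Xc A(1)[OF MN(1)] P(1)[OF MN(2)]]
          by (simp add: D_def B_def)
        then show ?thesis by (simp add: tr_def)
      qed
      then show "(case (M, N) of (M, N) \<Rightarrow> \<integral>\<omega>. mat_trace (?Y M N \<omega> ^\<^sub>m k) / of_nat N \<partial>\<Omega> M N) = E (M, N) [replicate k 1]"
        unfolding E_def prod.case by (rule Bochner_Integration.integral_cong[OF refl])
    qed
    then show "((\<lambda>(M, N). \<integral>\<omega>. mat_trace (?Y M N \<omega> ^\<^sub>m k) / of_nat N \<partial>\<Omega> M N) \<longlongrightarrow> of_real (m k)) F"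
      using E_m[of k] by (simp add: tendsto_cong)
  qed
  ultimately show ?thesis unfolding K_def by blast
qed

end
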